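(* Let the standing assumptions listed in the context hold, with the box-type admissible sets $\mathcal U_{ad}(\mathbf e)$ described there. Let $(\bar{\mathbf u}^*,\bar{\mathbf e})\in\mathbf L^2(\Omega)\times\mathbf E$ and $\bar{\mathbf u}=(\bar u_1,\ldots,\bar u_m)\in\mathcal S(\bar{\mathbf u}^*,\bar{\mathbf e})$. Assume there exists $\varrho>0$ such that $\mathcal U_{ad}(\mathbf e)\neq\emptyset$ for all $\mathbf e$ in the closed ball $\bar B_\varrho(\bar{\mathbf e})\subset\mathbf E$. If $\bar{\mathbf u}$ is a fully stable solution to the parametric variational inequality $\mathbf u^*\in F(\mathbf u,\mathbf e)+N(\mathbf u;\mathcal U_{ad}(\mathbf e))$ corresponding to $(\bar{\mathbf u}^*,\bar{\mathbf e})$, then $\bar{\mathbf u}$ is a local Nash equilibrium associated to the parametric optimal control problems $$\text{minimize}\quad\mathcal J_k(u_k,u_{-k},e_Y,e_k)-(u_k^*,u_k)_{L^2(\Omega)}\quad\text{subject to}\quad u_k\in\mathcal U^k_{ad}(e_k)\qquad(k=1,\ldots,m)$$ with respect to $(\bar{\mathbf u}^*,\bar{\mathbf e})$; that is, for each $k\in\{1,\ldots,m\}$ there exists $\varepsilon>0$ such that $$\bar u_k\in\operatorname{argmin}_{u_k\in\mathcal U^k_{ad}(\bar e_k)\cap\bar B_\varepsilon(\bar u_k)}\Big(\mathcal J_k(u_k,\bar u_{-k},\bar e_Y,\bar e_k)-(\bar u_k^*,u_k)_{L^2(\Omega)}\Big),$$ where $\bar B_\varepsilon(\bar u_k)$ is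 the closed ball in $L^2(\Omega)$.
   Context: Data. Let $m\ge 1$ be an integer and $N\in\{1,2,3\}$. Let $\Omega\subset\mathbb R^N$ be an open bounded domain with Lipschitz boundary $\Gamma$, and let $\mathcal A y=-\sum_{i,j=1}^N\partial_{x_j}(a_{ij}(x)\partial_{x_i}y)$ with $a_{ij}\in L^\infty(\Omega)$ and, for some $\lambda_{\mathcal A}>0$, $\lambda_{\mathcal A}\|\xi\|^2\le\sum_{i,j}a_{ij}(x)\xi_i\xi_j$ for all $\xi\in\mathbb R^N$ and a.a. $x\in\Omega$. Let $\zeta_k,B_k\in L^\infty(\Omega)$ for $k=1,\ldots,m$, with $\zeta_k(x)\ge\zeta_{0k}>0$ for a.a. $x\in\Omega$ ($\zeta_{0k}$ a constant). Let $f,L_1,\ldots,L_m:\Omega\times\mathbb R\to\mathbb R$ be Carathéodory functions of class $C^2$ with respect to the second variable $y$. Assumptions on $f$: $f(\cdot,0)\in L^2(\Omega)$, $\frac{\partial f}{\partial y}(x,y)\ge0$ for a.a. $x\in\Omega$ (and all $y$), and for every $M>0$ there is $C_{f,M}>0$ with $|\frac{\partial f}{\partial y}(x,y)|+|\frac{\partial^2f}{\partial y^2}(x,y)|\le C_{f,M}$ and $|\frac{\partial^2f}{\partial y^2}(x,y_2)-\frac{\partial^2f}{\partial y^2}(x,y_1)|\le C_{f,M}|y_2-y_1|$ for a.a. $x\in\Omega$ and all $|y|,|y_1|,|y_2|\le M$. Assumptions on $L_k$ (each $k$): $L_k(\cdot,0)\in L^1(\Omega)$, and for every $M>0$ there are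 $C_{L_k,M}>0$ and $\psi_{k,M}\in L^2(\Omega)$ with $|\frac{\partial L_k}{\partial y}(x,y)|\le\psi_{k,M}(x)$, $|\frac{\partial^2L_k}{\partial y^2}(x,y)|\le C_{L_k,M}$ and $|\frac{\partial^2L_k}{\partial y^2}(x,y_2)-\frac{\partial^2L_k}{\partial y^2}(x,y_1)|\le C_{L_k,M}|y_2-y_1|$ for a.a. $x\in\Omega$ and all $|y|,|y_1|,|y_2|\le M$. State and costs. For $w\in L^2(\Omega)$, $y_w\in H^1_0(\Omega)\cap C(\bar\Omega)$ denotes the unique weak solution of $\mathcal A y+f(x,y)=w$ in $\Omega$, $y=0$ on $\Gamma$. For $(u_1,\ldots,u_m)\in L^2(\Omega)^m$ put $u=\sum_{i=1}^mB_iu_i$ and $J_k(u_1,\ldots,u_m)=\int_\Omega L_k(x,y_u)\,dx+\frac12\int_\Omega\zeta_ku_k^2\,dx$. One writes $(u_k,u_{-k})$ for $(u_1,\ldots,u_m)$, where $u_{-k}$ collects the components other than $u_k$. Parameters and box constraints. The parameter space is $\mathbf E=E_Y\times E_1\times\cdots\times E_m$ with $E_k=E_{k,J}\times E_{k,\bullet}$, $E_Y\subset L^2(\Omega)$, $E_{k,J}\subset L^2(\Omega)$, $E_{k,\bullet}\subset L^\infty(\Omega)\times L^\infty(\Omega)$, elements $e_k=(e_{k,J},e_{k,\alpha},e_{k,\beta})$, $\mathbf e=(e_Y,e_1,\ldots,e_m)$, and the metric $\|\mathbf e_1-\mathbf e_2\|_{\mathbf E}$ induced by the sum of the $L^2$-norms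 of $e_Y,e_{k,J}$ and the $L^\infty$-norms of $e_{k,\alpha},e_{k,\beta}$. Given $\alpha_k,\beta_k\in L^\infty(\Omega)$ with $\alpha_k(x)<\beta_k(x)$ for a.a. $x\in\Omega$, $$\mathcal U^k_{ad}(e_k)=\{v\in L^2(\Omega):\alpha_k(x)+e_{k,\alpha}(x)\le v(x)\le\beta_k(x)+e_{k,\beta}(x)\text{ for a.a. }x\in\Omega\},\quad \mathcal U_{ad}(\mathbf e)=\prod_{k=1}^m\mathcal U^k_{ad}(e_k).$$ The perturbed cost is $\mathcal J_k(u_k,u_{-k},e_Y,e_k)=J_k(u_k+e_Y,u_{-k})+(e_{k,J},y_{u+e_Y})_{L^2(\Omega)}$ with $u=\sum_iB_iu_i$. Variational inequality. $\mathbf L^2(\Omega)=L^2(\Omega)^m$ is the product Hilbert space with inner product $\langle\mathbf u,\mathbf v\rangle=\sum_k(u_k,v_k)_{L^2(\Omega)}$ and its norm. $F(\mathbf u,\mathbf e)=(\nabla_{u_1}\mathcal J_1(\mathbf u,e_Y,e_1),\ldots,\nabla_{u_m}\mathcal J_m(\mathbf u,e_Y,e_m))\in\mathbf L^2(\Omega)$. $N(\mathbf u;\Theta)$ is the normal cone of convex analysis (empty if $\mathbf u\notin\Theta$). The solution map is $\mathcal S(\mathbf u^*,\mathbf e)=\{\mathbf u\in\mathcal U_{ad}(\mathbf e):\mathbf u^*\in F(\mathbf u,\mathbf e)+N(\mathbf u;\mathcal U_{ad}(\mathbf e))\}$. Full stability. $\bar{\mathbf u}\in\mathcal S(\bar{\mathbf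 u}^*,\bar{\mathbf e})$ is a Lipschitzian (resp. Hölderian) fully stable solution corresponding to $(\bar{\mathbf u}^*,\bar{\mathbf e})$ if there are neighborhoods $\mathcal V_{\bar{\mathbf u}^*},\mathcal V_{\bar{\mathbf e}},\mathcal V_{\bar{\mathbf u}}$ of $\bar{\mathbf u}^*,\bar{\mathbf e},\bar{\mathbf u}$ such that $\mathcal S$ has a single-valued localization $\vartheta:\mathcal V_{\bar{\mathbf u}^*}\times\mathcal V_{\bar{\mathbf e}}\to\mathcal V_{\bar{\mathbf u}}$ (i.e. $\mathcal S(\mathbf u^*,\mathbf e)\cap\mathcal V_{\bar{\mathbf u}}=\{\vartheta(\mathbf u^*,\mathbf e)\}$ there), and constants $\kappa,\ell>0$ with $$\|(\mathbf u_1^*-\mathbf u_2^* )-2\kappa(\vartheta(\mathbf u_1^*,\mathbf e_1)-\vartheta(\mathbf u_2^*,\mathbf e_2))\|\le\|\mathbf u_1^*-\mathbf u_2^*\|+\ell\|\mathbf e_1-\mathbf e_2\|_{\mathbf E}^{s}$$ for all $(\mathbf u_i^*,\mathbf e_i)\in\mathcal V_{\bar{\mathbf u}^*}\times\mathcal V_{\bar{\mathbf e}}$, $i=1,2$, where $s=1$ (resp. $s=1/2$). "Fully stable" without qualifier means both Lipschitzian and Hölderian fully stable. *)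

theory Defs
  imports "HOL-Analysis.Analysis" "HOL-Probability.Essential_Supremum"
begin

text \<open>
  Elements of \<open>L\<^sup>2(\<Omega>)\<close>, \<open>L\<^sup>\<infinity>(\<Omega>)\<close> and \<open>H\<^sup>1\<^sub>0(\<Omega>)\<close> are represented by functions on the whole space, of
  which only the values on \<open>\<Omega>\<close> matter, and two representatives are identified when they agree almost
  everywhere on \<open>\<Omega>\<close>.  The finite type \<open>'m\<close> indexes the players, \<open>'n\<close> the space coordinates.
\<close>

type_synonym 'n scal = "real^'n \<Rightarrow> real"
type_synonym ('n, 'm) control = "'m \<Rightarrow> real^'n \<Rightarrow> real"

section \<open>Lebesgue and Sobolev spaces\<close>

definition L2 :: "(real^'n::finite) set \<Rightarrow> 'n scal set" where
  "L2 \<Omega> = {u \<in> borel_measurable (lebesgue_on \<Omega>). integrable (lebesgue_on \<Omega>) (\<lambda>x. (u x)\<^sup>2)}"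

definition L2_inner :: "(real^'n::finite) set \<Rightarrow> 'n scal \<Rightarrow> 'n scal \<Rightarrow> real" where
  "L2_inner \<Omega> u v = (LINT x|lebesgue_on \<Omega>. u x * v x)"

definition L2_norm :: "(real^'n::finite) set \<Rightarrow> 'n scal \<Rightarrow> real" where
  "L2_norm \<Omega> u = sqrt (L2_inner \<Omega> u u)"

definition Linf :: "(real^'n::finite) set \<Rightarrow> 'n scal set" where
  "Linf \<Omega> = {u \<in> borel_measurable (lebesgue_on \<Omega>). \<exists>C. AE x in lebesgue_on \<Omega>. \<bar>u x\<bar> \<le> C}"

definition Linf_norm :: "(real^'n::finite) set \<Rightarrow> 'n scal \<Rightarrow> real" where
  "Linf_norm \<Omega> u = real_of_ereal (esssup (lebesgue_on \<Omega>) (\<lambda>x. ereal \<bar>u x\<bar>))"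

definition L2m :: "(real^'n::finite) set \<Rightarrow> ('n, 'm::finite) control set" where
  "L2m \<Omega> = {u. \<forall>k. u k \<in> L2 \<Omega>}"

definition L2m_inner ::
  "(real^'n::finite) set \<Rightarrow> ('n, 'm::finite) control \<Rightarrow> ('n, 'm) control \<Rightarrow> real" where
  "L2m_inner \<Omega> u v = (\<Sum>k\<in>UNIV. L2_inner \<Omega> (u k) (v k))"

definition L2m_norm :: "(real^'n::finite) set \<Rightarrow> ('n, 'm::finite) control \<Rightarrow> real" where
  "L2m_norm \<Omega> u = sqrt (L2m_inner \<Omega> u u)"

definition ae_eq :: "(real^'n::finite) set \<Rightarrow> ('n, 'm::finite) control \<Rightarrow> ('n, 'm) control \<Rightarrow> bool" where
  "ae_eq \<Omega> u v \<longleftrightarrow> (\<forall>k. AE x in lebesgue_on \<Omega>. u k x = v k x)"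

text \<open>\<open>C1c \<Omega> \<phi> D\<close>: \<open>\<phi>\<close> is a \<open>C\<^sup>1\<close> function with compact support in \<open>\<Omega>\<close> and gradient \<open>D\<close>.\<close>

definition C1c :: "(real^'n::finite) set \<Rightarrow> 'n scal \<Rightarrow> (real^'n \<Rightarrow> real^'n) \<Rightarrow> bool" where
  "C1c \<Omega> \<phi> D \<longleftrightarrow> (\<forall>x. GDERIV \<phi> x :> D x) \<and> continuous_on UNIV D \<and>
     (\<exists>K. compact K \<and> K \<subseteq> \<Omega> \<and> (\<forall>x. x \<notin> K \<longrightarrow> \<phi> x = 0))"

definition weak_gradient :: "(real^'n::finite) set \<Rightarrow> 'n scal \<Rightarrow> (real^'n \<Rightarrow> real^'n) \<Rightarrow> bool" where
  "weak_gradient \<Omega> y G \<longleftrightarrow> (\<forall>\<phi> D i. C1c \<Omega> \<phi> D \<longrightarrow>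
     (LINT x|lebesgue_on \<Omega>. y x * D x $ i) = - (LINT x|lebesgue_on \<Omega>. G x $ i * \<phi> x))"

definition H1 :: "(real^'n::finite) set \<Rightarrow> 'n scal \<Rightarrow> (real^'n \<Rightarrow> real^'n) \<Rightarrow> bool" where
  "H1 \<Omega> y G \<longleftrightarrow> y \<in> L2 \<Omega> \<and> (\<forall>i. (\<lambda>x. G x $ i) \<in> L2 \<Omega>) \<and> weak_gradient \<Omega> y G"

text \<open>
  \<open>H10 \<Omega> y G\<close>: \<open>y \<in> H\<^sup>1\<^sub>0(\<Omega>)\<close> with weak gradient \<open>G\<close>, where \<open>H\<^sup>1\<^sub>0(\<Omega>)\<close> is the closure of \<open>C\<^sup>1\<^sub>c(\<Omega>)\<close> in
  \<open>H\<^sup>1(\<Omega>)\<close> (as in Brezis and in Gilbarg--Trudinger).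
\<close>

definition H10 :: "(real^'n::finite) set \<Rightarrow> 'n scal \<Rightarrow> (real^'n \<Rightarrow> real^'n) \<Rightarrow> bool" where
  "H10 \<Omega> y G \<longleftrightarrow> H1 \<Omega> y G \<and>
     (\<exists>\<phi> D. (\<forall>j::nat. C1c \<Omega> (\<phi> j) (D j)) \<and>
        (\<lambda>j. L2_norm \<Omega> (\<lambda>x. \<phi> j x - y x)) \<longlonglongrightarrow> 0 \<and>
        (\<forall>i. (\<lambda>j. L2_norm \<Omega> (\<lambda>x. D j x $ i - G x $ i)) \<longlonglongrightarrow> 0))"

text \<open>
  Near each boundary point, \<open>\<Omega>\<close> is the part strictly above the graph of a Lipschitz function over the
  hyperplane orthogonal to some unit vector \<open>\<nu>\<close>.
\<close>

definition lipschitz_boundary :: "(real^'n::finite) set \<Rightarrow> bool" where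
  "lipschitz_boundary \<Omega> \<longleftrightarrow> (\<forall>p\<in>frontier \<Omega>. \<exists>r>0. \<exists>\<nu> \<gamma> C. norm \<nu> = 1 \<and>
     C-lipschitz_on {z. z \<bullet> \<nu> = 0} \<gamma> \<and>
     (\<forall>x\<in>ball p r. x \<in> \<Omega> \<longleftrightarrow> x \<bullet> \<nu> > \<gamma> (x - (x \<bullet> \<nu>) *\<^sub>R \<nu>)))"

section \<open>Data of the problem\<close>

definition elliptic :: "(real^'n::finite) set \<Rightarrow> ('n \<Rightarrow> 'n \<Rightarrow> 'n scal) \<Rightarrow> bool" where
  "elliptic \<Omega> a \<longleftrightarrow> (\<exists>\<Lambda>>0. AE x in lebesgue_on \<Omega>. \<forall>\<xi>::real^'n.
     \<Lambda> * (norm \<xi>)\<^sup>2 \<le> (\<Sum>i\<in>UNIV. \<Sum>j\<in>UNIV. a i j x * \<xi> $ i * \<xi> $ j))"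

definition C2_fun :: "(real \<Rightarrow> real) \<Rightarrow> bool" where
  "C2_fun g \<longleftrightarrow> (\<forall>y. g differentiable at y) \<and> (\<forall>y. deriv g differentiable at y) \<and>
     continuous_on UNIV (deriv (deriv g))"

text \<open>Continuity in the second variable is part of \<^const>\<open>C2_fun\<close>.\<close>

definition caratheodory_C2 :: "(real^'n::finite) set \<Rightarrow> (real^'n \<Rightarrow> real \<Rightarrow> real) \<Rightarrow> bool" where
  "caratheodory_C2 \<Omega> f \<longleftrightarrow> (\<forall>y. (\<lambda>x. f x y) \<in> borel_measurable (lebesgue_on \<Omega>)) \<and>
     (AE x in lebesgue_on \<Omega>. C2_fun (f x))"

definition nonlinearity_assms :: "(real^'n::finite) set \<Rightarrow> (real^'n \<Rightarrow> real \<Rightarrow> real) \<Rightarrow> bool" where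
  "nonlinearity_assms \<Omega> f \<longleftrightarrow> caratheodory_C2 \<Omega> f \<and> (\<lambda>x. f x 0) \<in> L2 \<Omega> \<and>
     (AE x in lebesgue_on \<Omega>. \<forall>y. deriv (f x) y \<ge> 0) \<and>
     (\<forall>M>0. \<exists>C>0. AE x in lebesgue_on \<Omega>.
        (\<forall>y. \<bar>y\<bar> \<le> M \<longrightarrow> \<bar>deriv (f x) y\<bar> + \<bar>deriv (deriv (f x)) y\<bar> \<le> C) \<and>
        (\<forall>y1 y2. \<bar>y1\<bar> \<le> M \<and> \<bar>y2\<bar> \<le> M \<longrightarrow>
           \<bar>deriv (deriv (f x)) y2 - deriv (deriv (f x)) y1\<bar> \<le> C * \<bar>y2 - y1\<bar>))"

definition integrand_assms :: "(real^'n::finite) set \<Rightarrow> (real^'n \<Rightarrow> real \<Rightarrow> real) \<Rightarrow> bool" where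
  "integrand_assms \<Omega> l \<longleftrightarrow> caratheodory_C2 \<Omega> l \<and> integrable (lebesgue_on \<Omega>) (\<lambda>x. l x 0) \<and>
     (\<forall>M>0. \<exists>C>0. \<exists>\<psi>\<in>L2 \<Omega>. AE x in lebesgue_on \<Omega>.
        (\<forall>y. \<bar>y\<bar> \<le> M \<longrightarrow> \<bar>deriv (l x) y\<bar> \<le> \<psi> x \<and> \<bar>deriv (deriv (l x)) y\<bar> \<le> C) \<and>
        (\<forall>y1 y2. \<bar>y1\<bar> \<le> M \<and> \<bar>y2\<bar> \<le> M \<longrightarrow>
           \<bar>deriv (deriv (l x)) y2 - deriv (deriv (l x)) y1\<bar> \<le> C * \<bar>y2 - y1\<bar>))"

section \<open>State equation\<close>

definition weak_solution ::
  "(real^'n::finite) set \<Rightarrow> ('n \<Rightarrow> 'n \<Rightarrow> 'n scal) \<Rightarrow> (real^'n \<Rightarrow> real \<Rightarrow> real) \<Rightarrow> 'n scal \<Rightarrow> 'n scal \<Rightarrow> bool" where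
  "weak_solution \<Omega> a f w y \<longleftrightarrow> continuous_on (closure \<Omega>) y \<and>
     (\<exists>G. H10 \<Omega> y G \<and>
        (\<forall>z Z. H10 \<Omega> z Z \<longrightarrow>
           (LINT x|lebesgue_on \<Omega>. (\<Sum>i\<in>UNIV. \<Sum>j\<in>UNIV. a i j x * G x $ i * Z x $ j)) +
           (LINT x|lebesgue_on \<Omega>. f x (y x) * z x) = (LINT x|lebesgue_on \<Omega>. w x * z x)))"

text \<open>
  \<open>state_map \<Omega> a f y\<close>: for every \<open>w \<in> L\<^sup>2(\<Omega>)\<close>, \<open>y w\<close> is the unique weak solution in
  \<open>H\<^sup>1\<^sub>0(\<Omega>) \<inter> C(closure \<Omega>)\<close> of the state equation with right-hand side \<open>w\<close>.  This determines \<open>y w\<close> on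
  \<open>closure \<Omega>\<close>, so that \<open>y\<close> does not depend on the chosen representative of \<open>w\<close> there.
\<close>

definition state_map ::
  "(real^'n::finite) set \<Rightarrow> ('n \<Rightarrow> 'n \<Rightarrow> 'n scal) \<Rightarrow> (real^'n \<Rightarrow> real \<Rightarrow> real) \<Rightarrow> ('n scal \<Rightarrow> 'n scal) \<Rightarrow> bool" where
  "state_map \<Omega> a f y \<longleftrightarrow> (\<forall>w\<in>L2 \<Omega>. weak_solution \<Omega> a f w (y w) \<and>
     (\<forall>z. weak_solution \<Omega> a f w z \<longrightarrow> (\<forall>x\<in>closure \<Omega>. z x = y w x)))"

section \<open>Parameters, admissible sets and costs\<close>

record ('x, 'm) param =
  eY :: "'x \<Rightarrow> real"
  eJ :: "'m \<Rightarrow> 'x \<Rightarrow> real"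
  e\<alpha> :: "'m \<Rightarrow> 'x \<Rightarrow> real"
  e\<beta> :: "'m \<Rightarrow> 'x \<Rightarrow> real"

definition param_space ::
  "'n::finite scal set \<Rightarrow> ('m::finite \<Rightarrow> 'n scal set) \<Rightarrow> ('m \<Rightarrow> ('n scal \<times> 'n scal) set) \<Rightarrow>
   (real^'n, 'm) param set" where
  "param_space E\<^sub>Y E\<^sub>J E\<^sub>B = {e. eY e \<in> E\<^sub>Y \<and> (\<forall>k. eJ e k \<in> E\<^sub>J k) \<and> (\<forall>k. (e\<alpha> e k, e\<beta> e k) \<in> E\<^sub>B k)}"

definition param_dist ::
  "(real^'n::finite) set \<Rightarrow> (real^'n, 'm::finite) param \<Rightarrow> (real^'n, 'm) param \<Rightarrow> real" where
  "param_dist \<Omega> e e' = L2_norm \<Omega> (\<lambda>x. eY e x - eY e' x) +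
     (\<Sum>k\<in>UNIV. L2_norm \<Omega> (\<lambda>x. eJ e k x - eJ e' k x) +
        Linf_norm \<Omega> (\<lambda>x. e\<alpha> e k x - e\<alpha> e' k x) + Linf_norm \<Omega> (\<lambda>x. e\<beta> e k x - e\<beta> e' k x))"

definition Uad_k ::
  "(real^'n::finite) set \<Rightarrow> ('n, 'm::finite) control \<Rightarrow> ('n, 'm) control \<Rightarrow> (real^'n, 'm) param \<Rightarrow> 'm \<Rightarrow>
   'n scal set" where
  "Uad_k \<Omega> \<alpha> \<beta> e k = {v \<in> L2 \<Omega>. AE x in lebesgue_on \<Omega>.
     \<alpha> k x + e\<alpha> e k x \<le> v x \<and> v x \<le> \<beta> k x + e\<beta> e k x}"

definition Uad ::
  "(real^'n::finite) set \<Rightarrow> ('n, 'm::finite) control \<Rightarrow> ('n, 'm) control \<Rightarrow> (real^'n, 'm) param \<Rightarrow>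
   ('n, 'm) control set" where
  "Uad \<Omega> \<alpha> \<beta> e = {u. \<forall>k. u k \<in> Uad_k \<Omega> \<alpha> \<beta> e k}"

definition total_control ::
  "('n::finite, 'm::finite) control \<Rightarrow> ('n, 'm) control \<Rightarrow> 'n scal" where
  "total_control B u = (\<lambda>x. \<Sum>i\<in>UNIV. B i x * u i x)"

definition J_cost ::
  "(real^'n::finite) set \<Rightarrow> ('n, 'm::finite) control \<Rightarrow> ('n, 'm) control \<Rightarrow>
   ('m \<Rightarrow> real^'n \<Rightarrow> real \<Rightarrow> real) \<Rightarrow> ('n scal \<Rightarrow> 'n scal) \<Rightarrow> 'm \<Rightarrow> ('n, 'm) control \<Rightarrow> real" where
  "J_cost \<Omega> \<zeta> B L y k u =
     (LINT x|lebesgue_on \<Omega>. L k x (y (total_control B u) x)) +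
     1/2 * (LINT x|lebesgue_on \<Omega>. \<zeta> k x * (u k x)\<^sup>2)"

text \<open>
  In the first term \<open>e\<^sub>Y\<close> is added to the \<open>k\<close>-th control only, so that the state occurring there belongs
  to the right-hand side \<open>(\<Sum>i. B\<^sub>i u\<^sub>i) + B\<^sub>k e\<^sub>Y\<close>; in the second term it is added to the total control.
\<close>

definition J_pert ::
  "(real^'n::finite) set \<Rightarrow> ('n, 'm::finite) control \<Rightarrow> ('n, 'm) control \<Rightarrow>
   ('m \<Rightarrow> real^'n \<Rightarrow> real \<Rightarrow> real) \<Rightarrow> ('n scal \<Rightarrow> 'n scal) \<Rightarrow> 'm \<Rightarrow> (real^'n, 'm) param \<Rightarrow>
   ('n, 'm) control \<Rightarrow> real" where
  "J_pert \<Omega> \<zeta> B L y k e u =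
     J_cost \<Omega> \<zeta> B L y k (u(k := (\<lambda>x. u k x + eY e x))) +
     L2_inner \<Omega> (eJ e k) (y (\<lambda>x. total_control B u x + eY e x))"

section \<open>The variational inequality\<close>

text \<open>Frechet differentiability on \<open>L\<^sup>2(\<Omega>)\<close>, with derivative represented by \<open>g \<in> L\<^sup>2(\<Omega>)\<close>.\<close>

definition has_L2_gradient ::
  "(real^'n::finite) set \<Rightarrow> ('n scal \<Rightarrow> real) \<Rightarrow> 'n scal \<Rightarrow> 'n scal \<Rightarrow> bool" where
  "has_L2_gradient \<Omega> \<Phi> u g \<longleftrightarrow> g \<in> L2 \<Omega> \<and>
     (\<forall>\<epsilon>>0. \<exists>\<delta>>0. \<forall>h\<in>L2 \<Omega>. L2_norm \<Omega> h < \<delta> \<longrightarrow>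
        \<bar>\<Phi> (\<lambda>x. u x + h x) - \<Phi> u - L2_inner \<Omega> g h\<bar> \<le> \<epsilon> * L2_norm \<Omega> h)"

text \<open>The gradient is unique only almost everywhere, hence \<open>SOME\<close> instead of \<open>THE\<close>.\<close>

definition L2_gradient :: "(real^'n::finite) set \<Rightarrow> ('n scal \<Rightarrow> real) \<Rightarrow> 'n scal \<Rightarrow> 'n scal" where
  "L2_gradient \<Omega> \<Phi> u = (SOME g. has_L2_gradient \<Omega> \<Phi> u g)"

definition F_map ::
  "(real^'n::finite) set \<Rightarrow> ('n, 'm::finite) control \<Rightarrow> ('n, 'm) control \<Rightarrow>
   ('m \<Rightarrow> real^'n \<Rightarrow> real \<Rightarrow> real) \<Rightarrow> ('n scal \<Rightarrow> 'n scal) \<Rightarrow> ('n, 'm) control \<Rightarrow>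
   (real^'n, 'm) param \<Rightarrow> ('n, 'm) control" where
  "F_map \<Omega> \<zeta> B L y u e = (\<lambda>k. L2_gradient \<Omega> (\<lambda>v. J_pert \<Omega> \<zeta> B L y k e (u(k := v))) (u k))"

definition normal_cone ::
  "(real^'n::finite) set \<Rightarrow> ('n, 'm::finite) control \<Rightarrow> ('n, 'm) control set \<Rightarrow> ('n, 'm) control set" where
  "normal_cone \<Omega> u \<Theta> = (if u \<in> \<Theta>
     then {p \<in> L2m \<Omega>. \<forall>v\<in>\<Theta>. L2m_inner \<Omega> p (\<lambda>k x. v k x - u k x) \<le> 0} else {})"

definition solution_map ::
  "(real^'n::finite) set \<Rightarrow> ('n, 'm::finite) control \<Rightarrow> ('n, 'm) control \<Rightarrow>
   ('m \<Rightarrow> real^'n \<Rightarrow> real \<Rightarrow> real) \<Rightarrow> ('n scal \<Rightarrow> 'n scal) \<Rightarrow> ('n, 'm) control \<Rightarrow> ('n, 'm) control \<Rightarrow>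
   ('n, 'm) control \<Rightarrow> (real^'n, 'm) param \<Rightarrow> ('n, 'm) control set" where
  "solution_map \<Omega> \<zeta> B L y \<alpha> \<beta> ustar e = {u \<in> Uad \<Omega> \<alpha> \<beta> e.
     \<exists>p\<in>normal_cone \<Omega> u (Uad \<Omega> \<alpha> \<beta> e). ae_eq \<Omega> ustar (\<lambda>k x. F_map \<Omega> \<zeta> B L y u e k x + p k x)}"

section \<open>Full stability and Nash equilibria\<close>

definition nbhd_L2m ::
  "(real^'n::finite) set \<Rightarrow> ('n, 'm::finite) control \<Rightarrow> ('n, 'm) control set \<Rightarrow> bool" where
  "nbhd_L2m \<Omega> u V \<longleftrightarrow> V \<subseteq> L2m \<Omega> \<and>
     (\<exists>r>0. \<forall>v\<in>L2m \<Omega>. L2m_norm \<Omega> (\<lambda>k x. v k x - u k x) < r \<longrightarrow> v \<in> V)"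

definition nbhd_param ::
  "(real^'n::finite) set \<Rightarrow> (real^'n, 'm::finite) param set \<Rightarrow> (real^'n, 'm) param \<Rightarrow>
   (real^'n, 'm) param set \<Rightarrow> bool" where
  "nbhd_param \<Omega> E e V \<longleftrightarrow> V \<subseteq> E \<and> (\<exists>r>0. \<forall>e'\<in>E. param_dist \<Omega> e' e < r \<longrightarrow> e' \<in> V)"

text \<open>
  \<open>fully_stable_exp s \<Omega> E S ubarstar ebar ubar\<close>: full stability, with exponent \<open>s\<close> of the parameter
  term, of \<open>ubar\<close> for the solution map \<open>S\<close> on \<open>L\<^sup>2(\<Omega>)\<^sup>m \<times> E\<close>.
\<close>

definition fully_stable_exp ::
  "real \<Rightarrow> (real^'n::finite) set \<Rightarrow> (real^'n, 'm::finite) param set \<Rightarrow>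
   (('n, 'm) control \<Rightarrow> (real^'n, 'm) param \<Rightarrow> ('n, 'm) control set) \<Rightarrow>
   ('n, 'm) control \<Rightarrow> (real^'n, 'm) param \<Rightarrow> ('n, 'm) control \<Rightarrow> bool" where
  "fully_stable_exp s \<Omega> E S ubarstar ebar ubar \<longleftrightarrow> ubar \<in> S ubarstar ebar \<and>
     (\<exists>Vstar Ve Vu \<theta> \<kappa> l.
        nbhd_L2m \<Omega> ubarstar Vstar \<and> nbhd_param \<Omega> E ebar Ve \<and> nbhd_L2m \<Omega> ubar Vu \<and> \<kappa> > 0 \<and> l > 0 \<and>
        (\<forall>p\<in>Vstar. \<forall>e\<in>Ve. \<theta> p e \<in> S p e \<inter> Vu \<and> (\<forall>v\<in>S p e \<inter> Vu. ae_eq \<Omega> v (\<theta> p e))) \<and>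
        (\<forall>p1\<in>Vstar. \<forall>p2\<in>Vstar. \<forall>e1\<in>Ve. \<forall>e2\<in>Ve.
           L2m_norm \<Omega> (\<lambda>k x. (p1 k x - p2 k x) - 2 * \<kappa> * (\<theta> p1 e1 k x - \<theta> p2 e2 k x))
             \<le> L2m_norm \<Omega> (\<lambda>k x. p1 k x - p2 k x) + l * param_dist \<Omega> e1 e2 powr s))"

definition lipschitzian_fully_stable where
  "lipschitzian_fully_stable = fully_stable_exp 1"

definition hoelderian_fully_stable where
  "hoelderian_fully_stable = fully_stable_exp (1/2)"

definition fully_stable where
  "fully_stable \<Omega> E S ubarstar ebar ubar \<longleftrightarrow>
     lipschitzian_fully_stable \<Omega> E S ubarstar ebar ubar \<and>
     hoelderian_fully_stable \<Omega> E S ubarstar ebar ubar"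

definition local_nash_equilibrium ::
  "(real^'n::finite) set \<Rightarrow> ('n, 'm::finite) control \<Rightarrow> ('n, 'm) control \<Rightarrow>
   ('m \<Rightarrow> real^'n \<Rightarrow> real \<Rightarrow> real) \<Rightarrow> ('n scal \<Rightarrow> 'n scal) \<Rightarrow> ('n, 'm) control \<Rightarrow> ('n, 'm) control \<Rightarrow>
   ('n, 'm) control \<Rightarrow> (real^'n, 'm) param \<Rightarrow> ('n, 'm) control \<Rightarrow> bool" where
  "local_nash_equilibrium \<Omega> \<zeta> B L y \<alpha> \<beta> ustar e u \<longleftrightarrow> (\<forall>k. \<exists>\<epsilon>>0.
     is_arg_min (\<lambda>v. J_pert \<Omega> \<zeta> B L y k e (u(k := v)) - L2_inner \<Omega> (ustar k) v)
       (\<lambda>v. v \<in> Uad_k \<Omega> \<alpha> \<beta> e k \<and> L2_norm \<Omega> (\<lambda>x. v x - u k x) \<le> \<epsilon>) (u k))"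

end

theory Submission
  imports Defs
begin

text \<open>
  With the parameter fixed, full stability says that the inverse of \<open>u \<mapsto> F(u) + N(u)\<close> is locally single
  valued and strongly monotone around the reference point.  Fix a player \<open>k\<close>, freeze the other players
  at \<open>ubar\<close> and run the projected gradient method \<open>v' = Proj(v - \<tau> \<nabla>\<phi>(v))\<close> for the reduced cost
  \<open>\<phi>\<close> of that player.  Each iterate solves the variational inequality with a right-hand side close to
  \<open>ubarstar\<close> (the components of the other players are adjusted so that their normals do not change), so
  that strong monotonicity forces linear convergence to \<open>ubar k\<close>; since \<open>\<phi>\<close> decreases along the iteration,
  \<open>\<phi>(ubar k) \<le> \<phi>(v)\<close> for every starting point \<open>v\<close> nearby.  No existence of minimizers is needed.

  This requires the gradient of \<open>\<phi>\<close> to exist and to be locally Lipschitz.  The gradient is given by an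
  adjoint state (Lax--Milgram).  The necessary \<open>L\<^sup>\<infinity>\<close> bounds on states come from the comparison principle
  together with the assumed solvability of the state equation for every right-hand side in \<open>L\<^sup>2\<close>, instead
  of elliptic regularity theory.
\<close>

section \<open>Semi-inner-product spaces\<close>

text \<open>The reduced cost of one player need not be convex, so criticality of
  \<open>ubar k\<close> alone says nothing about minimality, and strong monotonicity is available
  only on the graph of F + N, not at an arbitrary competitor v. The gradient step moves from v to a
  point of that graph: the projection residual, divided by the step size, supplies a normal, and
  what remains of the right-hand side is of the order of the length of the step. The estimate for
  the whole game passes to one player because in the pairing of right-hand sides with U - ubar only
  component k survives. The regularity of the gradient is not a pure L2 matter. The error of
  linearizing f is quadratic in the difference of two states, and the change of the coefficient
  \<open>deriv f\<close> multiplies an adjoint state; to bound either in L2 by L2 norms, one factor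
  has to be small in the supremum norm. This is why states need a Lipschitz estimate in that norm.
  Functions stand for their classes modulo null sets, so every norm below is a seminorm.\<close>

lemma quadratic_discriminant_le:
  fixes a b c :: real
  assumes "\<And>t. 0 \<le> a * t\<^sup>2 + 2 * b * t + c" "0 \<le> a" "0 \<le> c"
  shows "b\<^sup>2 \<le> a * c"
proof (cases "a = 0")
  case True
  have "b = 0"
  proof (rule ccontr)
    assume "b \<noteq> 0"
    \<comment> \<open>With \<open>a = 0\<close> this argument makes the quadratic expression equal
      to -1.\<close>
    then show False using assms(1)[of "- (c + 1) / (2 * b)"] True by simp
  qed
  then show ?thesis using True by simp
next
  case False
  then have "0 \<le> a * (a * (- b / a)\<^sup>2 + 2 * b * (- b / a) + c)"
    using assms(1)[of "- b / a"] assms(2) by (intro mult_nonneg_nonneg)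
  also have "\<dots> = a * c - b\<^sup>2" using False by (simp add: field_simps power2_eq_square)
  finally show ?thesis by simp
qed

text \<open>The vector operations carry no axioms of their own. Vectors agree only up to seminorm
  zero, so identities between them are checked through \<open>ip\<close> alone. The carrier is a
  set, which admits L2, its powers, and pairs of an H10 function with its gradient.\<close>

locale semi_ip =
  fixes K :: "'v set" and add sub :: "'v \<Rightarrow> 'v \<Rightarrow> 'v" and sc :: "real \<Rightarrow> 'v \<Rightarrow> 'v"
    and ip :: "'v \<Rightarrow> 'v \<Rightarrow> real" and nrm :: "'v \<Rightarrow> real"
  assumes nonempty: "K \<noteq> {}"
    and add_closed [simp, intro]: "u \<in> K \<Longrightarrow> v \<in> K \<Longrightarrow> add u v \<in> K"
    and sub_closed [simp, intro]: "u \<in> K \<Longrightarrow> v \<in> K \<Longrightarrow> sub u v \<in> K"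
    and sc_closed [simp, intro]: "u \<in> K \<Longrightarrow> sc c u \<in> K"
    and ip_add_left: "u \<in> K \<Longrightarrow> v \<in> K \<Longrightarrow> w \<in> K \<Longrightarrow> ip (add u v) w = ip u w + ip v w"
    and ip_sub_left: "u \<in> K \<Longrightarrow> v \<in> K \<Longrightarrow> w \<in> K \<Longrightarrow> ip (sub u v) w = ip u w - ip v w"
    and ip_sc_left: "u \<in> K \<Longrightarrow> w \<in> K \<Longrightarrow> ip (sc c u) w = c * ip u w"
    and ip_sym: "u \<in> K \<Longrightarrow> v \<in> K \<Longrightarrow> ip u v = ip v u"
    and ip_nonneg: "u \<in> K \<Longrightarrow> 0 \<le> ip u u"
    and nrm_eq: "nrm u = sqrt (ip u u)"
begin

lemma ip_add_right: "u \<in> K \<Longrightarrow> v \<in> K \<Longrightarrow> w \<in> K \<Longrightarrow> ip w (add u v) = ip w u + ip w v"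
  by (metis add_closed ip_add_left ip_sym)

lemma ip_sub_right: "u \<in> K \<Longrightarrow> v \<in> K \<Longrightarrow> w \<in> K \<Longrightarrow> ip w (sub u v) = ip w u - ip w v"
  by (metis sub_closed ip_sub_left ip_sym)

lemma ip_sc_right: "u \<in> K \<Longrightarrow> w \<in> K \<Longrightarrow> ip w (sc c u) = c * ip w u"
  by (metis sc_closed ip_sc_left ip_sym)

lemmas ip_rules = ip_add_left ip_sub_left ip_sc_left ip_add_right ip_sub_right ip_sc_right

lemma nrm_nonneg: "u \<in> K \<Longrightarrow> 0 \<le> nrm u"
  by (simp add: nrm_eq ip_nonneg)

lemma nrm_sq: "u \<in> K \<Longrightarrow> (nrm u)\<^sup>2 = ip u u"
  by (simp add: nrm_eq ip_nonneg)

lemma cauchy_schwarz: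
  assumes "u \<in> K" "v \<in> K"
  shows "\<bar>ip u v\<bar> \<le> nrm u * nrm v"
proof -
  have "0 \<le> ip v v * t\<^sup>2 + 2 * ip u v * t + ip u u" for t
    using ip_nonneg[of "add u (sc t v)"] assms ip_sym[of u v]
    by (simp add: ip_rules algebra_simps power2_eq_square)
  then have "(ip u v)\<^sup>2 \<le> ip v v * ip u u"
    by (rule quadratic_discriminant_le) (use assms ip_nonneg in auto)
  also have "\<dots> = (nrm u * nrm v)\<^sup>2"
    using assms by (simp add: power_mult_distrib nrm_sq)
  finally show ?thesis
    using assms nrm_nonneg by (metis abs_le_square_iff abs_of_nonneg mult_nonneg_nonneg)
qed

lemma nrm_add_le:
  assumes "u \<in> K" "v \<in> K" shows "nrm (add u v) \<le> nrm u + nrm v"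
proof (rule power2_le_imp_le)
  have "(nrm (add u v))\<^sup>2 = ip u u + 2 * ip u v + ip v v"
    using assms ip_sym[of u v] by (simp add: nrm_sq ip_rules)
  also have "\<dots> \<le> (nrm u + nrm v)\<^sup>2"
    using cauchy_schwarz[OF assms] assms by (simp add: power2_sum nrm_sq)
  finally show "(nrm (add u v))\<^sup>2 \<le> (nrm u + nrm v)\<^sup>2" .
qed (use assms nrm_nonneg in auto)

lemma nrm_sc: "u \<in> K \<Longrightarrow> nrm (sc c u) = \<bar>c\<bar> * nrm u"
  by (simp add: nrm_eq ip_rules real_sqrt_mult flip: mult.assoc)

lemma nrm_sub_commute: "u \<in> K \<Longrightarrow> v \<in> K \<Longrightarrow> nrm (sub u v) = nrm (sub v u)"
  by (simp add: nrm_eq ip_rules)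

lemma nrm_sub_triangle:
  assumes "u \<in> K" "v \<in> K" "w \<in> K" shows "nrm (sub u w) \<le> nrm (sub u v) + nrm (sub v w)"
proof -
  have "nrm (sub u w) = nrm (add (sub u v) (sub v w))"
    using assms by (simp add: nrm_eq ip_rules)
  then show ?thesis using assms nrm_add_le by simp
qed

lemma nrm_le_nrm_sub:
  assumes "u \<in> K" "v \<in> K" shows "nrm u \<le> nrm v + nrm (sub u v)"
proof -
  have "nrm u = nrm (add v (sub u v))"
    using assms by (simp add: nrm_eq ip_rules)
  then show ?thesis using assms nrm_add_le by simp
qed

lemma ip_tendsto:
  assumes "\<And>n. x n \<in> K" "l \<in> K" "v \<in> K" "(\<lambda>n. nrm (sub (x n) l)) \<longlonglongrightarrow> 0"
  shows "(\<lambda>n. ip (x n) v) \<longlonglongrightarrow> ip l v"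
proof -
  have "(\<lambda>n. ip (x n) v - ip l v) \<longlonglongrightarrow> 0"
  proof (rule Lim_null_comparison)
    show "\<forall>\<^sub>F n in sequentially. norm (ip (x n) v - ip l v) \<le> nrm (sub (x n) l) * nrm v"
      using cauchy_schwarz[of "sub (x n) l" v for n] assms by (auto simp: ip_rules)
    show "(\<lambda>n. nrm (sub (x n) l) * nrm v) \<longlonglongrightarrow> 0"
      using tendsto_mult[OF assms(4) tendsto_const] by simp
  qed
  then show ?thesis using LIM_zero_iff by blast
qed

lemma nrm_tendsto:
  assumes "\<And>n. x n \<in> K" "l \<in> K" "(\<lambda>n. nrm (sub (x n) l)) \<longlonglongrightarrow> 0"
  shows "(\<lambda>n. nrm (x n)) \<longlonglongrightarrow> nrm l"
proof -
  have "(\<lambda>n. nrm (x n) - nrm l) \<longlonglongrightarrow> 0"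
  proof (rule Lim_null_comparison[OF _ assms(3)])
    show "\<forall>\<^sub>F n in sequentially. norm (nrm (x n) - nrm l) \<le> nrm (sub (x n) l)"
      using nrm_le_nrm_sub[of "x n" l for n] nrm_le_nrm_sub[of l "x n" for n] assms nrm_sub_commute[of l "x n" for n]
      by (auto simp: abs_le_iff add.commute algebra_simps)
  qed
  then show ?thesis using LIM_zero_iff by blast
qed

text \<open>Projected gradient steps decrease \<open>\<phi>\<close> and, by monotonicity, contract the distance to \<open>u\<^sub>0\<close>.\<close>

lemma projected_gradient_minimum:
  assumes CK: "C \<subseteq> K" and u0: "u0 \<in> C" and pos: "r > 0" "Lp > 0" "s > 0" "\<kappa> > 0"
    and gK: "\<And>v. v \<in> C \<Longrightarrow> nrm (sub v u0) < r \<Longrightarrow> g v \<in> K"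
    and quad: "\<And>v w. v \<in> C \<Longrightarrow> w \<in> C \<Longrightarrow> nrm (sub v u0) < r \<Longrightarrow> nrm (sub w u0) < r \<Longrightarrow>
      \<phi> w \<le> \<phi> v + ip (g v) (sub w v) + Lp * (nrm (sub w v))\<^sup>2"
    and lip: "\<And>v w. v \<in> C \<Longrightarrow> w \<in> C \<Longrightarrow> nrm (sub v u0) < r \<Longrightarrow> nrm (sub w u0) < r \<Longrightarrow>
      nrm (sub (g v) (g w)) \<le> Lp * nrm (sub v w)"
    and proj: "\<And>x. x \<in> K \<Longrightarrow> \<exists>v\<in>C. \<forall>w\<in>C. ip (sub x v) (sub w v) \<le> 0"
    and crit: "\<And>w. w \<in> C \<Longrightarrow> 0 \<le> ip (g u0) (sub w u0)"
    and mono: "\<And>v n. v \<in> C \<Longrightarrow> nrm (sub v u0) < r \<Longrightarrow> n \<in> K \<Longrightarrow> (\<And>w. w \<in> C \<Longrightarrow> ip n (sub w v) \<le> 0) \<Longrightarrow>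
      nrm (add (g v) n) < s \<Longrightarrow> \<kappa> * (nrm (sub v u0))\<^sup>2 \<le> ip (add (g v) n) (sub v u0)"
  shows "\<exists>\<epsilon>>0. \<forall>v\<in>C. nrm (sub v u0) \<le> \<epsilon> \<longrightarrow> \<phi> u0 \<le> \<phi> v"
proof -
  have inK: "v \<in> C \<Longrightarrow> v \<in> K" for v using CK by auto
  \<comment> \<open>\<open>1 / Lp\<close> makes the step decrease \<open>\<phi>\<close>;
    \<open>\<kappa> / Lp\<^sup>2\<close> lets the monotonicity gain absorb the gradient
    error.\<close>
  define \<tau> where "\<tau> = min (1 / Lp) (\<kappa> / Lp\<^sup>2)"
  \<comment> \<open>A step from radius \<open>\<epsilon>\<close> ends within radius
    \<open>2 * \<epsilon>\<close> and has length at most \<open>3 * \<epsilon>\<close>. The first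
    bound keeps it inside the ball of radius \<open>r\<close>, the second keeps the new right-hand
    side below \<open>s\<close>.\<close>
  define \<epsilon> where "\<epsilon> = min (r / 4) (s / (6 * (1 / \<tau> + Lp)))"
  have \<tau>: "\<tau> > 0" "\<tau> * Lp \<le> 1" "\<tau> * Lp\<^sup>2 \<le> \<kappa>"
    using pos by (auto simp: \<tau>_def min_def field_simps)
  have \<epsilon>: "\<epsilon> > 0" "2 * \<epsilon> < r" "(1 / \<tau> + Lp) * (3 * \<epsilon>) < s"
  proof -
    have h: "1 / \<tau> + Lp > 0" using \<tau> pos by (simp add: add_pos_pos)
    then show "\<epsilon> > 0" using pos by (simp add: \<epsilon>_def)
    have "\<epsilon> \<le> r / 4" unfolding \<epsilon>_def by (rule min.cobounded1)
    then show "2 * \<epsilon> < r" using pos by simp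
    have "(1 / \<tau> + Lp) * (3 * \<epsilon>) \<le> (1 / \<tau> + Lp) * (3 * (s / (6 * (1 / \<tau> + Lp))))"
      using h by (intro mult_left_mono) (auto simp: \<epsilon>_def)
    also have "\<dots> = s / 2" using h by (simp add: field_simps)
    finally show "(1 / \<tau> + Lp) * (3 * \<epsilon>) < s" using pos by simp
  qed
  have step: "\<exists>v'\<in>C. \<phi> v' \<le> \<phi> v \<and> nrm (sub v' u0) \<le> \<epsilon> \<and> (1 + \<tau> * \<kappa>) * (nrm (sub v' u0))\<^sup>2 \<le> (nrm (sub v u0))\<^sup>2"
    if v: "v \<in> C" "nrm (sub v u0) \<le> \<epsilon>" for v
  proof -
    have vr: "nrm (sub v u0) < r" using v \<epsilon> by linarith
    have u0r: "nrm (sub u0 u0) < r" using pos inK[OF u0] by (simp add: nrm_eq ip_rules)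
    note K = inK[OF u0] inK[OF v(1)] gK[OF v(1) vr] gK[OF u0 u0r]
    obtain v' where v': "v' \<in> C" "\<And>w. w \<in> C \<Longrightarrow> ip (sub (sub v (sc \<tau> (g v))) v') (sub w v') \<le> 0"
      using proj[of "sub v (sc \<tau> (g v))"] K by auto
    note K' = K inK[OF v'(1)]
    define e where "e = nrm (sub v u0)"
    define e' where "e' = nrm (sub v' u0)"
    define \<Delta> where "\<Delta> = nrm (sub v' v)"
    have e0: "e \<ge> 0" "e' \<ge> 0" "\<Delta> \<ge> 0" using K' by (auto simp: e_def e'_def \<Delta>_def nrm_nonneg)
    \<comment> \<open>The projection inequality tested with \<open>u0\<close>, and criticality of
      \<open>u0\<close> tested with \<open>v'\<close>; their sum bounds \<open>e'\<close> by
      \<open>e\<close> and the variation of the gradient.\<close>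
    have i1: "ip (sub v v') (sub u0 v') - \<tau> * ip (g v) (sub u0 v') \<le> 0"
      using v'(2)[OF u0] K' by (simp add: ip_rules algebra_simps)
    have i2: "\<tau> * ip (g u0) (sub u0 v') \<le> 0"
    proof -
      have "ip (g u0) (sub u0 v') \<le> 0" using crit[OF v'(1)] K' by (simp add: ip_rules)
      then show ?thesis using \<tau>(1) by (simp add: mult_le_0_iff)
    qed
    have "e'\<^sup>2 \<le> ip (sub v u0) (sub v' u0) - \<tau> * ip (sub (g v) (g u0)) (sub v' u0)"
      using i1 i2 K' by (simp add: e'_def nrm_sq ip_rules algebra_simps)
    also have "\<dots> \<le> e * e' + \<tau> * (Lp * e * e')"
    proof -
      have "\<bar>ip (sub v u0) (sub v' u0)\<bar> \<le> e * e'"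
        using cauchy_schwarz[of "sub v u0" "sub v' u0"] K' by (simp add: e_def e'_def)
      moreover have "\<bar>ip (sub (g v) (g u0)) (sub v' u0)\<bar> \<le> Lp * e * e'"
      proof -
        have "\<bar>ip (sub (g v) (g u0)) (sub v' u0)\<bar> \<le> nrm (sub (g v) (g u0)) * e'"
          using cauchy_schwarz[of "sub (g v) (g u0)" "sub v' u0"] K' by (simp add: e'_def)
        also have "\<dots> \<le> Lp * e * e'"
          using lip[OF v(1) u0 vr u0r] e0 by (intro mult_right_mono) (auto simp: e_def)
        finally show ?thesis .
      qed
      then have "\<tau> * \<bar>ip (sub (g v) (g u0)) (sub v' u0)\<bar> \<le> \<tau> * (Lp * e * e')"
        using \<tau>(1) by (intro mult_left_mono) auto
      then have "\<bar>\<tau> * ip (sub (g v) (g u0)) (sub v' u0)\<bar> \<le> \<tau> * (Lp * e * e')"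
        using \<tau>(1) by (simp add: abs_mult)
      ultimately show ?thesis by linarith
    qed
    finally have "e' * e' \<le> (1 + \<tau> * Lp) * e * e'" by (simp add: power2_eq_square algebra_simps)
    then have "e' \<le> (1 + \<tau> * Lp) * e"
      using e0 \<tau>(1) pos by (cases "e' = 0") (auto simp: mult_nonneg_nonneg)
    also have "\<dots> \<le> 2 * e" using \<tau> e0 by (intro mult_right_mono) auto
    \<comment> \<open>Only a crude growth bound: it keeps \<open>v'\<close> within radius
      \<open>r\<close>, where the Lipschitz and monotonicity hypotheses can be applied to
      it.\<close>
    finally have e'2: "e' \<le> 2 * e" .
    then have v'r: "nrm (sub v' u0) < r" using v \<epsilon> by (simp add: e_def e'_def)
    note K' = K' gK[OF v'(1) v'r]
    \<comment> \<open>The projection residual \<open>v - \<tau> g v - v'\<close> is normal at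
      \<open>v'\<close>, and \<open>n\<close> is this vector divided by \<open>\<tau>\<close>. In
      \<open>g v' + n\<close> the two gradients nearly cancel, so that its norm is at most
      \<open>(1 / \<tau> + Lp) * \<Delta>\<close>.\<close>
    define n where "n = sub (sc (1 / \<tau>) (sub v v')) (g v)"
    have nK: "n \<in> K" using K' by (simp add: n_def)
    have n: "ip n (sub w v') \<le> 0" if "w \<in> C" for w
    proof -
      have "ip n (sub w v') = (1 / \<tau>) * ip (sub (sub v (sc \<tau> (g v))) v') (sub w v')"
        using K' inK[OF that] \<tau>(1) by (simp add: n_def ip_rules field_simps)
      also have "\<dots> \<le> 0" using v'(2)[OF that] \<tau>(1) by (simp add: divide_nonpos_pos)
      finally show ?thesis .
    qed
    have \<Delta>e: "\<Delta> \<le> e + e'"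
      using nrm_sub_triangle[of v' u0 v] K' nrm_sub_commute[of u0 v] by (simp add: \<Delta>_def e_def e'_def)
    have lipv: "nrm (sub (g v') (g v)) \<le> Lp * \<Delta>"
      using lip[OF v'(1) v(1) v'r vr] by (simp add: \<Delta>_def)
    have "nrm (add (g v') n) = nrm (add (sc (1 / \<tau>) (sub v v')) (sub (g v') (g v)))"
      using K' by (simp add: nrm_eq n_def ip_rules)
    also have "\<dots> \<le> nrm (sc (1 / \<tau>) (sub v v')) + nrm (sub (g v') (g v))"
      using K' by (intro nrm_add_le) auto
    also have "\<dots> \<le> 1 / \<tau> * \<Delta> + Lp * \<Delta>"
      using lipv K' \<tau>(1) nrm_sub_commute[of v v'] by (simp add: nrm_sc \<Delta>_def)
    also have "\<dots> = (1 / \<tau> + Lp) * \<Delta>" by (simp add: algebra_simps)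
    also have "\<dots> \<le> (1 / \<tau> + Lp) * (3 * \<epsilon>)"
      using \<Delta>e e'2 v \<tau>(1) pos by (intro mult_left_mono) (auto simp: e_def)
    also have "\<dots> < s" by (rule \<epsilon>)
    finally have "\<kappa> * e'\<^sup>2 \<le> ip (add (g v') n) (sub v' u0)"
      using mono[OF v'(1) v'r nK n] by (simp add: e'_def)
    also have "\<dots> = 1 / \<tau> * ip (sub v v') (sub v' u0) + ip (sub (g v') (g v)) (sub v' u0)"
      using K' by (simp add: n_def ip_rules algebra_simps)
    also have "ip (sub (g v') (g v)) (sub v' u0) \<le> (Lp * \<Delta>) * e'"
      using cauchy_schwarz[of "sub (g v') (g v)" "sub v' u0"] K' lipv e0
        mult_right_mono[OF lipv, of e'] by (simp add: e'_def)
    \<comment> \<open>Three-point identity; the negative square of \<open>\<Delta>\<close> that it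
      produces absorbs the gradient error below.\<close>
    also have "ip (sub v v') (sub v' u0) = (e\<^sup>2 - e'\<^sup>2 - \<Delta>\<^sup>2) / 2"
      using K' ip_sym[of v u0] ip_sym[of v' u0] ip_sym[of v v']
      by (simp add: e_def e'_def \<Delta>_def nrm_sq ip_rules)
    finally have "\<tau> * (\<kappa> * e'\<^sup>2) \<le> \<tau> * (1 / \<tau> * ((e\<^sup>2 - e'\<^sup>2 - \<Delta>\<^sup>2) / 2) + Lp * \<Delta> * e')"
      using \<tau>(1) by (intro mult_left_mono) auto
    also have "\<dots> = (e\<^sup>2 - e'\<^sup>2 - \<Delta>\<^sup>2) / 2 + \<tau> * (Lp * \<Delta> * e')"
      using \<tau>(1) by (simp add: distrib_left)
    finally have "2 * \<tau> * \<kappa> * e'\<^sup>2 \<le> e\<^sup>2 - e'\<^sup>2 - \<Delta>\<^sup>2 + 2 * \<tau> * Lp * \<Delta> * e'"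
      unfolding mult.assoc diff_divide_distrib by linarith
    \<comment> \<open>Half of the monotonicity gain is spent on the gradient error; the other half
      remains as the contraction factor \<open>1 + \<tau> * \<kappa>\<close>.\<close>
    moreover have "2 * \<tau> * Lp * \<Delta> * e' \<le> \<Delta>\<^sup>2 + \<tau> * \<kappa> * e'\<^sup>2"
    proof -
      have "2 * \<tau> * Lp * \<Delta> * e' \<le> \<Delta>\<^sup>2 + (\<tau> * Lp * e')\<^sup>2"
      using sum_squares_bound[of \<Delta> "\<tau> * Lp * e'"] by (simp add: algebra_simps)
      moreover have "(\<tau> * Lp * e')\<^sup>2 = \<tau> * (\<tau> * Lp\<^sup>2) * e'\<^sup>2" by (simp add: power2_eq_square)
      moreover have "\<tau> * (\<tau> * Lp\<^sup>2) * e'\<^sup>2 \<le> \<tau> * \<kappa> * e'\<^sup>2"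
        using \<tau> by (intro mult_right_mono mult_left_mono) auto
      ultimately show ?thesis by linarith
    qed
    ultimately have contr: "(1 + \<tau> * \<kappa>) * e'\<^sup>2 \<le> e\<^sup>2"
      unfolding distrib_right by linarith
    have "1 * e'\<^sup>2 \<le> (1 + \<tau> * \<kappa>) * e'\<^sup>2" using \<tau> pos by (intro mult_right_mono) auto
    then have "e'\<^sup>2 \<le> e\<^sup>2" using contr by simp
    then have e'e: "e' \<le> e" by (rule power2_le_imp_le) (rule e0)
    \<comment> \<open>The projection inequality tested with the old point \<open>v\<close>, which is
      the descent property of the step.\<close>
    have d: "\<Delta>\<^sup>2 + \<tau> * ip (g v) (sub v' v) \<le> 0"
      using v'(2)[OF v(1)] K' ip_sym[of v v'] by (simp add: \<Delta>_def nrm_sq ip_rules algebra_simps)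
    have "\<tau> * \<phi> v' \<le> \<tau> * (\<phi> v + ip (g v) (sub v' v) + Lp * \<Delta>\<^sup>2)"
      using quad[OF v(1) v'(1) vr v'r] \<tau>(1) by (intro mult_left_mono) (auto simp: \<Delta>_def)
    also have "\<dots> \<le> \<tau> * \<phi> v + (\<tau> * Lp - 1) * \<Delta>\<^sup>2" using d by (simp add: algebra_simps)
    also have "\<dots> \<le> \<tau> * \<phi> v" using \<tau>(2) by (simp add: mult_le_0_iff)
    finally have "\<phi> v' \<le> \<phi> v" using \<tau>(1) by simp
    with v'(1) contr e'e v show ?thesis by (auto simp: e_def e'_def)
  qed
  have "\<phi> u0 \<le> \<phi> v" if v: "v \<in> C" "nrm (sub v u0) \<le> \<epsilon>" for v
  proof -
    \<comment> \<open>No orbit is constructed. For each \<open>n\<close> some point satisfies the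
      rate after \<open>n\<close> steps, and the points chosen afterwards for different
      \<open>n\<close> may belong to different orbits; only the rate matters.\<close>
    have "\<exists>x\<in>C. \<phi> x \<le> \<phi> v \<and> nrm (sub x u0) \<le> \<epsilon> \<and> (1 + \<tau> * \<kappa>) ^ n * (nrm (sub x u0))\<^sup>2 \<le> \<epsilon>\<^sup>2" for n
    proof (induction n)
      case 0
      show ?case
        using v inK[OF v(1)] inK[OF u0] by (intro bexI[of _ v]) (auto intro!: power_mono nrm_nonneg)
    next
      case (Suc n)
      then obtain x where x: "x \<in> C" "\<phi> x \<le> \<phi> v" "nrm (sub x u0) \<le> \<epsilon>"
        "(1 + \<tau> * \<kappa>) ^ n * (nrm (sub x u0))\<^sup>2 \<le> \<epsilon>\<^sup>2" by auto
      obtain x' where x': "x' \<in> C" "\<phi> x' \<le> \<phi> x" "nrm (sub x' u0) \<le> \<epsilon>"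
        "(1 + \<tau> * \<kappa>) * (nrm (sub x' u0))\<^sup>2 \<le> (nrm (sub x u0))\<^sup>2" using step[OF x(1,3)] by auto
      have "(1 + \<tau> * \<kappa>) ^ Suc n * (nrm (sub x' u0))\<^sup>2
          = (1 + \<tau> * \<kappa>) ^ n * ((1 + \<tau> * \<kappa>) * (nrm (sub x' u0))\<^sup>2)" by simp
      also have "\<dots> \<le> (1 + \<tau> * \<kappa>) ^ n * (nrm (sub x u0))\<^sup>2"
        using x'(4) \<tau> pos by (intro mult_left_mono) auto
      also have "\<dots> \<le> \<epsilon>\<^sup>2" by (rule x)
      finally show ?case using x' x by (intro bexI[of _ x']) auto
    qed
    then obtain x where x: "\<And>n. x n \<in> C" "\<And>n. \<phi> (x n) \<le> \<phi> v" "\<And>n. nrm (sub (x n) u0) \<le> \<epsilon>"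
      "\<And>n. (1 + \<tau> * \<kappa>) ^ n * (nrm (sub (x n) u0))\<^sup>2 \<le> \<epsilon>\<^sup>2" by metis
    define e where "e n = nrm (sub (x n) u0)" for n
    have u0r: "nrm (sub u0 u0) < r" using pos inK[OF u0] by (simp add: nrm_eq ip_rules)
    have xr: "nrm (sub (x n) u0) < r" for n using x(3)[of n] \<epsilon> by linarith
    note K = inK[OF u0] inK[OF x(1)] gK[OF x(1) xr] gK[OF u0 u0r]
    have e0: "e n \<ge> 0" for n using K by (simp add: e_def nrm_nonneg)
    have q: "1 + \<tau> * \<kappa> > 1" using \<tau> pos by simp
    have "(e n)\<^sup>2 \<le> \<epsilon>\<^sup>2 * (1 / (1 + \<tau> * \<kappa>)) ^ n" for n
      using x(4)[of n] q by (simp add: e_def field_simps power_divide)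
    moreover have "(\<lambda>n. \<epsilon>\<^sup>2 * (1 / (1 + \<tau> * \<kappa>)) ^ n) \<longlonglongrightarrow> 0"
      using q by (intro tendsto_mult_right_zero LIMSEQ_realpow_zero) auto
    ultimately have "(\<lambda>n. (e n)\<^sup>2) \<longlonglongrightarrow> 0"
      by (intro tendsto_sandwich[of "\<lambda>_. 0" "\<lambda>n. (e n)\<^sup>2" sequentially "\<lambda>n. \<epsilon>\<^sup>2 * (1 / (1 + \<tau> * \<kappa>)) ^ n"]) auto
    then have elim: "e \<longlonglongrightarrow> 0"
      using tendsto_real_sqrt[of "\<lambda>n. (e n)\<^sup>2" 0] e0 by simp
    define G where "G = nrm (g u0) + Lp * \<epsilon>"
    \<comment> \<open>The quadratic upper estimate is used from \<open>x n\<close> towards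
      \<open>u0\<close>; it supplies the semicontinuity of \<open>\<phi>\<close> at
      \<open>u0\<close> that the passage to the limit requires.\<close>
    have bnd: "\<phi> u0 \<le> \<phi> v + G * e n + Lp * (e n)\<^sup>2" for n
    proof -
      have "nrm (g (x n)) \<le> nrm (g u0) + nrm (sub (g (x n)) (g u0))"
        using K by (intro nrm_le_nrm_sub) auto
      also have "nrm (sub (g (x n)) (g u0)) \<le> Lp * e n"
        using lip[OF x(1) u0 xr u0r] by (simp add: e_def)
      also have "Lp * e n \<le> Lp * \<epsilon>" using x(3)[of n] pos by (simp add: e_def)
      finally have "nrm (g (x n)) \<le> G" by (simp add: G_def)
      then have "ip (g (x n)) (sub u0 (x n)) \<le> G * e n"
        using cauchy_schwarz[of "g (x n)" "sub u0 (x n)"] K e0[of n] nrm_sub_commute[of u0 "x n"]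
          mult_right_mono[of "nrm (g (x n))" G "e n"] by (simp add: e_def)
      then show ?thesis
        using quad[OF x(1) u0 xr u0r, of n] x(2)[of n] K nrm_sub_commute[of u0 "x n"]
        by (simp add: e_def)
    qed
    have "(\<lambda>n. \<phi> v + G * e n + Lp * (e n)\<^sup>2) \<longlonglongrightarrow> \<phi> v + G * 0 + Lp * 0\<^sup>2"
      by (intro tendsto_intros elim)
    then have "\<phi> u0 \<le> \<phi> v + G * 0 + Lp * 0\<^sup>2"
      using bnd by (intro LIMSEQ_le_const) auto
    then show ?thesis by simp
  qed
  then show ?thesis using \<epsilon>(1) by auto
qed

end

section \<open>Riesz representation and Lax--Milgram\<close>

locale semi_hilbert = semi_ip +
  assumes complete: "\<And>x :: nat \<Rightarrow> 'a. (\<And>n. x n \<in> K) \<Longrightarrow>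
    (\<And>e. e > 0 \<Longrightarrow> \<exists>N. \<forall>m\<ge>N. \<forall>n\<ge>N. nrm (sub (x m) (x n)) < e) \<Longrightarrow>
    \<exists>l\<in>K. (\<lambda>n. nrm (sub (x n) l)) \<longlonglongrightarrow> 0"
begin

text \<open>Direct method for \<open>ip u u / 2 - h u\<close>: by the parallelogram law a minimizing
  sequence is Cauchy. The Euler equation is obtained approximately along the sequence, so that only
  \<open>ip (x n) v\<close> is passed to the limit.\<close>

lemma riesz_representation:
  assumes add: "\<And>u v. u \<in> K \<Longrightarrow> v \<in> K \<Longrightarrow> h (add u v) = h u + h v"
    and scale: "\<And>u c. u \<in> K \<Longrightarrow> h (sc c u) = c * h u"
    and bdd: "\<And>u. u \<in> K \<Longrightarrow> \<bar>h u\<bar> \<le> C * nrm u"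
  shows "\<exists>w\<in>K. \<forall>v\<in>K. ip w v = h v"
proof -
  define J where "J u = ip u u / 2 - h u" for u
  have J_low: "J u \<ge> - C\<^sup>2 / 2" if "u \<in> K" for u
    using bdd[OF that] sum_squares_bound[of C "nrm u"] nrm_sq[OF that] by (simp add: J_def)
  have bb: "bdd_below (J ` K)" using J_low by (intro bdd_belowI2[where m = "- C\<^sup>2 / 2"]) auto
  define I where "I = Inf (J ` K)"
  have I_le: "I \<le> J u" if "u \<in> K" for u using bb that by (auto simp: I_def intro: cInf_lower)
  have "\<exists>u\<in>K. J u < I + 1 / real (Suc n)" for n
    using cInf_lessD[of "J ` K" "I + 1 / real (Suc n)"] nonempty by (auto simp: I_def)
  then obtain x where x: "\<And>n. x n \<in> K" "\<And>n. J (x n) < I + 1 / real (Suc n)" by metis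
  have par: "(nrm (sub (x m) (x n)))\<^sup>2 \<le> 4 * (1 / real (Suc m) + 1 / real (Suc n))" for m n
  proof -
    have "I \<le> J (sc (1/2) (add (x m) (x n)))" using x by (intro I_le) auto
    moreover have "J (sc (1/2) (add (x m) (x n))) =
        (J (x m) + J (x n)) / 2 - (nrm (sub (x m) (x n)))\<^sup>2 / 8"
      using x(1) ip_sym[of "x m" "x n"] by (simp add: J_def nrm_sq ip_rules add scale field_simps)
    ultimately have "(nrm (sub (x m) (x n)))\<^sup>2 \<le> 4 * ((J (x m) - I) + (J (x n) - I))"
      by (simp add: field_simps)
    also have "\<dots> \<le> 4 * (1 / real (Suc m) + 1 / real (Suc n))"
      by (intro mult_left_mono add_mono) (use x(2)[of m] x(2)[of n] in \<open>auto simp del: of_nat_Suc\<close>)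
    finally show ?thesis .
  qed
  have aux: "X < Y" if "a \<le> c" "b \<le> c" "X \<le> 4 * (a + b)" "c < Y / 8"
    for a :: real and b c X Y
  proof -
    have "4 * (a + b) \<le> 8 * c" using that(1,2) by simp
    also have "8 * c < Y" using that(4) by simp
    finally show ?thesis using that(3) by simp
  qed
  have "\<exists>N. \<forall>m\<ge>N. \<forall>n\<ge>N. nrm (sub (x m) (x n)) < e" if e: "e > 0" for e
  proof -
    obtain N where N: "1 / real (Suc N) < e\<^sup>2 / 8"
      using reals_Archimedean[of "e\<^sup>2 / 8"] e by (auto simp: inverse_eq_divide)
    have "nrm (sub (x m) (x n)) < e" if "m \<ge> N" "n \<ge> N" for m n
    proof -
      have "1 / real (Suc m) \<le> 1 / real (Suc N)" "1 / real (Suc n) \<le> 1 / real (Suc N)"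
        using that by (auto intro!: divide_left_mono)
      then have "(nrm (sub (x m) (x n)))\<^sup>2 < e\<^sup>2" using par[of m n] N by (rule aux)
      then show ?thesis using e by (simp add: power2_less_imp_less)
    qed
    then show ?thesis by blast
  qed
  then obtain l where l: "l \<in> K" "(\<lambda>n. nrm (sub (x n) l)) \<longlonglongrightarrow> 0" using complete[of x] x(1) by auto
  have "ip l v = h v" if v: "v \<in> K" for v
  proof -
    \<comment> \<open>Near-minimality of \<open>x n\<close> on the line in direction
      \<open>v\<close> gives a nonnegative quadratic in \<open>t\<close>; its discriminant bounds
      the defect in the Euler equation.\<close>
    have "(ip (x n) v - h v)\<^sup>2 \<le> 2 * ip v v * (1 / real (Suc n))" for n
    proof -
      have "0 \<le> (ip v v / 2) * t\<^sup>2 + 2 * ((ip (x n) v - h v) / 2) * t + 1 / real (Suc n)" for t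
      proof -
        have "I \<le> J (add (x n) (sc t v))" using x v by (intro I_le) auto
        also have "\<dots> = J (x n) + (ip v v / 2) * t\<^sup>2 + 2 * ((ip (x n) v - h v) / 2) * t"
          using x(1) v ip_sym[of v "x n"]
          by (simp add: J_def ip_rules add scale field_simps power2_eq_square)
        finally show ?thesis using x(2)[of n] by linarith
      qed
      then have "((ip (x n) v - h v) / 2)\<^sup>2 \<le> (ip v v / 2) * (1 / real (Suc n))"
        by (rule quadratic_discriminant_le) (use v ip_nonneg in auto)
      then show ?thesis by (simp add: power_divide del: of_nat_Suc)
    qed
    moreover have "(\<lambda>n. 2 * ip v v * (1 / real (Suc n))) \<longlonglongrightarrow> 2 * ip v v * 0"
      by (intro tendsto_mult tendsto_const LIMSEQ_Suc[OF lim_1_over_n])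
    ultimately have "(\<lambda>n. (ip (x n) v - h v)\<^sup>2) \<longlonglongrightarrow> 0"
      by (intro tendsto_sandwich[of "\<lambda>_. 0" "\<lambda>n. (ip (x n) v - h v)\<^sup>2" sequentially "\<lambda>n. 2 * ip v v * (1 / real (Suc n))"]) auto
    moreover have "(\<lambda>n. (ip (x n) v - h v)\<^sup>2) \<longlonglongrightarrow> (ip l v - h v)\<^sup>2"
      by (intro tendsto_intros ip_tendsto x l v)
    ultimately show ?thesis using LIMSEQ_unique by fastforce
  qed
  with l show ?thesis by auto
qed

text \<open>The form need not be symmetric, so there is no energy to minimize. Instead
  \<open>T u\<close> is the Riesz representative of
  \<open>v \<mapsto> ip u v - \<rho> * (b u v - h v)\<close>, whose fixed points are the solutions,
  and \<open>T\<close> is a contraction for small \<open>\<rho>\<close>.\<close>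

lemma lax_milgram:
  assumes l_add: "\<And>u v. u \<in> K \<Longrightarrow> v \<in> K \<Longrightarrow> h (add u v) = h u + h v"
    and l_sc: "\<And>u c. u \<in> K \<Longrightarrow> h (sc c u) = c * h u"
    and l_bdd: "\<And>u. u \<in> K \<Longrightarrow> \<bar>h u\<bar> \<le> C' * nrm u"
    and b_add: "\<And>u v w. u \<in> K \<Longrightarrow> v \<in> K \<Longrightarrow> w \<in> K \<Longrightarrow> b w (add u v) = b w u + b w v"
    and b_sc: "\<And>u w c. u \<in> K \<Longrightarrow> w \<in> K \<Longrightarrow> b w (sc c u) = c * b w u"
    and b_sub: "\<And>u v w. u \<in> K \<Longrightarrow> v \<in> K \<Longrightarrow> w \<in> K \<Longrightarrow> b (sub u v) w = b u w - b v w"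
    and b_bdd: "\<And>u v. u \<in> K \<Longrightarrow> v \<in> K \<Longrightarrow> \<bar>b u v\<bar> \<le> C * nrm u * nrm v"
    and coercive: "\<And>u. u \<in> K \<Longrightarrow> \<gamma> * (nrm u)\<^sup>2 \<le> b u u"
    and pos: "C > 0" "\<gamma> > 0"
  shows "\<exists>u\<in>K. \<forall>v\<in>K. b u v = h v"
proof -
  \<comment> \<open>The squared contraction factor is at most
    \<open>1 - 2 * \<rho> * \<gamma> + \<rho>\<^sup>2 * C\<^sup>2\<close>. The first bound reduces
    this to \<open>1 - \<rho> * \<gamma>\<close>, the second keeps the latter positive, so that
    \<open>q\<close> is a genuine root in (0, 1).\<close>
  define \<rho> where "\<rho> = min (\<gamma> / C\<^sup>2) (1 / (2 * \<gamma>))"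
  have \<rho>: "\<rho> > 0" "\<rho> * C\<^sup>2 \<le> \<gamma>" "\<rho> * \<gamma> < 1"
  proof -
    show "\<rho> > 0" using pos by (simp add: \<rho>_def)
    have "\<rho> \<le> \<gamma> / C\<^sup>2" by (simp add: \<rho>_def)
    then show "\<rho> * C\<^sup>2 \<le> \<gamma>" using pos by (simp add: field_simps)
    have "\<rho> \<le> 1 / (2 * \<gamma>)" by (simp add: \<rho>_def)
    then have "\<rho> * (2 * \<gamma>) \<le> 1" using pos by (simp add: field_simps)
    moreover have "\<rho> * \<gamma> > 0" using pos \<open>\<rho> > 0\<close> by simp
    ultimately show "\<rho> * \<gamma> < 1" by simp
  qed
  have "\<exists>w\<in>K. \<forall>v\<in>K. ip w v = ip u v - \<rho> * (b u v - h v)" if u: "u \<in> K" for u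
  proof (rule riesz_representation)
    fix v assume v: "v \<in> K"
    have "\<bar>ip u v - \<rho> * (b u v - h v)\<bar> \<le> \<bar>ip u v\<bar> + \<rho> * (\<bar>b u v\<bar> + \<bar>h v\<bar>)"
    proof -
      have "\<bar>\<rho> * (b u v - h v)\<bar> \<le> \<rho> * (\<bar>b u v\<bar> + \<bar>h v\<bar>)"
        using \<rho>(1) by (simp add: abs_mult abs_triangle_ineq4)
      then show ?thesis using abs_triangle_ineq4[of "ip u v" "\<rho> * (b u v - h v)"] by linarith
    qed
    also have "\<dots> \<le> nrm u * nrm v + \<rho> * (C * nrm u * nrm v + C' * nrm v)"
      using u v \<rho>(1) by (intro add_mono mult_left_mono cauchy_schwarz b_bdd l_bdd) auto
    finally show "\<bar>ip u v - \<rho> * (b u v - h v)\<bar> \<le> (nrm u + \<rho> * (C * nrm u + C')) * nrm v"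
      by (simp add: algebra_simps)
  qed (use u in \<open>auto simp: ip_rules b_add b_sc l_add l_sc algebra_simps\<close>)
  then obtain T where T: "\<And>u. u \<in> K \<Longrightarrow> T u \<in> K"
    "\<And>u v. u \<in> K \<Longrightarrow> v \<in> K \<Longrightarrow> ip (T u) v = ip u v - \<rho> * (b u v - h v)" by metis
  define q where "q = sqrt (1 - \<rho> * \<gamma>)"
  have q: "0 < q" "q < 1" "q\<^sup>2 = 1 - \<rho> * \<gamma>" using \<rho> pos by (auto simp: q_def)
  have contr: "nrm (sub (T u) (T w)) \<le> q * nrm (sub u w)" if uw: "u \<in> K" "w \<in> K" for u w
  proof (rule power2_le_imp_le)
    define d where "d = sub u w"
    define e where "e = sub (T u) (T w)"
    have K: "d \<in> K" "e \<in> K" using uw T by (auto simp: d_def e_def)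
    \<comment> \<open>\<open>sub d e\<close> represents the functional \<open>\<rho> * b d\<close>.
      Its norm is bounded by testing with itself, its pairing with \<open>d\<close> from below by
      coercivity.\<close>
    have ed: "ip (sub d e) v = \<rho> * b d v" if "v \<in> K" for v
      using uw T that by (simp add: d_def e_def ip_rules b_sub algebra_simps)
    have "(nrm (sub d e))\<^sup>2 = \<rho> * b d (sub d e)" using ed[of "sub d e"] K by (simp add: nrm_sq)
    also have "\<dots> \<le> \<rho> * (C * nrm d * nrm (sub d e))"
      using b_bdd[of d "sub d e"] K \<rho>(1) by (intro mult_left_mono) auto
    finally have "nrm (sub d e) * nrm (sub d e) \<le> (\<rho> * C * nrm d) * nrm (sub d e)"
      by (simp add: power2_eq_square algebra_simps)
    then have "nrm (sub d e) \<le> \<rho> * C * nrm d"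
      using K \<rho> pos nrm_nonneg[of "sub d e"] nrm_nonneg[of d]
      by (cases "nrm (sub d e) = 0") (auto simp: mult_le_cancel_right)
    then have "(nrm (sub d e))\<^sup>2 \<le> (\<rho> * C * nrm d)\<^sup>2"
      using K nrm_nonneg by (intro power_mono) auto
    also have "\<dots> = \<rho> * (\<rho> * C\<^sup>2) * (nrm d)\<^sup>2" by (simp add: power2_eq_square)
    also have "\<dots> \<le> \<rho> * \<gamma> * (nrm d)\<^sup>2" using \<rho> by (intro mult_right_mono mult_left_mono) auto
    finally have 1: "(nrm (sub d e))\<^sup>2 \<le> \<rho> * \<gamma> * (nrm d)\<^sup>2" .
    have 2: "\<rho> * \<gamma> * (nrm d)\<^sup>2 \<le> ip (sub d e) d"
      using ed[of d] coercive[of d] K \<rho>(1) by (simp add: mult.assoc)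
    have "(nrm e)\<^sup>2 = (nrm d)\<^sup>2 - 2 * ip (sub d e) d + (nrm (sub d e))\<^sup>2"
      using K ip_sym[of d e] by (simp add: nrm_sq ip_rules)
    then show "(nrm (sub (T u) (T w)))\<^sup>2 \<le> (q * nrm (sub u w))\<^sup>2"
      using 1 2 by (simp add: d_def e_def power_mult_distrib q algebra_simps)
  qed (use uw q nrm_nonneg in auto)
  obtain x0 where x0: "x0 \<in> K" using nonempty by auto
  define x where "x n = (T ^^ n) x0" for n
  have xK: "x n \<in> K" for n by (induction n) (auto simp: x_def x0 T)
  have xS: "x (Suc n) = T (x n)" for n by (simp add: x_def)
  define D where "D = nrm (sub (x 1) (x 0))"
  have D0: "D \<ge> 0" using xK by (simp add: D_def nrm_nonneg)
  have s1: "nrm (sub (x (Suc n)) (x n)) \<le> q ^ n * D" for n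
  proof (induction n)
    case (Suc n)
    have "nrm (sub (x (Suc (Suc n))) (x (Suc n))) \<le> q * nrm (sub (x (Suc n)) (x n))"
      using contr[OF xK xK, of "Suc n" n] by (simp only: xS)
    also have "\<dots> \<le> q * (q ^ n * D)" using Suc q by (intro mult_left_mono) auto
    finally show ?case by simp
  qed (simp add: D_def)
  have s2: "nrm (sub (x (n + k)) (x n)) \<le> q ^ n * D * ((1 - q ^ k) / (1 - q))" for n k
  proof (induction k)
    case 0
    then show ?case using xK by (simp add: nrm_eq ip_rules)
  next
    case (Suc k)
    have "nrm (sub (x (n + Suc k)) (x n)) \<le> nrm (sub (x (Suc (n + k))) (x (n + k))) + nrm (sub (x (n + k)) (x n))"
      using nrm_sub_triangle[of "x (Suc (n + k))" "x (n + k)" "x n"] xK by simp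
    also have "\<dots> \<le> q ^ (n + k) * D + q ^ n * D * ((1 - q ^ k) / (1 - q))" by (intro add_mono s1 Suc)
    also have "\<dots> = q ^ n * D * ((1 - q ^ Suc k) / (1 - q))" using q by (simp add: field_simps power_add)
    finally show ?case .
  qed
  have s3: "nrm (sub (x m) (x n)) \<le> q ^ N * D * (1 / (1 - q))" if "m \<ge> n" "n \<ge> N" for m n N
  proof -
    have "nrm (sub (x m) (x n)) \<le> q ^ n * D * ((1 - q ^ (m - n)) / (1 - q))" using s2[of n "m - n"] that by simp
    also have "\<dots> \<le> q ^ N * D * (1 / (1 - q))"
      using q D0 that by (intro mult_mono divide_right_mono power_decreasing) (auto simp: power_le_one)
    finally show ?thesis .
  qed
  have "\<exists>N. \<forall>m\<ge>N. \<forall>n\<ge>N. nrm (sub (x m) (x n)) < e" if e: "e > 0" for e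
  proof -
    have "(\<lambda>N. q ^ N * D * (1 / (1 - q))) \<longlonglongrightarrow> 0"
      using q by (intro tendsto_mult_left_zero LIMSEQ_realpow_zero) auto
    then obtain N where N: "q ^ N * D * (1 / (1 - q)) < e"
      using order_tendstoD(2)[of _ 0 sequentially e] e by (meson eventually_sequentially order_refl)
    have "nrm (sub (x m) (x n)) < e" if "m \<ge> N" "n \<ge> N" for m n
      using s3[of n m N] s3[of m n N] that N nrm_sub_commute[OF xK xK, of m n]
      by (cases "m \<ge> n") auto
    then show ?thesis by blast
  qed
  then obtain l where l: "l \<in> K" "(\<lambda>n. nrm (sub (x n) l)) \<longlonglongrightarrow> 0" using complete[of x] xK by auto
  have "b l v = h v" if v: "v \<in> K" for v
  proof -
    have bl: "(\<lambda>n. b (x n) v) \<longlonglongrightarrow> b l v"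
    proof -
      have "(\<lambda>n. b (x n) v - b l v) \<longlonglongrightarrow> 0"
      proof (rule Lim_null_comparison)
        show "\<forall>\<^sub>F n in sequentially. norm (b (x n) v - b l v) \<le> C * nrm (sub (x n) l) * nrm v"
          using b_bdd[of "sub (x n) l" v for n] xK l v by (auto simp: b_sub)
        show "(\<lambda>n. C * nrm (sub (x n) l) * nrm v) \<longlonglongrightarrow> 0"
          using l(2) by (intro tendsto_mult_left_zero tendsto_mult_right_zero)
      qed
      then show ?thesis using LIM_zero_iff by blast
    qed
    \<comment> \<open>The recursion is tested with \<open>v\<close> before the limit is taken, so
      that only \<open>ip\<close> and \<open>b\<close> have to converge, not
      \<open>T\<close>.\<close>
    have "(\<lambda>n. ip (x n) v - \<rho> * (b (x n) v - h v)) \<longlonglongrightarrow> ip l v - \<rho> * (b l v - h v)"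
      by (intro tendsto_intros bl ip_tendsto xK l v)
    moreover have "(\<lambda>n. ip (x (Suc n)) v) \<longlonglongrightarrow> ip l v"
      by (intro LIMSEQ_Suc ip_tendsto xK l v)
    then have "(\<lambda>n. ip (x n) v - \<rho> * (b (x n) v - h v)) \<longlonglongrightarrow> ip l v" by (simp add: xS T xK v)
    ultimately have "ip l v - \<rho> * (b l v - h v) = ip l v" using LIMSEQ_unique by blast
    then show ?thesis using \<rho>(1) by simp
  qed
  with l show ?thesis by auto
qed

end

section \<open>The spaces L2 and Linf\<close>

abbreviation L2_dist :: "(real^'n::finite) set \<Rightarrow> 'n scal \<Rightarrow> 'n scal \<Rightarrow> real" where
  "L2_dist \<Omega> u v \<equiv> L2_norm \<Omega> (\<lambda>x. u x - v x)"

lemma L2_measurable [measurable_dest]: "u \<in> L2 \<Omega> \<Longrightarrow> u \<in> borel_measurable (lebesgue_on \<Omega>)"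
  by (simp add: L2_def)

lemma L2_integrable_square: "u \<in> L2 \<Omega> \<Longrightarrow> integrable (lebesgue_on \<Omega>) (\<lambda>x. (u x)\<^sup>2)"
  by (simp add: L2_def)

lemma L2_integrable_mult:
  assumes [measurable]: "u \<in> L2 \<Omega>" "v \<in> L2 \<Omega>"
  shows "integrable (lebesgue_on \<Omega>) (\<lambda>x. u x * v x)"
proof (rule Bochner_Integration.integrable_bound)
  show "integrable (lebesgue_on \<Omega>) (\<lambda>x. (u x)\<^sup>2 + (v x)\<^sup>2)"
    using assms by (intro Bochner_Integration.integrable_add L2_integrable_square)
  have "\<bar>a * b\<bar> \<le> a\<^sup>2 + b\<^sup>2" for a b :: real
  proof -
    have "0 \<le> \<bar>a\<bar> * \<bar>b\<bar>" by simp
    moreover have "2 * (\<bar>a\<bar> * \<bar>b\<bar>) \<le> a\<^sup>2 + b\<^sup>2"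
      using sum_squares_bound[of "\<bar>a\<bar>" "\<bar>b\<bar>"] by (simp add: mult.assoc)
    ultimately show ?thesis unfolding abs_mult by linarith
  qed
  then show "AE x in lebesgue_on \<Omega>. norm (u x * v x) \<le> norm ((u x)\<^sup>2 + (v x)\<^sup>2)" by simp
qed measurable

lemma L2_dominated:
  assumes [measurable]: "u \<in> borel_measurable (lebesgue_on \<Omega>)" and "v \<in> L2 \<Omega>"
    and "AE x in lebesgue_on \<Omega>. \<bar>u x\<bar> \<le> \<bar>v x\<bar>"
  shows "u \<in> L2 \<Omega>"
proof -
  have "integrable (lebesgue_on \<Omega>) (\<lambda>x. (u x)\<^sup>2)"
    by (rule Bochner_Integration.integrable_bound[OF L2_integrable_square[OF assms(2)]])
      (measurable, use assms(3) in \<open>auto simp: abs_le_square_iff\<close>)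
  then show ?thesis by (simp add: L2_def)
qed

lemma L2_add: "u \<in> L2 \<Omega> \<Longrightarrow> v \<in> L2 \<Omega> \<Longrightarrow> (\<lambda>x. u x + v x) \<in> L2 \<Omega>"
  using L2_integrable_square[of u \<Omega>] L2_integrable_square[of v \<Omega>] L2_integrable_mult[of u \<Omega> v]
  by (auto simp: L2_def power2_sum mult.assoc intro!: Bochner_Integration.integrable_add)

lemma L2_scale: "u \<in> L2 \<Omega> \<Longrightarrow> (\<lambda>x. c * u x) \<in> L2 \<Omega>"
  by (auto simp: L2_def power_mult_distrib)

lemma L2_diff: "u \<in> L2 \<Omega> \<Longrightarrow> v \<in> L2 \<Omega> \<Longrightarrow> (\<lambda>x. u x - v x) \<in> L2 \<Omega>"
  using L2_add[of u \<Omega> "\<lambda>x. (-1) * v x"] L2_scale[of v \<Omega> "-1"] by simp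

lemma L2_zero: "(\<lambda>x. 0) \<in> L2 \<Omega>"
  by (simp add: L2_def)

lemma L2_abs: "u \<in> L2 \<Omega> \<Longrightarrow> (\<lambda>x. \<bar>u x\<bar>) \<in> L2 \<Omega>"
  by (auto simp: L2_def)

lemma L2_sum: "finite I \<Longrightarrow> (\<And>i. i \<in> I \<Longrightarrow> u i \<in> L2 \<Omega>) \<Longrightarrow> (\<lambda>x. \<Sum>i\<in>I. u i x) \<in> L2 \<Omega>"
  by (induction I rule: finite_induct) (auto simp: L2_zero intro!: L2_add)

interpretation L2: semi_ip "L2 \<Omega>" "\<lambda>u v x. u x + v x" "\<lambda>u v x. u x - v x" "\<lambda>c u x. c * u x"
  "L2_inner \<Omega>" "L2_norm \<Omega>" for \<Omega>
proof
  show "L2 \<Omega> \<noteq> {}" using L2_zero by blast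
qed (auto simp: L2_add L2_diff L2_scale L2_inner_def L2_norm_def algebra_simps L2_integrable_mult)

lemma L2_norm_sq: "u \<in> L2 \<Omega> \<Longrightarrow> (L2_norm \<Omega> u)\<^sup>2 = (LINT x|lebesgue_on \<Omega>. (u x)\<^sup>2)"
  by (simp add: L2.nrm_sq) (simp add: L2_inner_def power2_eq_square)

lemma L2_norm_mono:
  assumes "u \<in> L2 \<Omega>" "v \<in> L2 \<Omega>" "AE x in lebesgue_on \<Omega>. \<bar>u x\<bar> \<le> \<bar>v x\<bar>"
  shows "L2_norm \<Omega> u \<le> L2_norm \<Omega> v"
proof (rule power2_le_imp_le)
  show "(L2_norm \<Omega> u)\<^sup>2 \<le> (L2_norm \<Omega> v)\<^sup>2"
    using assms by (auto simp: L2_norm_sq abs_le_square_iff intro!: integral_mono_AE L2_integrable_square)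
qed (use assms in \<open>auto simp: L2.nrm_nonneg\<close>)

lemma L2_norm_cong_AE:
  assumes "u \<in> L2 \<Omega>" "v \<in> L2 \<Omega>" "AE x in lebesgue_on \<Omega>. u x = v x"
  shows "L2_norm \<Omega> u = L2_norm \<Omega> v"
  using assms(3) by (intro antisym L2_norm_mono assms) auto

lemma L2_inner_cong_AE:
  assumes "u \<in> L2 \<Omega>" "v \<in> L2 \<Omega>" "u' \<in> L2 \<Omega>" "v' \<in> L2 \<Omega>"
    and "AE x in lebesgue_on \<Omega>. u x = u' x" "AE x in lebesgue_on \<Omega>. v x = v' x"
  shows "L2_inner \<Omega> u v = L2_inner \<Omega> u' v'"
  unfolding L2_inner_def
  by (rule integral_cong_AE) (use assms in auto)

lemma L2_norm_eq_0_imp_AE: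
  assumes "u \<in> L2 \<Omega>" "L2_norm \<Omega> u = 0"
  shows "AE x in lebesgue_on \<Omega>. u x = 0"
proof -
  have "(LINT x|lebesgue_on \<Omega>. (u x)\<^sup>2) = 0" using L2_norm_sq[OF assms(1)] assms(2) by simp
  then show ?thesis
    using integral_nonneg_eq_0_iff_AE[OF L2_integrable_square[OF assms(1)]] by simp
qed

lemma L2_mult_bounded:
  assumes [measurable]: "b \<in> borel_measurable (lebesgue_on \<Omega>)" and u: "u \<in> L2 \<Omega>"
    and b: "AE x in lebesgue_on \<Omega>. \<bar>b x\<bar> \<le> C"
  shows "(\<lambda>x. b x * u x) \<in> L2 \<Omega>" "C \<ge> 0 \<Longrightarrow> L2_norm \<Omega> (\<lambda>x. b x * u x) \<le> C * L2_norm \<Omega> u"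
proof -
  note [measurable] = u
  have le: "AE x in lebesgue_on \<Omega>. \<bar>b x * u x\<bar> \<le> \<bar>C * u x\<bar>"
    using b by eventually_elim (auto simp: abs_mult intro!: mult_right_mono)
  show m: "(\<lambda>x. b x * u x) \<in> L2 \<Omega>"
    by (rule L2_dominated[OF _ L2_scale[OF u] le]) measurable
  show "L2_norm \<Omega> (\<lambda>x. b x * u x) \<le> C * L2_norm \<Omega> u" if "C \<ge> 0"
    using L2_norm_mono[OF m L2_scale[OF u] le] that u by (simp add: L2.nrm_sc)
qed

lemma Linf_bound:
  assumes "b \<in> Linf \<Omega>"
  obtains C where "C \<ge> 0" "AE x in lebesgue_on \<Omega>. \<bar>b x\<bar> \<le> C"
proof -
  obtain C where C: "AE x in lebesgue_on \<Omega>. \<bar>b x\<bar> \<le> C" using assms by (auto simp: Linf_def)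
  have "AE x in lebesgue_on \<Omega>. \<bar>b x\<bar> \<le> max C 0" using C by eventually_elim auto
  then show ?thesis by (intro that[of "max C 0"]) auto
qed

lemma Linf_measurable [measurable_dest]: "u \<in> Linf \<Omega> \<Longrightarrow> u \<in> borel_measurable (lebesgue_on \<Omega>)"
  by (simp add: Linf_def)

lemma Linf_add:
  assumes u: "u \<in> Linf \<Omega>" and v: "v \<in> Linf \<Omega>" shows "(\<lambda>x. u x + v x) \<in> Linf \<Omega>"
proof -
  obtain C where C: "AE x in lebesgue_on \<Omega>. \<bar>u x\<bar> \<le> C" using u by (rule Linf_bound)
  obtain D where D: "AE x in lebesgue_on \<Omega>. \<bar>v x\<bar> \<le> D" using v by (rule Linf_bound)
  have "AE x in lebesgue_on \<Omega>. \<bar>u x + v x\<bar> \<le> C + D" using C D by eventually_elim linarith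
  then show ?thesis
    using borel_measurable_add[OF Linf_measurable[OF u] Linf_measurable[OF v]] unfolding Linf_def by blast
qed

lemma L2_mult_Linf:
  assumes "b \<in> Linf \<Omega>" "u \<in> L2 \<Omega>" shows "(\<lambda>x. b x * u x) \<in> L2 \<Omega>"
proof -
  obtain C where "AE x in lebesgue_on \<Omega>. \<bar>b x\<bar> \<le> C" using assms(1) by (rule Linf_bound)
  then show ?thesis by (rule L2_mult_bounded(1)[OF Linf_measurable[OF assms(1)] assms(2)])
qed

lemma L2_bounded:
  assumes "\<Omega> \<in> lmeasurable" and [measurable]: "u \<in> borel_measurable (lebesgue_on \<Omega>)"
    and "AE x in lebesgue_on \<Omega>. \<bar>u x\<bar> \<le> C"
  shows "u \<in> L2 \<Omega>"
proof -
  interpret finite_measure "lebesgue_on \<Omega>" by (rule finite_measure_lebesgue_on) (rule assms)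
  have "(\<lambda>x. C) \<in> L2 \<Omega>" by (simp add: L2_def)
  then show ?thesis
    by (rule L2_dominated[rotated]) (use assms(3) in auto)
qed

section \<open>Completeness of L2 and domination of sequences\<close>

text \<open>Monotone convergence for series of nonnegative functions: a finite sum of integrals
  makes the pointwise sum finite almost everywhere.\<close>

lemma AE_summable_integrable:
  fixes g :: "nat \<Rightarrow> 'a \<Rightarrow> real"
  assumes int: "\<And>k. integrable M (g k)" and nn: "\<And>k x. 0 \<le> g k x"
    and sm: "summable (\<lambda>k. integral\<^sup>L M (g k))"
  shows "AE x in M. summable (\<lambda>k. g k x)" "integrable M (\<lambda>x. \<Sum>k. g k x)"
proof -
  note [measurable] = borel_measurable_integrable[OF int]
  have "(\<integral>\<^sup>+x. (\<Sum>k. ennreal (g k x)) \<partial>M) = (\<Sum>k. \<integral>\<^sup>+x. ennreal (g k x) \<partial>M)"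
    by (intro nn_integral_suminf) measurable
  also have "\<dots> = (\<Sum>k. ennreal (integral\<^sup>L M (g k)))"
    using nn by (intro suminf_cong nn_integral_eq_integral int) auto
  also have "\<dots> = ennreal (\<Sum>k. integral\<^sup>L M (g k))"
    using sm nn by (intro suminf_ennreal2) auto
  finally have "(\<integral>\<^sup>+x. (\<Sum>k. ennreal (g k x)) \<partial>M) \<noteq> \<infinity>" by simp
  then have "AE x in M. (\<Sum>k. ennreal (g k x)) \<noteq> \<infinity>"
    by (intro nn_integral_PInf_AE) auto
  then show *: "AE x in M. summable (\<lambda>k. g k x)"
    by eventually_elim (rule summable_suminf_not_top, use nn in auto)
  show "integrable M (\<lambda>x. \<Sum>k. g k x)"
    by (rule integrable_suminf[OF int]) (use * nn sm in auto)
qed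

text \<open>The majorant is the square root of the pointwise sum of squares. A single majorant for a
  whole sequence is what the comparison principle needs in
  \<open>state_locally_bounded\<close>.\<close>

lemma L2_dominating_function:
  fixes h :: "nat \<Rightarrow> real^'n::finite \<Rightarrow> real"
  assumes h: "\<And>k. h k \<in> L2 \<Omega>" and sm: "summable (\<lambda>k. (L2_norm \<Omega> (h k))\<^sup>2)"
  shows "\<exists>H\<in>L2 \<Omega>. AE x in lebesgue_on \<Omega>. \<forall>k. \<bar>h k x\<bar> \<le> H x"
proof (rule bexI)
  note [measurable] = h
  define H where "H x = sqrt (\<Sum>k. (h k x)\<^sup>2)" for x
  have s: "summable (\<lambda>k. LINT x|lebesgue_on \<Omega>. (h k x)\<^sup>2)" using sm by (simp add: L2_norm_sq h)
  note A = AE_summable_integrable[OF L2_integrable_square[OF h] _ s]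
  have "(\<lambda>x. \<Sum>k. (h k x)\<^sup>2) \<in> borel_measurable (lebesgue_on \<Omega>)" by measurable
  then have Hm [measurable]: "H \<in> borel_measurable (lebesgue_on \<Omega>)" unfolding H_def[abs_def] by measurable
  have "integrable (lebesgue_on \<Omega>) (\<lambda>x. (H x)\<^sup>2)"
  proof (rule integrable_cong_AE_imp)
    show "integrable (lebesgue_on \<Omega>) (\<lambda>x. \<Sum>k. (h k x)\<^sup>2)" by (rule A(2)) auto
    have "AE x in lebesgue_on \<Omega>. summable (\<lambda>k. (h k x)\<^sup>2)" by (rule A(1)) auto
    then show "AE x in lebesgue_on \<Omega>. (\<Sum>k. (h k x)\<^sup>2) = (H x)\<^sup>2"
      by eventually_elim (simp add: H_def suminf_nonneg)
  qed auto
  then show "H \<in> L2 \<Omega>" by (simp add: L2_def)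
  have "AE x in lebesgue_on \<Omega>. summable (\<lambda>k. (h k x)\<^sup>2)" by (rule A(1)) auto
  then show "AE x in lebesgue_on \<Omega>. \<forall>k. \<bar>h k x\<bar> \<le> H x"
  proof eventually_elim
    case (elim x)
    show ?case
    proof
      fix k
      have "(h k x)\<^sup>2 \<le> (\<Sum>k. (h k x)\<^sup>2)"
        using sum_le_suminf[OF elim, of "{k}"] by simp
      then show "\<bar>h k x\<bar> \<le> H x" unfolding H_def by (simp add: real_le_rsqrt)
    qed
  qed
qed

text \<open>Riesz--Fischer: a rapidly convergent subsequence converges almost everywhere, and
  Fatou's lemma applied along it, with the other index fixed, carries the Cauchy estimate over to
  the limit.\<close>

lemma L2_complete:
  fixes x :: "nat \<Rightarrow> real^'n::finite \<Rightarrow> real"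
  assumes x: "\<And>n. x n \<in> L2 \<Omega>"
    and cauchy: "\<And>e. e > 0 \<Longrightarrow> \<exists>N. \<forall>m\<ge>N. \<forall>n\<ge>N. L2_dist \<Omega> (x m) (x n) < e"
  shows "\<exists>l\<in>L2 \<Omega>. (\<lambda>n. L2_dist \<Omega> (x n) l) \<longlonglongrightarrow> 0"
proof -
  note [measurable] = x
  have "\<exists>N. \<forall>k::nat. \<forall>m\<ge>N k. \<forall>n\<ge>N k. L2_dist \<Omega> (x m) (x n) < (1/2) ^ k"
    by (intro choice allI cauchy) auto
  then obtain N where N: "\<And>k m n. m \<ge> N k \<Longrightarrow> n \<ge> N k \<Longrightarrow> L2_dist \<Omega> (x m) (x n) < (1/2) ^ k" by blast
  \<comment> \<open>Partial sums of \<open>N\<close> are monotone in \<open>k\<close> and stay above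
    \<open>N k\<close>.\<close>
  define r where "r k = (\<Sum>i\<le>k. N i)" for k
  have rN: "r k \<ge> N k" "r (Suc k) \<ge> N k" for k
    unfolding r_def by (intro member_le_sum; simp)+
  have r_mono: "r j \<le> r k" if "j \<le> k" for j k
    unfolding r_def using that by (intro sum_mono2) auto
  define d where "d k t = x (r (Suc k)) t - x (r k) t" for k t
  have dL: "d k \<in> L2 \<Omega>" for k unfolding d_def[abs_def] by (intro L2_diff x)
  have dn: "L2_norm \<Omega> (d k) < (1/2) ^ k" for k unfolding d_def[abs_def] by (intro N rN)
  have int: "integrable (lebesgue_on \<Omega>) (\<lambda>t. 2 ^ k * (d k t)\<^sup>2)" for k
    by (intro Bochner_Integration.integrable_mult_right L2_integrable_square dL)
  have "AE t in lebesgue_on \<Omega>. summable (\<lambda>k. 2 ^ k * (d k t)\<^sup>2)"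
  proof (rule AE_summable_integrable(1)[OF int])
    show "summable (\<lambda>k. LINT t|lebesgue_on \<Omega>. 2 ^ k * (d k t)\<^sup>2)"
    proof (rule summable_comparison_test')
      show "summable (\<lambda>k. (1/2::real) ^ k)" by (intro summable_geometric) auto
      fix k
      have "(LINT t|lebesgue_on \<Omega>. 2 ^ k * (d k t)\<^sup>2) = 2 ^ k * (L2_norm \<Omega> (d k))\<^sup>2"
        by (simp add: L2_norm_sq dL)
      also have "\<dots> \<le> 2 ^ k * ((1/2) ^ k)\<^sup>2"
        using dn[of k] L2.nrm_nonneg[OF dL, of k] by (intro mult_left_mono power_mono) auto
      also have "\<dots> = (1/2) ^ k" by (simp add: power2_eq_square power_divide)
      finally show "norm (LINT t|lebesgue_on \<Omega>. 2 ^ k * (d k t)\<^sup>2) \<le> (1/2) ^ k" by simp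
    qed
  qed auto
  then have conv: "AE t in lebesgue_on \<Omega>. (\<lambda>k. x (r k) t) \<longlonglongrightarrow> lim (\<lambda>k. x (r k) t)"
  proof eventually_elim
    case (elim t)
    have "summable (\<lambda>k. d k t)"
    proof (rule summable_comparison_test')
      show "summable (\<lambda>k. (1/2::real) ^ k + 2 ^ k * (d k t)\<^sup>2)"
        by (intro summable_add elim summable_geometric) auto
      fix k
      \<comment> \<open>Either the increment is at most \<open>(1/2) ^ k\<close>, or the weight
        \<open>2 ^ k\<close> makes its square dominate it. The weighted squares still have summable
        integrals, because the norm of \<open>d k\<close> is below \<open>(1/2) ^ k\<close>.\<close>
      have "\<bar>d k t\<bar> \<le> (1/2) ^ k + 2 ^ k * (d k t)\<^sup>2"
      proof (cases "\<bar>d k t\<bar> \<le> (1/2) ^ k")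
        case True
        moreover have "0 \<le> 2 ^ k * (d k t)\<^sup>2" by simp
        ultimately show ?thesis by linarith
      next
        case False
        then have "1 \<le> 2 ^ k * \<bar>d k t\<bar>" by (simp add: power_divide field_simps)
        then have "1 * \<bar>d k t\<bar> \<le> 2 ^ k * \<bar>d k t\<bar> * \<bar>d k t\<bar>" by (intro mult_right_mono) auto
        also have "\<dots> = 2 ^ k * (d k t)\<^sup>2" by (simp add: power2_eq_square)
        finally show ?thesis by (simp add: add_increasing)
      qed
      then show "norm (d k t) \<le> (1/2) ^ k + 2 ^ k * (d k t)\<^sup>2" by simp
    qed
    then have "convergent (\<lambda>n. \<Sum>k<n. d k t)" by (simp add: summable_iff_convergent)
    moreover have "(\<Sum>k<n. d k t) = x (r n) t - x (r 0) t" for n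
      unfolding d_def by (rule sum_lessThan_telescope)
    ultimately have "convergent (\<lambda>n. x (r n) t - x (r 0) t)" by simp
    then have "convergent (\<lambda>n. x (r n) t)" by (simp add: convergent_diff_const_right_iff)
    then show ?case by (simp add: convergent_LIMSEQ_iff)
  qed
  \<comment> \<open>Defined everywhere, with meaningless values off the set of convergence; this
    gives measurability at once.\<close>
  define l where "l t = lim (\<lambda>k. x (r k) t)" for t
  have lm [measurable]: "l \<in> borel_measurable (lebesgue_on \<Omega>)"
    unfolding l_def[abs_def] by measurable
  have fatou: "integrable (lebesgue_on \<Omega>) (\<lambda>t. (x n t - l t)\<^sup>2) \<and>
      (LINT t|lebesgue_on \<Omega>. (x n t - l t)\<^sup>2) \<le> ((1/2) ^ k)\<^sup>2" if "n \<ge> N k" for n k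
  proof -
    have "(\<integral>\<^sup>+t. ennreal ((x n t - l t)\<^sup>2) \<partial>lebesgue_on \<Omega>)
        = (\<integral>\<^sup>+t. liminf (\<lambda>j. ennreal ((x n t - x (r j) t)\<^sup>2)) \<partial>lebesgue_on \<Omega>)"
      using conv
    proof (intro nn_integral_cong_AE, eventually_elim)
      case (elim t)
      have "(\<lambda>j. ennreal ((x n t - x (r j) t)\<^sup>2)) \<longlonglongrightarrow> ennreal ((x n t - l t)\<^sup>2)"
        unfolding l_def by (intro tendsto_intros tendsto_ennrealI elim)
      then show ?case using lim_imp_Liminf[OF trivial_limit_sequentially] by metis
    qed
    also have "\<dots> \<le> liminf (\<lambda>j. \<integral>\<^sup>+t. ennreal ((x n t - x (r j) t)\<^sup>2) \<partial>lebesgue_on \<Omega>)"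
      by (intro nn_integral_liminf) measurable
    also have "\<dots> \<le> ennreal (((1/2) ^ k)\<^sup>2)"
    proof -
      have "(\<integral>\<^sup>+t. ennreal ((x n t - x (r j) t)\<^sup>2) \<partial>lebesgue_on \<Omega>) \<le> ennreal (((1/2) ^ k)\<^sup>2)" if "j \<ge> k" for j
      proof -
        have D: "(\<lambda>t. x n t - x (r j) t) \<in> L2 \<Omega>" by (intro L2_diff x)
        have "(\<integral>\<^sup>+t. ennreal ((x n t - x (r j) t)\<^sup>2) \<partial>lebesgue_on \<Omega>)
            = ennreal ((L2_norm \<Omega> (\<lambda>t. x n t - x (r j) t))\<^sup>2)"
          unfolding L2_norm_sq[OF D] by (intro nn_integral_eq_integral L2_integrable_square D) auto
        also have "\<dots> \<le> ennreal (((1/2) ^ k)\<^sup>2)"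
          using N[of k n "r j"] \<open>n \<ge> N k\<close> rN(1)[of k] r_mono[OF that] L2.nrm_nonneg[OF D]
          by (intro ennreal_leI power_mono) auto
        finally show ?thesis .
      qed
      then have "\<forall>\<^sub>F j in sequentially. (\<integral>\<^sup>+t. ennreal ((x n t - x (r j) t)\<^sup>2) \<partial>lebesgue_on \<Omega>) \<le> ennreal (((1/2) ^ k)\<^sup>2)"
        by (auto simp: eventually_sequentially)
      then have "liminf (\<lambda>j. \<integral>\<^sup>+t. ennreal ((x n t - x (r j) t)\<^sup>2) \<partial>lebesgue_on \<Omega>) \<le> liminf (\<lambda>j. ennreal (((1/2) ^ k)\<^sup>2))"
        by (rule Liminf_mono)
      then show ?thesis by (simp add: Liminf_const)
    qed
    finally have le: "(\<integral>\<^sup>+t. ennreal ((x n t - l t)\<^sup>2) \<partial>lebesgue_on \<Omega>) \<le> ennreal (((1/2) ^ k)\<^sup>2)" .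
    then have int: "integrable (lebesgue_on \<Omega>) (\<lambda>t. (x n t - l t)\<^sup>2)"
      by (intro integrableI_nonneg) (auto simp: less_top[symmetric] top_unique)
    moreover have "(LINT t|lebesgue_on \<Omega>. (x n t - l t)\<^sup>2) \<le> ((1/2) ^ k)\<^sup>2"
      using le nn_integral_eq_integral[OF int] by (simp add: ennreal_le_iff)
    ultimately show ?thesis by blast
  qed
  have diffL: "(\<lambda>t. x n t - l t) \<in> L2 \<Omega>" if "n \<ge> N k" for n k
    using fatou[OF that] by (simp add: L2_def)
  have lL: "l \<in> L2 \<Omega>"
    using L2_diff[OF x diffL[of 0 "N 0"], of "N 0"] by simp
  have "(\<lambda>n. L2_dist \<Omega> (x n) l) \<longlonglongrightarrow> 0"
  proof (rule LIMSEQ_I)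
    fix e :: real assume "e > 0"
    then obtain k where k: "(1/2) ^ k < e" using real_arch_pow_inv[of e "1/2"] by auto
    have "L2_dist \<Omega> (x n) l < e" if "n \<ge> N k" for n
    proof -
      have "(L2_dist \<Omega> (x n) l)\<^sup>2 \<le> ((1/2) ^ k)\<^sup>2"
        unfolding L2_norm_sq[OF diffL[OF that]] using fatou[OF that] by blast
      then have "L2_dist \<Omega> (x n) l \<le> (1/2) ^ k" by (rule power2_le_imp_le) simp
      then show ?thesis using k by simp
    qed
    then show "\<exists>no. \<forall>n\<ge>no. norm (L2_dist \<Omega> (x n) l - 0) < e"
      using L2.nrm_nonneg[OF L2_diff[OF x lL]] by auto
  qed
  then show ?thesis using lL by blast
qed

text \<open>The factors \<open>b j\<close> are small only in L2 and \<open>G\<close> may be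
  unbounded. Where \<open>\<bar>G\<bar>\<close> is at most \<open>K\<close> the product is
  controlled by the norm of \<open>b j\<close>; where it is larger, by \<open>C\<close> and the tail
  \<open>T K\<close> of \<open>G\<close>, which vanishes by dominated convergence. It provides the
  critical limit in the chain rule \<open>H10_compose\<close>.\<close>

lemma L2_norm_mult_tendsto_0:
  fixes b :: "nat \<Rightarrow> real^'n::finite \<Rightarrow> real"
  assumes b: "\<And>j. b j \<in> L2 \<Omega>" "\<And>j x. \<bar>b j x\<bar> \<le> C" and lim: "(\<lambda>j. L2_norm \<Omega> (b j)) \<longlonglongrightarrow> 0"
    and G: "G \<in> L2 \<Omega>"
  shows "(\<lambda>j. L2_norm \<Omega> (\<lambda>x. b j x * G x)) \<longlonglongrightarrow> 0"
proof -
  note [measurable] = b(1) G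
  have bG: "(\<lambda>x. b j x * G x) \<in> L2 \<Omega>" for j
    by (rule L2_mult_bounded(1)[OF _ G]) (use b in auto)
  have C0: "C \<ge> 0" using b(2)[of 0 undefined] by linarith
  define T where "T K x = (G x)\<^sup>2 * indicat_real {y. real K < \<bar>y\<bar>} (G x)" for K x
  have Tm [measurable]: "T K \<in> borel_measurable (lebesgue_on \<Omega>)" for K
    unfolding T_def[abs_def] by measurable
  have Tint: "integrable (lebesgue_on \<Omega>) (T K)" for K
    by (rule Bochner_Integration.integrable_bound[OF L2_integrable_square[OF G]])
      (auto simp: T_def indicator_def)
  have "(\<lambda>K. LINT x|lebesgue_on \<Omega>. T K x) \<longlonglongrightarrow> (LINT x|lebesgue_on \<Omega>. 0)"
  proof (rule integral_dominated_convergence[OF _ _ L2_integrable_square[OF G]])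
    show "AE x in lebesgue_on \<Omega>. (\<lambda>K. T K x) \<longlonglongrightarrow> 0"
    proof (rule AE_I2)
      fix x
      obtain K0 where "\<bar>G x\<bar> < real K0" using reals_Archimedean2 by blast
      then have "T K x = 0" if "K \<ge> K0" for K using that by (auto simp: T_def indicator_def)
      then show "(\<lambda>K. T K x) \<longlonglongrightarrow> 0"
        by (intro tendsto_eventually) (auto simp: eventually_sequentially)
    qed
  qed (auto simp: T_def indicator_def)
  then have Tlim: "(\<lambda>K. LINT x|lebesgue_on \<Omega>. T K x) \<longlonglongrightarrow> 0" by simp
  have bound: "(L2_norm \<Omega> (\<lambda>x. b j x * G x))\<^sup>2 \<le> C\<^sup>2 * (LINT x|lebesgue_on \<Omega>. T K x) + (real K)\<^sup>2 * (L2_norm \<Omega> (b j))\<^sup>2" for j K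
  proof -
    have "(L2_norm \<Omega> (\<lambda>x. b j x * G x))\<^sup>2 = (LINT x|lebesgue_on \<Omega>. (b j x * G x)\<^sup>2)" by (rule L2_norm_sq[OF bG])
    also have "\<dots> \<le> (LINT x|lebesgue_on \<Omega>. C\<^sup>2 * T K x + (real K)\<^sup>2 * (b j x)\<^sup>2)"
    proof (rule integral_mono_AE)
      show "integrable (lebesgue_on \<Omega>) (\<lambda>x. C\<^sup>2 * T K x + (real K)\<^sup>2 * (b j x)\<^sup>2)"
        by (intro Bochner_Integration.integrable_add Bochner_Integration.integrable_mult_right Tint L2_integrable_square b)
      have "(b j x * G x)\<^sup>2 \<le> C\<^sup>2 * T K x + (real K)\<^sup>2 * (b j x)\<^sup>2" for x
      proof (cases "real K < \<bar>G x\<bar>")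
        case True
        have "(b j x)\<^sup>2 \<le> C\<^sup>2" using b(2)[of j x] C0 by (simp add: abs_le_square_iff[symmetric])
        then have "(b j x)\<^sup>2 * (G x)\<^sup>2 \<le> C\<^sup>2 * (G x)\<^sup>2" by (intro mult_right_mono) auto
        then show ?thesis using True by (simp add: T_def power_mult_distrib add_increasing2)
      next
        case False
        then have "(G x)\<^sup>2 \<le> (real K)\<^sup>2" by (simp add: abs_le_square_iff[symmetric])
        then have "(b j x)\<^sup>2 * (G x)\<^sup>2 \<le> (b j x)\<^sup>2 * (real K)\<^sup>2" by (intro mult_left_mono) auto
        then show ?thesis using False by (simp add: T_def power_mult_distrib mult.commute)
      qed
      then show "AE x in lebesgue_on \<Omega>. (b j x * G x)\<^sup>2 \<le> C\<^sup>2 * T K x + (real K)\<^sup>2 * (b j x)\<^sup>2" by simp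
    qed (rule L2_integrable_square[OF bG])
    also have "\<dots> = C\<^sup>2 * (LINT x|lebesgue_on \<Omega>. T K x) + (real K)\<^sup>2 * (LINT x|lebesgue_on \<Omega>. (b j x)\<^sup>2)"
      by (simp add: Tint L2_integrable_square b)
    finally show ?thesis by (simp add: L2_norm_sq b)
  qed
  have "(\<lambda>j. (L2_norm \<Omega> (\<lambda>x. b j x * G x))\<^sup>2) \<longlonglongrightarrow> 0"
  proof (rule LIMSEQ_I)
    fix e :: real assume e: "e > 0"
    \<comment> \<open>The level \<open>K\<close> is fixed before \<open>j\<close>: the tail is small
      uniformly in \<open>j\<close>, and afterwards \<open>K\<close> is merely a constant
      factor.\<close>
    have "(\<lambda>K. C\<^sup>2 * (LINT x|lebesgue_on \<Omega>. T K x)) \<longlonglongrightarrow> C\<^sup>2 * 0" by (intro tendsto_intros Tlim)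
    then have "\<forall>\<^sub>F K in sequentially. C\<^sup>2 * (LINT x|lebesgue_on \<Omega>. T K x) < e / 2"
      using e by (intro order_tendstoD(2)) auto
    then obtain K where K: "C\<^sup>2 * (LINT x|lebesgue_on \<Omega>. T K x) < e / 2" by (auto simp: eventually_sequentially)
    have "(\<lambda>j. (real K)\<^sup>2 * (L2_norm \<Omega> (b j))\<^sup>2) \<longlonglongrightarrow> (real K)\<^sup>2 * 0\<^sup>2" by (intro tendsto_intros lim)
    then have "\<forall>\<^sub>F j in sequentially. (real K)\<^sup>2 * (L2_norm \<Omega> (b j))\<^sup>2 < e / 2"
      using e by (intro order_tendstoD(2)) auto
    then obtain N where N: "\<And>j. j \<ge> N \<Longrightarrow> (real K)\<^sup>2 * (L2_norm \<Omega> (b j))\<^sup>2 < e / 2" by (auto simp: eventually_sequentially)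
    have "(L2_norm \<Omega> (\<lambda>x. b j x * G x))\<^sup>2 < e" if "j \<ge> N" for j
      using bound[of j K] K N[OF that] by linarith
    then show "\<exists>no. \<forall>n\<ge>no. norm ((L2_norm \<Omega> (\<lambda>x. b n x * G x))\<^sup>2 - 0) < e" by auto
  qed
  then show ?thesis
    using tendsto_real_sqrt[of "\<lambda>j. (L2_norm \<Omega> (\<lambda>x. b j x * G x))\<^sup>2" 0] L2.nrm_nonneg[OF bG] by simp
qed

section \<open>The Sobolev space H10\<close>

text \<open>The gradient vanishes off \<open>K\<close> as well, because the complement of the
  compact set is open and \<open>\<phi>\<close> is zero near each of its points.\<close>

lemma C1c_support:
  assumes "C1c \<Omega> \<phi> D"
  obtains K where "compact K" "K \<subseteq> \<Omega>" "\<And>x. x \<notin> K \<Longrightarrow> \<phi> x = 0" "\<And>x. x \<notin> K \<Longrightarrow> D x = 0"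
proof -
  obtain K where K: "compact K" "K \<subseteq> \<Omega>" "\<And>x. x \<notin> K \<Longrightarrow> \<phi> x = 0"
    using assms by (auto simp: C1c_def)
  have "D x = 0" if x: "x \<notin> K" for x
  proof -
    have "((\<lambda>x. 0) has_derivative (\<lambda>h. 0)) (at x)" by simp
    then have "(\<phi> has_derivative (\<lambda>h. 0)) (at x)"
      by (rule has_derivative_transform_within_open[of _ _ _ _ "- K"])
        (use x K compact_imp_closed in auto)
    moreover have "(\<phi> has_derivative (\<lambda>h. h \<bullet> D x)) (at x)"
      using assms by (auto simp: C1c_def gderiv_def)
    ultimately have "(\<lambda>h. h \<bullet> D x) = (\<lambda>h. 0)" by (metis has_derivative_unique)
    then have "D x \<bullet> D x = 0" by metis
    then show ?thesis by simp
  qed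
  then show ?thesis using that K by blast
qed

lemma C1c_continuous: "C1c \<Omega> \<phi> D \<Longrightarrow> continuous_on UNIV \<phi>"
  unfolding C1c_def gderiv_def by (meson continuous_at_imp_continuous_on has_derivative_continuous)

text \<open>The support is carried by the first factor alone, so the second one may be a coordinate
  function, as in the Poincare inequality.\<close>

lemma C1c_mult:
  assumes "C1c \<Omega> \<phi> D" "\<And>x. GDERIV \<psi> x :> D' x" "continuous_on UNIV D'"
  shows "C1c \<Omega> (\<lambda>x. \<phi> x * \<psi> x) (\<lambda>x. \<phi> x *\<^sub>R D' x + \<psi> x *\<^sub>R D x)"
proof -
  have \<psi>: "continuous_on UNIV \<psi>"
    using assms(2) unfolding gderiv_def by (meson continuous_at_imp_continuous_on has_derivative_continuous)
  show ?thesis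
    using assms C1c_continuous[OF assms(1)] \<psi>
    by (auto simp: C1c_def intro!: GDERIV_mult continuous_intros)
qed

lemma C1c_linear:
  assumes "C1c \<Omega> \<phi> D" "C1c \<Omega> \<psi> D'"
  shows "C1c \<Omega> (\<lambda>x. a * \<phi> x + b * \<psi> x) (\<lambda>x. a *\<^sub>R D x + b *\<^sub>R D' x)"
proof -
  have "GDERIV (\<lambda>x. a * \<phi> x + b * \<psi> x) x :> a *\<^sub>R D x + b *\<^sub>R D' x" for x
  proof -
    have "GDERIV (\<lambda>x. a * \<phi> x) x :> a *\<^sub>R D x" "GDERIV (\<lambda>x. b * \<psi> x) x :> b *\<^sub>R D' x"
      using GDERIV_mult[OF GDERIV_const, of \<phi> x "D x" a] GDERIV_mult[OF GDERIV_const, of \<psi> x "D' x" b] assms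
      by (auto simp: C1c_def)
    then show ?thesis by (rule GDERIV_add)
  qed
  moreover have "continuous_on UNIV (\<lambda>x. a *\<^sub>R D x + b *\<^sub>R D' x)"
    using assms by (auto simp: C1c_def intro!: continuous_intros)
  moreover obtain K K' where "compact K" "K \<subseteq> \<Omega>" "\<And>x. x \<notin> K \<Longrightarrow> \<phi> x = 0"
      "compact K'" "K' \<subseteq> \<Omega>" "\<And>x. x \<notin> K' \<Longrightarrow> \<psi> x = 0"
    using assms unfolding C1c_def by metis
  then have "compact (K \<union> K')" "K \<union> K' \<subseteq> \<Omega>" "\<forall>x. x \<notin> K \<union> K' \<longrightarrow> a * \<phi> x + b * \<psi> x = 0"
    by (auto intro: compact_Un)
  ultimately show ?thesis unfolding C1c_def by blast
qed

lemma C1c_compose: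
  assumes "C1c \<Omega> \<phi> D" "\<And>t. (g has_field_derivative g' t) (at t)" "continuous_on UNIV g'" "g 0 = 0"
  shows "C1c \<Omega> (\<lambda>x. g (\<phi> x)) (\<lambda>x. g' (\<phi> x) *\<^sub>R D x)"
proof -
  have "continuous_on UNIV (\<lambda>x. g' (\<phi> x))"
    using continuous_on_compose2[OF assms(3) C1c_continuous[OF assms(1)]] by auto
  moreover have D: "continuous_on UNIV D" "\<And>x. GDERIV \<phi> x :> D x" using assms(1) by (auto simp: C1c_def)
  ultimately have "continuous_on UNIV (\<lambda>x. g' (\<phi> x) *\<^sub>R D x)" by (intro continuous_on_scaleR)
  moreover have "GDERIV (\<lambda>x. g (\<phi> x)) x :> g' (\<phi> x) *\<^sub>R D x" for x
    by (rule GDERIV_DERIV_compose[OF D(2) assms(2)])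
  moreover obtain K where "compact K" "K \<subseteq> \<Omega>" "\<And>x. x \<notin> K \<Longrightarrow> \<phi> x = 0"
    using assms(1) by (auto simp: C1c_def)
  ultimately show ?thesis unfolding C1c_def using assms(4) by metis
qed

text \<open>Translation invariance of Lebesgue measure: each difference quotient in direction
  \<open>i\<close> has integral zero, and dominated convergence passes to the derivative. All
  integration by parts below rests on this.\<close>

lemma C1c_integral_grad_lborel:
  fixes \<phi> :: "real^'n::finite \<Rightarrow> real"
  assumes C: "C1c \<Omega> \<phi> D"
  shows "(LINT x|lborel. D x $ i) = 0"
proof -
  obtain K where K: "compact K" "K \<subseteq> \<Omega>" "\<And>x. x \<notin> K \<Longrightarrow> \<phi> x = 0" "\<And>x. x \<notin> K \<Longrightarrow> D x = 0"
    using C by (rule C1c_support) auto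
  define e where "e = (axis i 1 :: real^'n)"
  have cD: "continuous_on UNIV D" and der: "(\<phi> has_derivative (\<lambda>h. h \<bullet> D x)) (at x)" for x
    using C by (auto simp: C1c_def gderiv_def)
  have c\<phi>: "continuous_on UNIV \<phi>" by (rule C1c_continuous[OF C])
  have m\<phi> [measurable]: "\<phi> \<in> borel_measurable borel" by (rule borel_measurable_continuous_onI[OF c\<phi>])
  have "bounded (D ` K)"
    using cD K(1) by (intro compact_imp_bounded compact_continuous_image) (auto intro: continuous_on_subset)
  then obtain B where B: "B > 0" "\<And>x. x \<in> K \<Longrightarrow> norm (D x) \<le> B" by (auto simp: bounded_pos)
  have DB: "norm (D x) \<le> B" for x using B K(4)[of x] by (cases "x \<in> K") auto
  \<comment> \<open>The global Lipschitz bound is what dominates the difference quotients.\<close>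
  have lip: "\<bar>\<phi> x - \<phi> y\<bar> \<le> B * norm (x - y)" for x y
  proof -
    have "onorm (\<lambda>h. h \<bullet> D x) \<le> B" for x
    proof (rule onorm_le)
      fix h show "norm (h \<bullet> D x) \<le> B * norm h"
        using Cauchy_Schwarz_ineq2[of h "D x"] mult_right_mono[OF DB[of x], of "norm h"] by (simp add: mult.commute)
    qed
    then have "norm (\<phi> x - \<phi> y) \<le> B * norm (x - y)"
      by (intro differentiable_bound[of UNIV \<phi> "\<lambda>x h. h \<bullet> D x"] der) auto
    then show ?thesis by simp
  qed
  define s where "s n x = (\<phi> (inverse (real (Suc n)) *\<^sub>R e + x) - \<phi> x) / inverse (real (Suc n))" for n x
  \<comment> \<open>The increments \<open>inverse (real (Suc n))\<close> are at most 1, so the unit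
    neighbourhood of \<open>K\<close> contains the supports of all difference quotients.\<close>
  define K' where "K' = {x + y | x y. x \<in> K \<and> y \<in> cball (0::real^'n) 1}"
  have K': "compact K'" unfolding K'_def by (intro compact_sums K compact_cball)
  have ne: "norm e = 1" by (simp add: e_def)
  have s_bound: "\<bar>s n x\<bar> \<le> B * indicat_real K' x" for n x
  proof (cases "x \<in> K'")
    case True
    have "\<bar>\<phi> (inverse (real (Suc n)) *\<^sub>R e + x) - \<phi> x\<bar> \<le> B * inverse (real (Suc n))"
      using lip[of "inverse (real (Suc n)) *\<^sub>R e + x" x] ne by simp
    then have "\<bar>\<phi> (inverse (real (Suc n)) *\<^sub>R e + x) - \<phi> x\<bar> / inverse (real (Suc n)) \<le> B"
      by (subst pos_divide_le_eq) auto
    then show ?thesis using True by (simp add: s_def abs_divide del: of_nat_Suc)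
  next
    case False
    have "x \<notin> K" using False by (force simp: K'_def)
    moreover have "inverse (real (Suc n)) *\<^sub>R e + x \<notin> K"
    proof
      assume "inverse (real (Suc n)) *\<^sub>R e + x \<in> K"
      moreover have "- inverse (real (Suc n)) *\<^sub>R e \<in> cball 0 1" using ne by (simp add: inverse_le_1_iff)
      moreover have "x = (inverse (real (Suc n)) *\<^sub>R e + x) + (- inverse (real (Suc n)) *\<^sub>R e)" by simp
      ultimately have "x \<in> K'" unfolding K'_def by blast
      with False show False by simp
    qed
    ultimately show ?thesis using False K(3) by (simp add: s_def)
  qed
  have lim: "(\<lambda>n. s n x) \<longlonglongrightarrow> D x $ i" for x
  proof -
    have "((\<lambda>t. \<phi> (t *\<^sub>R e + x)) has_derivative (\<lambda>h. (h *\<^sub>R e) \<bullet> D x)) (at 0)"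
    proof -
      have "((\<lambda>t. t *\<^sub>R e + x) has_derivative (\<lambda>h. h *\<^sub>R e)) (at 0)"
        by (auto intro!: derivative_eq_intros)
      from has_derivative_compose[OF this, of \<phi> "\<lambda>h. h \<bullet> D x"] der[of x] show ?thesis by simp
    qed
    moreover have "(\<lambda>h. (h *\<^sub>R e) \<bullet> D x) = (*) (D x $ i)"
      by (auto simp: e_def inner_axis' mult.commute)
    ultimately have "((\<lambda>t. \<phi> (t *\<^sub>R e + x)) has_field_derivative D x $ i) (at 0)"
      by (simp add: has_field_derivative_def)
    then have "((\<lambda>h. (\<phi> (h *\<^sub>R e + x) - \<phi> x) / h) \<longlongrightarrow> D x $ i) (at 0)"
      by (simp add: DERIV_def)
    moreover have "filterlim (\<lambda>n. inverse (real (Suc n))) (at 0) sequentially"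
      by (simp add: filterlim_at LIMSEQ_inverse_real_of_nat del: of_nat_Suc)
    ultimately show ?thesis unfolding s_def by (rule filterlim_compose)
  qed
  have int\<phi>: "integrable lborel \<phi>"
  proof -
    have "integrable lborel (\<lambda>x. indicator K x *\<^sub>R \<phi> x)"
      by (intro borel_integrable_compact K) (use c\<phi> continuous_on_subset in blast)
    moreover have "(\<lambda>x. indicator K x *\<^sub>R \<phi> x) = \<phi>" using K(3) by (auto simp: indicator_def fun_eq_iff)
    ultimately show ?thesis by simp
  qed
  have zero: "(LINT x|lborel. s n x) = 0" for n
  proof -
    define c where "c = inverse (real (Suc n)) *\<^sub>R e"
    have "(LINT x|lborel. \<phi> (c + x)) = (LINT x|distr lborel borel ((+) c). \<phi> x)"
      by (subst integral_distr) auto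
    then have eq: "(LINT x|lborel. \<phi> (c + x)) = (LINT x|lborel. \<phi> x)" by (simp add: lborel_distr_plus)
    have "integrable (distr lborel borel ((+) c)) \<phi>" using int\<phi> by (simp add: lborel_distr_plus)
    then have "integrable lborel (\<lambda>x. \<phi> (c + x))" by (subst (asm) integrable_distr_eq) auto
    then have "(LINT x|lborel. \<phi> (c + x) - \<phi> x) = 0" using eq int\<phi> by simp
    then show ?thesis unfolding s_def c_def by simp
  qed
  have "(\<lambda>n. LINT x|lborel. s n x) \<longlonglongrightarrow> (LINT x|lborel. D x $ i)"
  proof (rule integral_dominated_convergence)
    show "integrable lborel (\<lambda>x. B * indicat_real K' x)"
      using K' by (intro Bochner_Integration.integrable_mult_right integrable_real_indicator)
        (use emeasure_bounded_finite[of K'] in \<open>auto simp: borel_compact compact_imp_bounded\<close>)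
    show "(\<lambda>x. D x $ i) \<in> borel_measurable lborel"
      using cD by (auto intro!: borel_measurable_continuous_onI continuous_intros)
    show "s n \<in> borel_measurable lborel" for n unfolding s_def[abs_def] by measurable
  qed (use lim s_bound in auto)
  then show ?thesis unfolding zero by (simp add: LIMSEQ_const_iff)
qed

locale bounded_open =
  fixes \<Omega> :: "(real^'n::finite) set"
  assumes open_dom: "open \<Omega>" and bounded_dom: "bounded \<Omega>"
begin

lemma lmeasurable_dom [simp, intro]: "\<Omega> \<in> lmeasurable"
  using open_dom bounded_dom by (rule lmeasurable_open[rotated])

lemma C1c_integral_grad:
  assumes C: "C1c \<Omega> \<phi> D" shows "(LINT x|lebesgue_on \<Omega>. D x $ i) = 0"
proof -
  obtain K where K: "compact K" "K \<subseteq> \<Omega>" "\<And>x. x \<notin> K \<Longrightarrow> D x = 0"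
    using C by (rule C1c_support) auto
  have "(LINT x|lebesgue_on \<Omega>. D x $ i) = (LINT x|lebesgue. indicator \<Omega> x *\<^sub>R (D x $ i))"
    by (intro integral_restrict_space) (auto intro: fmeasurableD)
  also have "(\<lambda>x. indicator \<Omega> x *\<^sub>R (D x $ i)) = (\<lambda>x. D x $ i)"
  proof
    fix x show "indicator \<Omega> x *\<^sub>R (D x $ i) = D x $ i"
    proof (cases "x \<in> \<Omega>")
      case False
      then have "D x = 0" using K(2) by (intro K(3)) auto
      then show ?thesis by simp
    qed simp
  qed
  also have "(LINT x|lebesgue. D x $ i) = (LINT x|lborel. D x $ i)"
    using C by (intro integral_completion) (auto simp: C1c_def intro!: borel_measurable_continuous_onI continuous_intros)
  finally show ?thesis using C1c_integral_grad_lborel[OF C] by simp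
qed

lemma continuous_bounded_L2:
  assumes "continuous_on UNIV h" "compact K" "\<And>x. x \<notin> K \<Longrightarrow> h x = 0"
  shows "h \<in> L2 \<Omega>"
proof -
  have "bounded (h ` K)"
    using assms by (intro compact_imp_bounded compact_continuous_image) (auto intro: continuous_on_subset)
  then obtain B where B: "B > 0" "\<And>x. x \<in> K \<Longrightarrow> norm (h x) \<le> B" by (auto simp: bounded_pos)
  have "\<bar>h x\<bar> \<le> B" for x using B assms(3)[of x] by (cases "x \<in> K") auto
  moreover have "h \<in> borel_measurable (lebesgue_on \<Omega>)"
    using assms(1) by (intro continuous_imp_measurable_on_sets_lebesgue) (auto intro: continuous_on_subset fmeasurableD)
  ultimately show ?thesis by (intro L2_bounded[of _ _ B]) auto
qed

lemma C1c_L2: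
  assumes C: "C1c \<Omega> \<phi> D" shows "\<phi> \<in> L2 \<Omega>" "(\<lambda>x. D x $ i) \<in> L2 \<Omega>"
proof -
  obtain K where K: "compact K" "K \<subseteq> \<Omega>" "\<And>x. x \<notin> K \<Longrightarrow> \<phi> x = 0" "\<And>x. x \<notin> K \<Longrightarrow> D x = 0"
    using C by (rule C1c_support) auto
  show "\<phi> \<in> L2 \<Omega>" using C1c_continuous[OF C] K by (intro continuous_bounded_L2)
  show "(\<lambda>x. D x $ i) \<in> L2 \<Omega>"
    using C K by (intro continuous_bounded_L2[of _ K]) (auto simp: C1c_def intro!: continuous_intros)
qed

lemma C1c_integration_by_parts:
  assumes "C1c \<Omega> \<phi> D" "C1c \<Omega> \<psi> D'"
  shows "L2_inner \<Omega> \<phi> (\<lambda>x. D' x $ i) = - L2_inner \<Omega> (\<lambda>x. D x $ i) \<psi>"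
proof -
  have "(LINT x|lebesgue_on \<Omega>. (\<phi> x *\<^sub>R D' x + \<psi> x *\<^sub>R D x) $ i) = 0"
    by (rule C1c_integral_grad[OF C1c_mult[OF assms(1)]]) (use assms(2) in \<open>auto simp: C1c_def\<close>)
  then show ?thesis
    using L2_integrable_mult[OF C1c_L2(1)[OF assms(1)] C1c_L2(2)[OF assms(2)], of i]
      L2_integrable_mult[OF C1c_L2(1)[OF assms(2)] C1c_L2(2)[OF assms(1)], of i]
    by (simp add: L2_inner_def mult.commute)
qed

text \<open>The derivative in direction \<open>i\<close> of the function \<open>x $ i\<close> times
  the square of \<open>\<phi>\<close> has integral zero. This expresses the squared norm of
  \<open>\<phi>\<close> as -2 times the integral of \<open>x $ i * \<phi> x * D x $ i\<close>;
  bounding \<open>\<bar>x $ i\<bar>\<close> by \<open>R\<close>, Cauchy--Schwarz and cancelling one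
  norm finish. One partial derivative suffices.\<close>

lemma C1c_poincare:
  assumes C: "C1c \<Omega> \<phi> D" and R: "\<And>x. x \<in> \<Omega> \<Longrightarrow> norm x \<le> R" "R \<ge> 0"
  shows "L2_norm \<Omega> \<phi> \<le> 2 * R * L2_norm \<Omega> (\<lambda>x. D x $ i)"
proof -
  note L = C1c_L2(1)[OF C] C1c_L2(2)[OF C, of i]
  have G: "GDERIV (\<lambda>x. x $ i) x :> axis i 1" for x :: "real^'n"
    unfolding gderiv_def using bounded_linear_imp_has_derivative[OF bounded_linear_vec_nth[of i]]
    by (simp add: inner_axis)
  note C2 = C1c_mult[OF C1c_mult[OF C, where D' = D and \<psi> = \<phi>] G]
  have "(LINT x|lebesgue_on \<Omega>. ((\<phi> x * \<phi> x) *\<^sub>R axis i 1 + x $ i *\<^sub>R (\<phi> x *\<^sub>R D x + \<phi> x *\<^sub>R D x)) $ i) = 0"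
    by (rule C1c_integral_grad[OF C2]) (use C in \<open>auto simp: C1c_def\<close>)
  then have eq: "(LINT x|lebesgue_on \<Omega>. \<phi> x * \<phi> x + 2 * ((x $ i * \<phi> x) * (D x $ i))) = 0"
    by (simp add: algebra_simps)
  have "(\<lambda>x::real^'n. x $ i) \<in> borel_measurable (lebesgue_on \<Omega>)"
    by (intro continuous_imp_measurable_on_sets_lebesgue continuous_intros) (auto intro: fmeasurableD)
  moreover have "AE x in lebesgue_on \<Omega>. \<bar>x $ i\<bar> \<le> R"
  proof (rule AE_I2)
    fix x assume "x \<in> space (lebesgue_on \<Omega>)"
    then have "norm x \<le> R" using R(1) by simp
    then show "\<bar>x $ i\<bar> \<le> R" using component_le_norm_cart[of x i] by linarith
  qed
  ultimately have m: "(\<lambda>x. x $ i * \<phi> x) \<in> L2 \<Omega>" "L2_norm \<Omega> (\<lambda>x. x $ i * \<phi> x) \<le> R * L2_norm \<Omega> \<phi>"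
    by (rule L2_mult_bounded[OF _ L(1)]; simp add: R(2))+
  have "(L2_norm \<Omega> \<phi>)\<^sup>2 = - 2 * L2_inner \<Omega> (\<lambda>x. x $ i * \<phi> x) (\<lambda>x. D x $ i)"
    using eq L m by (simp add: L2.nrm_sq L2_inner_def L2_integrable_mult)
  also have "\<dots> \<le> 2 * (L2_norm \<Omega> (\<lambda>x. x $ i * \<phi> x) * L2_norm \<Omega> (\<lambda>x. D x $ i))"
    using L2.cauchy_schwarz[OF m(1) L(2)] by linarith
  also have "\<dots> \<le> 2 * (R * L2_norm \<Omega> \<phi> * L2_norm \<Omega> (\<lambda>x. D x $ i))"
    using m(2) L2.nrm_nonneg[OF L(2)] by (intro mult_left_mono mult_right_mono) auto
  finally have "L2_norm \<Omega> \<phi> * L2_norm \<Omega> \<phi> \<le> (2 * R * L2_norm \<Omega> (\<lambda>x. D x $ i)) * L2_norm \<Omega> \<phi>"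
    by (simp add: power2_eq_square algebra_simps)
  then show ?thesis
    using L2.nrm_nonneg[OF L(1)] L2.nrm_nonneg[OF L(2)] R(2)
    by (cases "L2_norm \<Omega> \<phi> = 0") (simp_all add: mult_le_cancel_right)
qed

section \<open>Closure properties of the Sobolev space\<close>

lemma H10_D:
  assumes "H10 \<Omega> y G" shows "y \<in> L2 \<Omega>" "(\<lambda>x. G x $ i) \<in> L2 \<Omega>"
  using assms by (auto simp: H10_def H1_def)

text \<open>Approximability by test functions already implies the weak gradient identity:
  integration by parts holds for each approximant and passes to the limit in L2.\<close>

lemma H10_I:
  assumes L: "y \<in> L2 \<Omega>" "\<And>i. (\<lambda>x. G x $ i) \<in> L2 \<Omega>"
    and C: "\<And>j::nat. C1c \<Omega> (\<phi> j) (D j)"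
    and lim: "(\<lambda>j. L2_dist \<Omega> (\<phi> j) y) \<longlonglongrightarrow> 0"
      "\<And>i. (\<lambda>j. L2_norm \<Omega> (\<lambda>x. D j x $ i - G x $ i)) \<longlonglongrightarrow> 0"
  shows "H10 \<Omega> y G"
proof -
  have "weak_gradient \<Omega> y G"
    unfolding weak_gradient_def
  proof (intro allI impI)
    fix \<psi> D' i assume \<psi>: "C1c \<Omega> \<psi> D'"
    have "(\<lambda>j. L2_inner \<Omega> (\<phi> j) (\<lambda>x. D' x $ i)) \<longlonglongrightarrow> L2_inner \<Omega> y (\<lambda>x. D' x $ i)"
      by (rule L2.ip_tendsto[OF C1c_L2(1)[OF C] L(1) C1c_L2(2)[OF \<psi>] lim(1)])
    moreover have "(\<lambda>j. - L2_inner \<Omega> (\<lambda>x. D j x $ i) \<psi>) \<longlonglongrightarrow> - L2_inner \<Omega> (\<lambda>x. G x $ i) \<psi>"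
      by (rule tendsto_minus, rule L2.ip_tendsto[OF C1c_L2(2)[OF C] L(2) C1c_L2(1)[OF \<psi>] lim(2)])
    ultimately have "L2_inner \<Omega> y (\<lambda>x. D' x $ i) = - L2_inner \<Omega> (\<lambda>x. G x $ i) \<psi>"
      unfolding C1c_integration_by_parts[OF C \<psi>] by (rule LIMSEQ_unique)
    then show "(LINT x|lebesgue_on \<Omega>. y x * D' x $ i) = - (LINT x|lebesgue_on \<Omega>. G x $ i * \<psi> x)"
      by (simp add: L2_inner_def)
  qed
  then show ?thesis using assms by (auto simp: H10_def H1_def)
qed

lemma H10_E:
  assumes "H10 \<Omega> y G"
  obtains \<phi> D where "\<And>j::nat. C1c \<Omega> (\<phi> j) (D j)" "(\<lambda>j. L2_dist \<Omega> (\<phi> j) y) \<longlonglongrightarrow> 0"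
      "\<And>i. (\<lambda>j. L2_norm \<Omega> (\<lambda>x. D j x $ i - G x $ i)) \<longlonglongrightarrow> 0"
  using assms by (auto simp: H10_def)

lemma H10_linear:
  assumes y: "H10 \<Omega> y G" and z: "H10 \<Omega> z Z"
  shows "H10 \<Omega> (\<lambda>x. a * y x + b * z x) (\<lambda>x. a *\<^sub>R G x + b *\<^sub>R Z x)"
proof -
  obtain \<phi> D where 1: "\<And>j::nat. C1c \<Omega> (\<phi> j) (D j)" "(\<lambda>j. L2_dist \<Omega> (\<phi> j) y) \<longlonglongrightarrow> 0"
      "\<And>i. (\<lambda>j. L2_norm \<Omega> (\<lambda>x. D j x $ i - G x $ i)) \<longlonglongrightarrow> 0" using y by (rule H10_E) blast
  obtain \<psi> D' where 2: "\<And>j::nat. C1c \<Omega> (\<psi> j) (D' j)" "(\<lambda>j. L2_dist \<Omega> (\<psi> j) z) \<longlonglongrightarrow> 0"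
      "\<And>i. (\<lambda>j. L2_norm \<Omega> (\<lambda>x. D' j x $ i - Z x $ i)) \<longlonglongrightarrow> 0" using z by (rule H10_E) blast
  have lim: "(\<lambda>j. L2_norm \<Omega> (\<lambda>x. (a * u j x + b * v j x) - (a * u' x + b * v' x))) \<longlonglongrightarrow> 0"
    if L: "\<And>j. u j \<in> L2 \<Omega>" "\<And>j. v j \<in> L2 \<Omega>" "u' \<in> L2 \<Omega>" "v' \<in> L2 \<Omega>"
      and l: "(\<lambda>j. L2_dist \<Omega> (u j) u') \<longlonglongrightarrow> 0" "(\<lambda>j. L2_dist \<Omega> (v j) v') \<longlonglongrightarrow> 0"
    for u v :: "nat \<Rightarrow> real^'n \<Rightarrow> real" and u' v'
  proof (rule tendsto_sandwich[of "\<lambda>_. 0" _ _ "\<lambda>j. \<bar>a\<bar> * L2_dist \<Omega> (u j) u' + \<bar>b\<bar> * L2_dist \<Omega> (v j) v'"])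
    have d: "(\<lambda>x. u j x - u' x) \<in> L2 \<Omega>" "(\<lambda>x. v j x - v' x) \<in> L2 \<Omega>" for j using L by (auto intro: L2_diff)
    have e: "(\<lambda>x. (a * u j x + b * v j x) - (a * u' x + b * v' x)) = (\<lambda>x. a * (u j x - u' x) + b * (v j x - v' x))" for j
      by (simp add: algebra_simps)
    have "L2_norm \<Omega> (\<lambda>x. (a * u j x + b * v j x) - (a * u' x + b * v' x))
        \<le> \<bar>a\<bar> * L2_dist \<Omega> (u j) u' + \<bar>b\<bar> * L2_dist \<Omega> (v j) v'" for j
      unfolding e using L2.nrm_add_le[OF L2_scale[OF d(1)] L2_scale[OF d(2)], of a j b j] d by (simp add: L2.nrm_sc)
    then show "\<forall>\<^sub>F j in sequentially. L2_norm \<Omega> (\<lambda>x. (a * u j x + b * v j x) - (a * u' x + b * v' x))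
        \<le> \<bar>a\<bar> * L2_dist \<Omega> (u j) u' + \<bar>b\<bar> * L2_dist \<Omega> (v j) v'" by simp
    show "\<forall>\<^sub>F j in sequentially. 0 \<le> L2_norm \<Omega> (\<lambda>x. (a * u j x + b * v j x) - (a * u' x + b * v' x))"
      using L by (intro always_eventually allI L2.nrm_nonneg L2_diff L2_add L2_scale)
    show "(\<lambda>j. \<bar>a\<bar> * L2_dist \<Omega> (u j) u' + \<bar>b\<bar> * L2_dist \<Omega> (v j) v') \<longlonglongrightarrow> 0"
      using tendsto_add[OF tendsto_mult_right_zero[OF l(1), of "\<bar>a\<bar>"] tendsto_mult_right_zero[OF l(2), of "\<bar>b\<bar>"]] by simp
  qed auto
  show ?thesis
  proof (rule H10_I[OF _ _ C1c_linear[OF 1(1) 2(1)]])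
    show "(\<lambda>x. a * y x + b * z x) \<in> L2 \<Omega>" using H10_D y z by (intro L2_add L2_scale)
    show "(\<lambda>x. (a *\<^sub>R G x + b *\<^sub>R Z x) $ i) \<in> L2 \<Omega>" for i using H10_D y z by (auto intro!: L2_add L2_scale)
    show "(\<lambda>j. L2_norm \<Omega> (\<lambda>x. a * \<phi> j x + b * \<psi> j x - (a * y x + b * z x))) \<longlonglongrightarrow> 0"
      by (rule lim[OF C1c_L2(1)[OF 1(1)] C1c_L2(1)[OF 2(1)] H10_D(1)[OF y] H10_D(1)[OF z] 1(2) 2(2)])
    show "(\<lambda>j. L2_norm \<Omega> (\<lambda>x. (a *\<^sub>R D j x + b *\<^sub>R D' j x) $ i - (a *\<^sub>R G x + b *\<^sub>R Z x) $ i)) \<longlonglongrightarrow> 0" for i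
      using lim[of "\<lambda>j x. D j x $ i" "\<lambda>j x. D' j x $ i" "\<lambda>x. G x $ i" "\<lambda>x. Z x $ i"]
        C1c_L2(2)[OF 1(1)] C1c_L2(2)[OF 2(1)] H10_D(2)[OF y] H10_D(2)[OF z] 1 2 by simp
  qed
qed

lemma H10_add: "H10 \<Omega> y G \<Longrightarrow> H10 \<Omega> z Z \<Longrightarrow> H10 \<Omega> (\<lambda>x. y x + z x) (\<lambda>x. G x + Z x)"
  using H10_linear[of y G z Z 1 1] by simp

lemma H10_diff: "H10 \<Omega> y G \<Longrightarrow> H10 \<Omega> z Z \<Longrightarrow> H10 \<Omega> (\<lambda>x. y x - z x) (\<lambda>x. G x - Z x)"
  using H10_linear[of y G z Z 1 "-1"] by simp

lemma H10_scale: "H10 \<Omega> y G \<Longrightarrow> H10 \<Omega> (\<lambda>x. c * y x) (\<lambda>x. c *\<^sub>R G x)"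
  using H10_linear[of y G y G c 0] by simp

lemma H10_zero: "H10 \<Omega> (\<lambda>x. 0) (\<lambda>x. 0)"
proof (rule H10_I)
  show "C1c \<Omega> (\<lambda>x. 0) (\<lambda>x. 0)" for j :: nat
    unfolding C1c_def using GDERIV_const by (auto intro!: exI[of _ "{}"])
qed (auto simp: L2_zero L2_norm_def L2_inner_def)

lemma H10_poincare:
  assumes y: "H10 \<Omega> y G" and R: "\<And>x. x \<in> \<Omega> \<Longrightarrow> norm x \<le> R" "R \<ge> 0"
  shows "L2_norm \<Omega> y \<le> 2 * R * L2_norm \<Omega> (\<lambda>x. G x $ i)"
proof -
  obtain \<phi> D where 1: "\<And>j::nat. C1c \<Omega> (\<phi> j) (D j)" "(\<lambda>j. L2_dist \<Omega> (\<phi> j) y) \<longlonglongrightarrow> 0"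
      "\<And>i. (\<lambda>j. L2_norm \<Omega> (\<lambda>x. D j x $ i - G x $ i)) \<longlonglongrightarrow> 0" using y by (rule H10_E) blast
  have "(\<lambda>j. L2_norm \<Omega> (\<phi> j)) \<longlonglongrightarrow> L2_norm \<Omega> y"
    by (rule L2.nrm_tendsto[OF C1c_L2(1)[OF 1(1)] H10_D(1)[OF y] 1(2)])
  moreover have "(\<lambda>j. 2 * R * L2_norm \<Omega> (\<lambda>x. D j x $ i)) \<longlonglongrightarrow> 2 * R * L2_norm \<Omega> (\<lambda>x. G x $ i)"
    by (intro tendsto_mult tendsto_const L2.nrm_tendsto[OF C1c_L2(2)[OF 1(1)] H10_D(2)[OF y] 1(3)])
  ultimately show ?thesis
    using C1c_poincare[OF 1(1) R, of _ i] by (auto intro: LIMSEQ_le)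
qed

text \<open>Diagonal choice: each \<open>y n\<close> is replaced by a test function at distance less
  than \<open>1 / real (Suc n)\<close> in all components. This gives completeness of H10.\<close>

lemma H10_closed:
  assumes y: "\<And>n::nat. H10 \<Omega> (y n) (G n)"
    and L: "l \<in> L2 \<Omega>" "\<And>i. (\<lambda>x. Z x $ i) \<in> L2 \<Omega>"
    and lim: "(\<lambda>n. L2_dist \<Omega> (y n) l) \<longlonglongrightarrow> 0"
      "\<And>i. (\<lambda>n. L2_norm \<Omega> (\<lambda>x. G n x $ i - Z x $ i)) \<longlonglongrightarrow> 0"
  shows "H10 \<Omega> l Z"
proof -
  have "\<forall>n. \<exists>p. C1c \<Omega> (fst p) (snd p) \<and> L2_dist \<Omega> (fst p) (y n) < 1 / real (Suc n) \<and>
      (\<forall>i. L2_norm \<Omega> (\<lambda>x. snd p x $ i - G n x $ i) < 1 / real (Suc n))"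
  proof
    fix n
    obtain \<phi> D where 1: "\<And>j::nat. C1c \<Omega> (\<phi> j) (D j)" "(\<lambda>j. L2_dist \<Omega> (\<phi> j) (y n)) \<longlonglongrightarrow> 0"
      "\<And>i. (\<lambda>j. L2_norm \<Omega> (\<lambda>x. D j x $ i - G n x $ i)) \<longlonglongrightarrow> 0" using y[of n] by (rule H10_E) blast
    have "\<forall>\<^sub>F j in sequentially. L2_dist \<Omega> (\<phi> j) (y n) < 1 / real (Suc n) \<and>
        (\<forall>i. L2_norm \<Omega> (\<lambda>x. D j x $ i - G n x $ i) < 1 / real (Suc n))"
      by (intro eventually_conj eventually_all_finite order_tendstoD(2)[OF 1(2)] order_tendstoD(2)[OF 1(3)]) auto
    then obtain j where "L2_dist \<Omega> (\<phi> j) (y n) < 1 / real (Suc n) \<and>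
        (\<forall>i. L2_norm \<Omega> (\<lambda>x. D j x $ i - G n x $ i) < 1 / real (Suc n))"
      using eventually_happens'[OF sequentially_bot] by fast
    then show "\<exists>p. C1c \<Omega> (fst p) (snd p) \<and> L2_dist \<Omega> (fst p) (y n) < 1 / real (Suc n) \<and>
      (\<forall>i. L2_norm \<Omega> (\<lambda>x. snd p x $ i - G n x $ i) < 1 / real (Suc n))"
      using 1(1) by (intro exI[of _ "(\<phi> j, D j)"]) simp
  qed
  from choice[OF this] obtain p where p: "\<forall>n. C1c \<Omega> (fst (p n)) (snd (p n)) \<and>
      L2_norm \<Omega> (\<lambda>x. fst (p n) x - y n x) < 1 / real (Suc n) \<and>
      (\<forall>i. L2_norm \<Omega> (\<lambda>x. snd (p n) x $ i - G n x $ i) < 1 / real (Suc n))" ..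
  define \<phi> D where "\<phi> n = fst (p n)" and "D n = snd (p n)" for n
  have 1: "\<And>n. C1c \<Omega> (\<phi> n) (D n)" "\<And>n. L2_dist \<Omega> (\<phi> n) (y n) < 1 / real (Suc n)"
      "\<And>n i. L2_norm \<Omega> (\<lambda>x. D n x $ i - G n x $ i) < 1 / real (Suc n)"
    using p by (simp_all add: \<phi>_def D_def)
  have lim': "(\<lambda>n. L2_dist \<Omega> (u n) w) \<longlonglongrightarrow> 0"
    if L: "\<And>n. u n \<in> L2 \<Omega>" "\<And>n. v n \<in> L2 \<Omega>" "w \<in> L2 \<Omega>"
      and l: "\<And>n. L2_dist \<Omega> (u n) (v n) < 1 / real (Suc n)" "(\<lambda>n. L2_dist \<Omega> (v n) w) \<longlonglongrightarrow> 0"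
    for u v :: "nat \<Rightarrow> real^'n \<Rightarrow> real" and w
  proof (rule tendsto_sandwich[of "\<lambda>_. 0" _ _ "\<lambda>n. 1 / real (Suc n) + L2_dist \<Omega> (v n) w"])
    show "\<forall>\<^sub>F n in sequentially. L2_dist \<Omega> (u n) w \<le> 1 / real (Suc n) + L2_dist \<Omega> (v n) w"
    proof (intro always_eventually allI)
      fix n show "L2_dist \<Omega> (u n) w \<le> 1 / real (Suc n) + L2_dist \<Omega> (v n) w"
        using L2.nrm_sub_triangle[OF L(1) L(2) L(3), of n n] l(1)[of n] by linarith
    qed
    show "\<forall>\<^sub>F n in sequentially. 0 \<le> L2_dist \<Omega> (u n) w"
      using L by (intro always_eventually allI L2.nrm_nonneg L2_diff)
    show "(\<lambda>n. 1 / real (Suc n) + L2_dist \<Omega> (v n) w) \<longlonglongrightarrow> 0"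
      using tendsto_add[OF LIMSEQ_Suc[OF lim_1_over_n] l(2)] by simp
  qed auto
  show ?thesis
  proof (rule H10_I[OF L 1(1)])
    show "(\<lambda>j. L2_dist \<Omega> (\<phi> j) l) \<longlonglongrightarrow> 0"
      by (rule lim'[OF C1c_L2(1)[OF 1(1)] H10_D(1)[OF y] L(1) 1(2) lim(1)])
    show "(\<lambda>j. L2_norm \<Omega> (\<lambda>x. D j x $ i - Z x $ i)) \<longlonglongrightarrow> 0" for i
      by (rule lim'[OF C1c_L2(2)[OF 1(1)] H10_D(2)[OF y] L(2) 1(3) lim(2)])
  qed
qed

text \<open>Chain rule for a function with bounded, Lipschitz derivative, by approximation. The
  values converge since \<open>g\<close> is Lipschitz; the gradients need the splitting into
  \<open>g' (\<phi> j x)\<close> times the error of \<open>D j\<close>, and an error of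
  \<open>g'\<close> times the fixed function \<open>G\<close>.\<close>

lemma H10_compose:
  assumes d: "H10 \<Omega> d G"
    and g: "\<And>t. (g has_field_derivative g' t) (at t)" "g 0 = 0" "\<And>t. \<bar>g' t\<bar> \<le> 1" "\<And>s t. \<bar>g' s - g' t\<bar> \<le> C * \<bar>s - t\<bar>"
  shows "H10 \<Omega> (\<lambda>x. g (d x)) (\<lambda>x. g' (d x) *\<^sub>R G x)"
proof -
  obtain \<phi> D where 1: "\<And>j::nat. C1c \<Omega> (\<phi> j) (D j)" "(\<lambda>j. L2_dist \<Omega> (\<phi> j) d) \<longlonglongrightarrow> 0"
      "\<And>i. (\<lambda>j. L2_norm \<Omega> (\<lambda>x. D j x $ i - G x $ i)) \<longlonglongrightarrow> 0" using d by (rule H10_E) blast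
  have lip: "\<bar>g s - g t\<bar> \<le> 1 * \<bar>s - t\<bar>" for s t
  proof -
    have "norm (g s - g t) \<le> 1 * norm (s - t)"
      by (rule field_differentiable_bound[of UNIV g g']) (use g(1,3) in auto)
    then show ?thesis by simp
  qed
  have C0: "C \<ge> 0" using order_trans[OF abs_ge_zero g(4)[of 1 0]] by simp
  have cg': "continuous_on UNIV g'"
    by (rule lipschitz_on_continuous_on[of C]) (simp add: lipschitz_on_def dist_real_def C0 g(4))
  have cg: "continuous_on UNIV g" using g(1) by (meson DERIV_isCont continuous_at_imp_continuous_on)
  have [measurable]: "g \<in> borel_measurable borel" "g' \<in> borel_measurable borel"
    using cg cg' borel_measurable_continuous_onI by blast+
  note [measurable] = H10_D(1)[OF d] H10_D(2)[OF d] C1c_L2(1)[OF 1(1)] C1c_L2(2)[OF 1(1)]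
  have gd: "(\<lambda>x. g (d x)) \<in> L2 \<Omega>"
    by (rule L2_dominated[OF _ H10_D(1)[OF d]]) (use lip[of _ 0] g(2) in auto)
  have gG: "(\<lambda>x. (g' (d x) *\<^sub>R G x) $ i) \<in> L2 \<Omega>" for i
    using L2_mult_bounded(1)[of "\<lambda>x. g' (d x)" \<Omega> "\<lambda>x. G x $ i" 1] H10_D(2)[OF d] g(3) by simp
  have C: "C1c \<Omega> (\<lambda>x. g (\<phi> j x)) (\<lambda>x. g' (\<phi> j x) *\<^sub>R D j x)" for j
    by (rule C1c_compose[OF 1(1) g(1) cg' g(2)])
  have diff0: "(\<lambda>x. \<phi> j x - d x) \<in> L2 \<Omega>" for j
    by (rule L2_diff[OF C1c_L2(1)[OF 1(1)] H10_D(1)[OF d]])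
  show ?thesis
  proof (rule H10_I[where \<phi> = "\<lambda>j x. g (\<phi> j x)" and D = "\<lambda>j x. g' (\<phi> j x) *\<^sub>R D j x"])
    show "(\<lambda>x. g (d x)) \<in> L2 \<Omega>" by (rule gd)
    show "(\<lambda>x. (g' (d x) *\<^sub>R G x) $ i) \<in> L2 \<Omega>" for i by (rule gG)
    show "C1c \<Omega> (\<lambda>x. g (\<phi> j x)) (\<lambda>x. g' (\<phi> j x) *\<^sub>R D j x)" for j by (rule C)
    show "(\<lambda>j. L2_norm \<Omega> (\<lambda>x. g (\<phi> j x) - g (d x))) \<longlonglongrightarrow> 0"
    proof (rule tendsto_sandwich[of "\<lambda>_. 0" _ _ "\<lambda>j. L2_dist \<Omega> (\<phi> j) d"])
      show "\<forall>\<^sub>F n in sequentially. L2_norm \<Omega> (\<lambda>x. g (\<phi> n x) - g (d x)) \<le> L2_dist \<Omega> (\<phi> n) d"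
      proof (rule always_eventually, rule allI, rule L2_norm_mono[OF L2_diff[OF C1c_L2(1)[OF C] gd] diff0])
        fix n show "AE x in lebesgue_on \<Omega>. \<bar>g (\<phi> n x) - g (d x)\<bar> \<le> \<bar>\<phi> n x - d x\<bar>"
          using lip by (intro AE_I2) simp
      qed
      show "\<forall>\<^sub>F n in sequentially. 0 \<le> L2_norm \<Omega> (\<lambda>x. g (\<phi> n x) - g (d x))"
        by (rule always_eventually, rule allI, rule L2.nrm_nonneg[OF L2_diff[OF C1c_L2(1)[OF C] gd]])
    qed (use 1(2) in auto)
    fix i
    have diff: "(\<lambda>x. D j x $ i - G x $ i) \<in> L2 \<Omega>" for j
      by (rule L2_diff[OF C1c_L2(2)[OF 1(1)] H10_D(2)[OF d]])
    have gm: "(\<lambda>x. g' (\<phi> j x)) \<in> borel_measurable (lebesgue_on \<Omega>)" for j by measurable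
    note A = L2_mult_bounded[OF gm diff AE_I2[of _ "\<lambda>x. \<bar>g' (\<phi> j x)\<bar> \<le> 1" for j], OF g(3)]
    \<comment> \<open>This difference is bounded by 2 and tends to zero in L2, while its cofactor
      \<open>G\<close> is merely square integrable; hence
      \<open>L2_norm_mult_tendsto_0\<close>.\<close>
    define b where "b j x = g' (\<phi> j x) - g' (d x)" for j x
    have bL: "b j \<in> L2 \<Omega>" for j
    proof (rule L2_dominated[OF _ L2_scale[OF diff0, of C j]])
      show "b j \<in> borel_measurable (lebesgue_on \<Omega>)" unfolding b_def[abs_def] by measurable
    qed (simp add: b_def abs_mult C0 g(4))
    have b2: "\<bar>b j x\<bar> \<le> 2" for j x using g(3)[of "\<phi> j x"] g(3)[of "d x"] by (simp add: b_def)
    have blim: "(\<lambda>j. L2_norm \<Omega> (b j)) \<longlonglongrightarrow> 0"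
    proof (rule tendsto_sandwich[of "\<lambda>_. 0" _ _ "\<lambda>j. C * L2_dist \<Omega> (\<phi> j) d"])
      have "L2_norm \<Omega> (b n) \<le> L2_norm \<Omega> (\<lambda>x. C * (\<phi> n x - d x))" for n
        by (rule L2_norm_mono[OF bL L2_scale[OF diff0]]) (simp add: b_def abs_mult C0 g(4))
      then show "\<forall>\<^sub>F n in sequentially. L2_norm \<Omega> (b n) \<le> C * L2_dist \<Omega> (\<phi> n) d"
        using C0 by (simp add: L2.nrm_sc[OF diff0])
      show "(\<lambda>j. C * L2_dist \<Omega> (\<phi> j) d) \<longlonglongrightarrow> 0" by (rule tendsto_mult_right_zero[OF 1(2)])
    qed (auto simp: L2.nrm_nonneg bL)
    have B: "(\<lambda>j. L2_norm \<Omega> (\<lambda>x. b j x * (G x $ i))) \<longlonglongrightarrow> 0"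
      by (rule L2_norm_mult_tendsto_0[OF bL b2 blim H10_D(2)[OF d]])
    have BL: "(\<lambda>x. b j x * (G x $ i)) \<in> L2 \<Omega>" for j
      by (rule L2_mult_bounded(1)[OF L2_measurable[OF bL] H10_D(2)[OF d], of _ 2]) (simp add: b2)
    show "(\<lambda>j. L2_norm \<Omega> (\<lambda>x. (g' (\<phi> j x) *\<^sub>R D j x) $ i - (g' (d x) *\<^sub>R G x) $ i)) \<longlonglongrightarrow> 0"
    proof (rule tendsto_sandwich[of "\<lambda>_. 0" _ _ "\<lambda>j. L2_norm \<Omega> (\<lambda>x. D j x $ i - G x $ i) + L2_norm \<Omega> (\<lambda>x. b j x * (G x $ i))"])
      have "(\<lambda>x. (g' (\<phi> j x) *\<^sub>R D j x) $ i - (g' (d x) *\<^sub>R G x) $ i)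
          = (\<lambda>x. g' (\<phi> j x) * (D j x $ i - G x $ i) + b j x * (G x $ i))" for j
        by (simp add: b_def algebra_simps)
      then show "\<forall>\<^sub>F j in sequentially. L2_norm \<Omega> (\<lambda>x. (g' (\<phi> j x) *\<^sub>R D j x) $ i - (g' (d x) *\<^sub>R G x) $ i)
          \<le> L2_norm \<Omega> (\<lambda>x. D j x $ i - G x $ i) + L2_norm \<Omega> (\<lambda>x. b j x * (G x $ i))"
        using order_trans[OF L2.nrm_add_le[OF A(1) BL] add_mono[OF A(2) order_refl]] by simp
      show "\<forall>\<^sub>F j in sequentially. 0 \<le> L2_norm \<Omega> (\<lambda>x. (g' (\<phi> j x) *\<^sub>R D j x) $ i - (g' (d x) *\<^sub>R G x) $ i)"
        by (rule always_eventually, rule allI, rule L2.nrm_nonneg[OF L2_diff[OF C1c_L2(2)[OF C] gG]])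
      show "(\<lambda>j. L2_norm \<Omega> (\<lambda>x. D j x $ i - G x $ i) + L2_norm \<Omega> (\<lambda>x. b j x * (G x $ i))) \<longlonglongrightarrow> 0"
        using tendsto_add[OF 1(3)[of i] B] by simp
    qed auto
  qed
qed

end

section \<open>Elliptic forms and the weak maximum principle\<close>

context bounded_open
begin

text \<open>Points of the space are pairs of a function and a weak gradient. The gradient is
  determined only almost everywhere, so it is carried as data instead of being computed from the
  first component.\<close>

definition h1_inner :: "(real^'n \<Rightarrow> real) \<times> (real^'n \<Rightarrow> real^'n) \<Rightarrow> (real^'n \<Rightarrow> real) \<times> (real^'n \<Rightarrow> real^'n) \<Rightarrow> real" where
  "h1_inner u v = L2_inner \<Omega> (fst u) (fst v) + (\<Sum>i\<in>UNIV. L2_inner \<Omega> (\<lambda>x. snd u x $ i) (\<lambda>x. snd v x $ i))"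

definition h1_norm :: "(real^'n \<Rightarrow> real) \<times> (real^'n \<Rightarrow> real^'n) \<Rightarrow> real" where
  "h1_norm u = sqrt (h1_inner u u)"

lemma h1_norm_sq:
  assumes "H10 \<Omega> (fst u) (snd u)"
  shows "(h1_norm u)\<^sup>2 = (L2_norm \<Omega> (fst u))\<^sup>2 + (\<Sum>i\<in>UNIV. (L2_norm \<Omega> (\<lambda>x. snd u x $ i))\<^sup>2)"
proof -
  have "h1_inner u u = (L2_norm \<Omega> (fst u))\<^sup>2 + (\<Sum>i\<in>UNIV. (L2_norm \<Omega> (\<lambda>x. snd u x $ i))\<^sup>2)"
    using H10_D[OF assms] by (simp add: h1_inner_def L2.nrm_sq)
  moreover have "0 \<le> (L2_norm \<Omega> (fst u))\<^sup>2 + (\<Sum>i\<in>UNIV. (L2_norm \<Omega> (\<lambda>x. snd u x $ i))\<^sup>2)"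
    by (intro add_nonneg_nonneg sum_nonneg) auto
  ultimately show ?thesis by (simp add: h1_norm_def)
qed

lemma L2_norm_le_h1_norm:
  assumes "H10 \<Omega> (fst u) (snd u)"
  shows "L2_norm \<Omega> (fst u) \<le> h1_norm u" "L2_norm \<Omega> (\<lambda>x. snd u x $ i) \<le> h1_norm u"
proof -
  have n: "0 \<le> (\<Sum>i\<in>UNIV. (L2_norm \<Omega> (\<lambda>x. snd u x $ i))\<^sup>2)" by (intro sum_nonneg) auto
  have m: "(L2_norm \<Omega> (\<lambda>x. snd u x $ i))\<^sup>2 \<le> (\<Sum>i\<in>UNIV. (L2_norm \<Omega> (\<lambda>x. snd u x $ i))\<^sup>2)"
    by (rule member_le_sum) auto
  have "0 \<le> h1_inner u u" unfolding h1_inner_def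
    using H10_D[OF assms] by (intro add_nonneg_nonneg sum_nonneg L2.ip_nonneg)
  then have p: "0 \<le> h1_norm u" unfolding h1_norm_def by simp
  show "L2_norm \<Omega> (fst u) \<le> h1_norm u"
    by (rule power2_le_imp_le[OF _ p]) (use h1_norm_sq[OF assms] n in simp)
  show "L2_norm \<Omega> (\<lambda>x. snd u x $ i) \<le> h1_norm u"
    by (rule power2_le_imp_le[OF _ p]) (use h1_norm_sq[OF assms] m in \<open>simp add: add_increasing\<close>)
qed

text \<open>Completeness is that of L2 in each component; the limits assemble to a pair in the space
  by \<open>H10_closed\<close>.\<close>

sublocale H10: semi_hilbert "{u. H10 \<Omega> (fst u) (snd u)}"
  "\<lambda>u v. (\<lambda>x. fst u x + fst v x, \<lambda>x. snd u x + snd v x)"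
  "\<lambda>u v. (\<lambda>x. fst u x - fst v x, \<lambda>x. snd u x - snd v x)"
  "\<lambda>c u. (\<lambda>x. c * fst u x, \<lambda>x. c *\<^sub>R snd u x)" h1_inner h1_norm
proof
  show "{u. H10 \<Omega> (fst u) (snd u)} \<noteq> {}"
    using H10_zero by (auto intro!: exI[of _ "\<lambda>x. 0"])
next
  fix u v w :: "(real^'n \<Rightarrow> real) \<times> (real^'n \<Rightarrow> real^'n)"
  assume H: "u \<in> {u. H10 \<Omega> (fst u) (snd u)}" "v \<in> {u. H10 \<Omega> (fst u) (snd u)}" "w \<in> {u. H10 \<Omega> (fst u) (snd u)}"
  then have L: "fst u \<in> L2 \<Omega>" "fst v \<in> L2 \<Omega>" "fst w \<in> L2 \<Omega>"
    "\<And>i. (\<lambda>x. snd u x $ i) \<in> L2 \<Omega>" "\<And>i. (\<lambda>x. snd v x $ i) \<in> L2 \<Omega>" "\<And>i. (\<lambda>x. snd w x $ i) \<in> L2 \<Omega>"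
    using H10_D by blast+
  show "h1_inner (\<lambda>x. fst u x + fst v x, \<lambda>x. snd u x + snd v x) w = h1_inner u w + h1_inner v w"
    using L by (simp add: h1_inner_def L2.ip_rules sum.distrib)
  show "h1_inner (\<lambda>x. fst u x - fst v x, \<lambda>x. snd u x - snd v x) w = h1_inner u w - h1_inner v w"
    using L by (simp add: h1_inner_def L2.ip_rules sum_subtractf)
next
  fix u w :: "(real^'n \<Rightarrow> real) \<times> (real^'n \<Rightarrow> real^'n)" and c :: real
  assume H: "u \<in> {u. H10 \<Omega> (fst u) (snd u)}" "w \<in> {u. H10 \<Omega> (fst u) (snd u)}"
  then have L: "fst u \<in> L2 \<Omega>" "fst w \<in> L2 \<Omega>"
    "\<And>i. (\<lambda>x. snd u x $ i) \<in> L2 \<Omega>" "\<And>i. (\<lambda>x. snd w x $ i) \<in> L2 \<Omega>"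
    using H10_D by blast+
  show "h1_inner (\<lambda>x. c * fst u x, \<lambda>x. c *\<^sub>R snd u x) w = c * h1_inner u w"
    using L by (simp add: h1_inner_def L2.ip_rules distrib_left sum_distrib_left)
next
  fix u v :: "(real^'n \<Rightarrow> real) \<times> (real^'n \<Rightarrow> real^'n)"
  show "h1_inner u v = h1_inner v u" by (simp add: h1_inner_def L2_inner_def mult.commute)
  assume "u \<in> {u. H10 \<Omega> (fst u) (snd u)}"
  then show "0 \<le> h1_inner u u"
    using H10_D[of "fst u" "snd u"] by (simp add: h1_inner_def L2.ip_nonneg sum_nonneg add_nonneg_nonneg)
next
  fix x :: "nat \<Rightarrow> (real^'n \<Rightarrow> real) \<times> (real^'n \<Rightarrow> real^'n)"
  assume x: "\<And>n. x n \<in> {u. H10 \<Omega> (fst u) (snd u)}"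
    and cauchy: "\<And>e. e > 0 \<Longrightarrow> \<exists>N. \<forall>m\<ge>N. \<forall>n\<ge>N.
      h1_norm (\<lambda>t. fst (x m) t - fst (x n) t, \<lambda>t. snd (x m) t - snd (x n) t) < e"
  have xH: "H10 \<Omega> (fst (x n)) (snd (x n))" for n using x[of n] by simp
  note L = H10_D(1)[OF xH] H10_D(2)[OF xH]
  have d: "H10 \<Omega> (\<lambda>t. fst (x m) t - fst (x n) t) (\<lambda>t. snd (x m) t - snd (x n) t)" for m n
    by (rule H10_diff[OF xH xH])
  note le = L2_norm_le_h1_norm[of "(\<lambda>t. fst (x m) t - fst (x n) t, \<lambda>t. snd (x m) t - snd (x n) t)" for m n, simplified, OF d]
  have "\<exists>l\<in>L2 \<Omega>. (\<lambda>n. L2_norm \<Omega> (\<lambda>t. fst (x n) t - l t)) \<longlonglongrightarrow> 0"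
  proof (rule L2_complete[OF L(1)])
    fix e :: real assume "e > 0"
    from cauchy[OF this] obtain N where "\<forall>m\<ge>N. \<forall>n\<ge>N.
      h1_norm (\<lambda>t. fst (x m) t - fst (x n) t, \<lambda>t. snd (x m) t - snd (x n) t) < e" ..
    then show "\<exists>N. \<forall>m\<ge>N. \<forall>n\<ge>N. L2_norm \<Omega> (\<lambda>t. fst (x m) t - fst (x n) t) < e"
      using le_less_trans[OF le(1)] by blast
  qed
  then obtain l where l: "l \<in> L2 \<Omega>" "(\<lambda>n. L2_norm \<Omega> (\<lambda>t. fst (x n) t - l t)) \<longlonglongrightarrow> 0" by blast
  have "\<forall>i. \<exists>Z. Z \<in> L2 \<Omega> \<and> (\<lambda>n. L2_norm \<Omega> (\<lambda>t. snd (x n) t $ i - Z t)) \<longlonglongrightarrow> 0"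
  proof
    fix i
    have "\<exists>l\<in>L2 \<Omega>. (\<lambda>n. L2_norm \<Omega> (\<lambda>t. snd (x n) t $ i - l t)) \<longlonglongrightarrow> 0"
    proof (rule L2_complete[OF L(2)])
      fix e :: real assume "e > 0"
      from cauchy[OF this] obtain N where "\<forall>m\<ge>N. \<forall>n\<ge>N.
        h1_norm (\<lambda>t. fst (x m) t - fst (x n) t, \<lambda>t. snd (x m) t - snd (x n) t) < e" ..
      then show "\<exists>N. \<forall>m\<ge>N. \<forall>n\<ge>N. L2_norm \<Omega> (\<lambda>t. snd (x m) t $ i - snd (x n) t $ i) < e"
        using le_less_trans[OF le(2)] by blast
    qed
    then show "\<exists>Z. Z \<in> L2 \<Omega> \<and> (\<lambda>n. L2_norm \<Omega> (\<lambda>t. snd (x n) t $ i - Z t)) \<longlonglongrightarrow> 0" by blast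
  qed
  from choice[OF this] obtain Z where Z: "\<And>i. Z i \<in> L2 \<Omega>"
    "\<And>i. (\<lambda>n. L2_norm \<Omega> (\<lambda>t. snd (x n) t $ i - Z i t)) \<longlonglongrightarrow> 0" by blast
  define G where "G t = (\<chi> i. Z i t)" for t
  have H: "H10 \<Omega> l G"
    by (rule H10_closed[OF xH l(1) _ l(2)]) (use Z in \<open>simp_all add: G_def\<close>)
  have "(\<lambda>n. (h1_norm (\<lambda>t. fst (x n) t - l t, \<lambda>t. snd (x n) t - G t))\<^sup>2) \<longlonglongrightarrow> 0\<^sup>2 + (\<Sum>i\<in>(UNIV::'n set). 0\<^sup>2)"
    using h1_norm_sq[of "(\<lambda>t. fst (x n) t - l t, \<lambda>t. snd (x n) t - G t)" for n, simplified, OF H10_diff[OF xH H]]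
    by (simp only: G_def vec_lambda_beta) (intro tendsto_intros l Z)
  then have "(\<lambda>n. sqrt ((h1_norm (\<lambda>t. fst (x n) t - l t, \<lambda>t. snd (x n) t - G t))\<^sup>2)) \<longlonglongrightarrow> 0"
    using tendsto_real_sqrt by fastforce
  then have "(\<lambda>n. h1_norm (\<lambda>t. fst (x n) t - l t, \<lambda>t. snd (x n) t - G t)) \<longlonglongrightarrow> 0"
    by (simp add: tendsto_rabs_zero_iff)
  then show "\<exists>l\<in>{u. H10 \<Omega> (fst u) (snd u)}.
      (\<lambda>n. h1_norm (\<lambda>t. fst (x n) t - fst l t, \<lambda>t. snd (x n) t - snd l t)) \<longlonglongrightarrow> 0"
    using H by (intro bexI[of _ "(l, G)"]) auto
qed (auto simp: H10_add H10_diff H10_scale h1_norm_def)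

end

section \<open>A smooth truncation\<close>

text \<open>A continuously differentiable stand-in for the positive part: zero for t \<le> 0,
  quadratic near 0, and equal to t - 1 + 1 / (1 + t) for t \<ge> 0. Its derivative lies in [0, 1]
  and is Lipschitz, exactly what \<open>H10_compose\<close> asks for.\<close>

definition cutoff :: "real \<Rightarrow> real" where
  "cutoff t = (max t 0)\<^sup>2 / (1 + max t 0)"

definition cutoff' :: "real \<Rightarrow> real" where
  "cutoff' t = 1 - 1 / (1 + max t 0)\<^sup>2"

lemma cutoff_simps: "cutoff 0 = 0" "0 \<le> cutoff t" "cutoff t = 0 \<longleftrightarrow> t \<le> 0" "t \<le> 0 \<Longrightarrow> cutoff t = 0"
  by (auto simp: cutoff_def max_def add_nonneg_eq_0_iff)

lemma cutoff'_bounds: "0 \<le> cutoff' t" "cutoff' t \<le> 1" "\<bar>cutoff' t\<bar> \<le> 1"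
proof -
  have "1 \<le> (1 + max t 0)\<^sup>2" by (rule one_le_power) simp
  then show "0 \<le> cutoff' t" "cutoff' t \<le> 1" by (auto simp: cutoff'_def divide_le_eq)
  then show "\<bar>cutoff' t\<bar> \<le> 1" by simp
qed

lemma cutoff'_lipschitz: "\<bar>cutoff' s - cutoff' t\<bar> \<le> 2 * \<bar>s - t\<bar>"
proof -
  define a b where "a = max s 0" and "b = max t 0"
  \<comment> \<open>In these variables, which lie in [0, 1], the difference of the derivatives
    factors as \<open>(v - u) * (u + v)\<close>.\<close>
  define u v where "u = 1 / (1 + a)" and "v = 1 / (1 + b)"
  have ab: "a \<ge> 0" "b \<ge> 0" "\<bar>a - b\<bar> \<le> \<bar>s - t\<bar>" by (auto simp: a_def b_def)
  have uv: "0 \<le> u" "u \<le> 1" "0 \<le> v" "v \<le> 1" using ab by (auto simp: u_def v_def)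
  have "u - v = (b - a) * (u * v)" using ab by (simp add: u_def v_def field_simps)
  then have "\<bar>u - v\<bar> = \<bar>a - b\<bar> * (u * v)" using uv by (simp add: abs_mult abs_minus_commute)
  also have "\<dots> \<le> \<bar>a - b\<bar> * 1" using uv by (intro mult_left_mono mult_le_one) auto
  finally have 1: "\<bar>u - v\<bar> \<le> \<bar>a - b\<bar>" by simp
  have "cutoff' s - cutoff' t = (v - u) * (u + v)"
    by (simp add: cutoff'_def u_def v_def a_def b_def power2_eq_square algebra_simps)
  then have "\<bar>cutoff' s - cutoff' t\<bar> = \<bar>u - v\<bar> * (u + v)" using uv by (simp add: abs_mult abs_minus_commute)
  also have "\<dots> \<le> \<bar>s - t\<bar> * 2" using 1 ab uv by (intro mult_mono) auto
  finally show ?thesis by simp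
qed

lemma cutoff_deriv: "(cutoff has_field_derivative cutoff' t) (at t)"
proof -
  consider "t < 0" | "t = 0" | "t > 0" by linarith
  then show ?thesis
  proof cases
    case 1
    have "((\<lambda>t::real. 0) has_field_derivative 0) (at t)" by simp
    then have "(cutoff has_field_derivative 0) (at t)"
      by (rule has_field_derivative_transform_within_open[of _ _ _ "{..<0}"]) (use 1 in \<open>auto simp: cutoff_def\<close>)
    then show ?thesis using 1 by (simp add: cutoff'_def)
  next
    case 2
    have "((\<lambda>h. (cutoff (0 + h) - cutoff 0) / h) \<longlongrightarrow> 0) (at 0)"
    proof (rule Lim_null_comparison)
      have "norm ((cutoff (0 + h) - cutoff 0) / h) \<le> \<bar>h\<bar>" for h :: real
      proof -
        \<comment> \<open>The quadratic bound on both sides of 0 forces the difference quotient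
          there to vanish.\<close>
        have "cutoff h \<le> h\<^sup>2"
        proof (cases "h \<ge> 0")
          case True
          have "h\<^sup>2 / (1 + h) \<le> h\<^sup>2 / 1" using True by (intro divide_left_mono) auto
          then show ?thesis using True by (simp add: cutoff_def)
        qed (simp add: cutoff_def)
        then have "\<bar>cutoff h\<bar> \<le> \<bar>h\<bar> * \<bar>h\<bar>" using cutoff_simps(2)[of h] by (simp add: power2_eq_square)
        then show ?thesis by (cases "h = 0") (simp_all add: cutoff_simps divide_le_eq)
      qed
      then show "\<forall>\<^sub>F h in at 0. norm ((cutoff (0 + h) - cutoff 0) / h) \<le> \<bar>h\<bar>" by simp
      show "((\<lambda>h::real. \<bar>h\<bar>) \<longlongrightarrow> 0) (at 0)" using tendsto_rabs[OF tendsto_ident_at, of 0 UNIV] by simp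
    qed
    then show ?thesis using 2 by (simp add: DERIV_def cutoff'_def)
  next
    case 3
    have "((\<lambda>t. t\<^sup>2 / (1 + t)) has_field_derivative (2 * t * (1 + t) - t\<^sup>2) / (1 + t)\<^sup>2) (at t)"
      using 3 by (auto intro!: derivative_eq_intros simp: power2_eq_square)
    then have "(cutoff has_field_derivative (2 * t * (1 + t) - t\<^sup>2) / (1 + t)\<^sup>2) (at t)"
      by (rule has_field_derivative_transform_within_open[of _ _ _ "{0<..}"]) (use 3 in \<open>auto simp: cutoff_def\<close>)
    moreover have "(2 * t * (1 + t) - t\<^sup>2) / (1 + t)\<^sup>2 = cutoff' t"
    proof -
      have "2 * t * (1 + t) - t\<^sup>2 = (1 + t)\<^sup>2 - 1" by (simp add: power2_eq_square algebra_simps)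
      moreover have "(1 + t)\<^sup>2 \<noteq> 0" using 3 by simp
      ultimately show ?thesis using 3 by (simp add: cutoff'_def diff_divide_distrib)
    qed
    ultimately show ?thesis by simp
  qed
qed

section \<open>The bilinear form of the operator\<close>

locale elliptic_form = bounded_open \<Omega> for \<Omega> :: "(real^'n::finite) set" +
  fixes a :: "'n \<Rightarrow> 'n \<Rightarrow> real^'n \<Rightarrow> real"
  assumes coeff: "\<And>i j. a i j \<in> Linf \<Omega>" and elliptic: "elliptic \<Omega> a"
begin

text \<open>The coefficient matrix is not assumed symmetric, so the order of arguments matters:
  states enter on the left, adjoint states on the right.\<close>

definition bil :: "(real^'n \<Rightarrow> real^'n) \<Rightarrow> (real^'n \<Rightarrow> real^'n) \<Rightarrow> real" where
  "bil G Z = (LINT x|lebesgue_on \<Omega>. (\<Sum>i\<in>UNIV. \<Sum>j\<in>UNIV. a i j x * G x $ i * Z x $ j))"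

abbreviation vL2 :: "(real^'n \<Rightarrow> real^'n) \<Rightarrow> bool" where
  "vL2 G \<equiv> (\<forall>i. (\<lambda>x. G x $ i) \<in> L2 \<Omega>)"

lemma coeff_L2: "vL2 G \<Longrightarrow> (\<lambda>x. a i j x * G x $ i) \<in> L2 \<Omega>"
  by (rule L2_mult_Linf[OF coeff]) simp

lemma bil_eq:
  assumes "vL2 G" "vL2 Z"
  shows "bil G Z = (\<Sum>i\<in>UNIV. \<Sum>j\<in>UNIV. L2_inner \<Omega> (\<lambda>x. a i j x * G x $ i) (\<lambda>x. Z x $ j))"
proof -
  have int: "integrable (lebesgue_on \<Omega>) (\<lambda>x. a i j x * G x $ i * Z x $ j)" for i j
    by (rule L2_integrable_mult[OF coeff_L2[OF assms(1)]]) (use assms(2) in simp)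
  show ?thesis
    unfolding bil_def L2_inner_def by (simp add: int)
qed

lemma bil_integrable:
  assumes "vL2 G" "vL2 Z"
  shows "integrable (lebesgue_on \<Omega>) (\<lambda>x. \<Sum>i\<in>UNIV. \<Sum>j\<in>UNIV. a i j x * G x $ i * Z x $ j)"
  by (intro Bochner_Integration.integrable_sum L2_integrable_mult[OF coeff_L2[OF assms(1)]])
    (use assms(2) in simp)

lemma bil_linear_left:
  assumes "vL2 G" "vL2 G'" "vL2 Z"
  shows "bil (\<lambda>x. s *\<^sub>R G x + t *\<^sub>R G' x) Z = s * bil G Z + t * bil G' Z"
proof -
  have *: "(\<lambda>x. a i j x * (s * G x $ i + t * G' x $ i)) = (\<lambda>x. s * (a i j x * G x $ i) + t * (a i j x * G' x $ i))" for i j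
    by (simp add: algebra_simps)
  have v: "vL2 (\<lambda>x. s *\<^sub>R G x + t *\<^sub>R G' x)" using assms by (auto intro!: L2_add L2_scale)
  show ?thesis
    unfolding bil_eq[OF v assms(3)] bil_eq[OF assms(1,3)] bil_eq[OF assms(2,3)]
    by (simp add: * L2.ip_rules coeff_L2[OF assms(1)] coeff_L2[OF assms(2)] L2_scale assms(3)[rule_format]
        sum.distrib sum_distrib_left)
qed

lemma bil_linear_right:
  assumes "vL2 G" "vL2 Z" "vL2 Z'"
  shows "bil G (\<lambda>x. s *\<^sub>R Z x + t *\<^sub>R Z' x) = s * bil G Z + t * bil G Z'"
proof -
  have v: "vL2 (\<lambda>x. s *\<^sub>R Z x + t *\<^sub>R Z' x)" using assms by (auto intro!: L2_add L2_scale)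
  show ?thesis
    unfolding bil_eq[OF assms(1) v] bil_eq[OF assms(1,2)] bil_eq[OF assms(1,3)]
    by (simp add: L2.ip_rules coeff_L2[OF assms(1)] L2_scale assms(2,3)[rule_format]
        sum.distrib sum_distrib_left)
qed

lemma bil_bounded:
  obtains C where "C > 0" "\<And>u v. H10 \<Omega> (fst u) (snd u) \<Longrightarrow> H10 \<Omega> (fst v) (snd v) \<Longrightarrow>
    \<bar>bil (snd u) (snd v)\<bar> \<le> C * h1_norm u * h1_norm v"
proof -
  have "\<forall>i j. \<exists>C\<ge>0. AE x in lebesgue_on \<Omega>. \<bar>a i j x\<bar> \<le> C"
  proof (intro allI)
    fix i j show "\<exists>C\<ge>0. AE x in lebesgue_on \<Omega>. \<bar>a i j x\<bar> \<le> C"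
      using coeff[of i j] by (rule Linf_bound) blast
  qed
  then obtain A where A: "\<And>i j. A i j \<ge> 0" "\<And>i j. AE x in lebesgue_on \<Omega>. \<bar>a i j x\<bar> \<le> A i j"
    by (simp only: choice_iff) blast
  \<comment> \<open>The summand 1 keeps the constant positive even when all bounds
    \<open>A i j\<close> are zero.\<close>
  define C where "C = (\<Sum>i\<in>UNIV. \<Sum>j\<in>UNIV. A i j) + 1"
  have "\<bar>bil (snd u) (snd v)\<bar> \<le> C * h1_norm u * h1_norm v"
    if u: "H10 \<Omega> (fst u) (snd u)" and v: "H10 \<Omega> (fst v) (snd v)" for u v
  proof -
    have vu: "vL2 (snd u)" and vv: "vL2 (snd v)" using H10_D(2)[OF u] H10_D(2)[OF v] by simp_all
    have n0: "0 \<le> h1_norm u" "0 \<le> h1_norm v" using u v H10.nrm_nonneg by simp_all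
    have t: "\<bar>L2_inner \<Omega> (\<lambda>x. a i j x * snd u x $ i) (\<lambda>x. snd v x $ j)\<bar> \<le> A i j * (h1_norm u * h1_norm v)" for i j
    proof -
      have "\<bar>L2_inner \<Omega> (\<lambda>x. a i j x * snd u x $ i) (\<lambda>x. snd v x $ j)\<bar>
          \<le> L2_norm \<Omega> (\<lambda>x. a i j x * snd u x $ i) * L2_norm \<Omega> (\<lambda>x. snd v x $ j)"
        by (rule L2.cauchy_schwarz[OF coeff_L2[OF vu]]) (use vv in simp)
      also have "\<dots> \<le> (A i j * h1_norm u) * h1_norm v"
      proof (rule mult_mono)
        have "L2_norm \<Omega> (\<lambda>x. a i j x * snd u x $ i) \<le> A i j * L2_norm \<Omega> (\<lambda>x. snd u x $ i)"
          by (rule L2_mult_bounded(2)[OF Linf_measurable[OF coeff] _ A(2) A(1)]) (use vu in simp)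
        also have "\<dots> \<le> A i j * h1_norm u" by (intro mult_left_mono L2_norm_le_h1_norm(2)[OF u] A)
        finally show "L2_norm \<Omega> (\<lambda>x. a i j x * snd u x $ i) \<le> A i j * h1_norm u" .
        show "0 \<le> L2_norm \<Omega> (\<lambda>x. snd v x $ j)" using vv by (intro L2.nrm_nonneg) simp
      qed (use L2_norm_le_h1_norm(2)[OF v] n0 A(1) in simp_all)
      finally show ?thesis by (simp add: mult.assoc)
    qed
    have "\<bar>bil (snd u) (snd v)\<bar> \<le> (\<Sum>i\<in>UNIV. \<Sum>j\<in>UNIV. A i j * (h1_norm u * h1_norm v))"
      unfolding bil_eq[OF vu vv]
      by (intro order_trans[OF sum_abs] sum_mono t)
    also have "\<dots> = (\<Sum>i\<in>UNIV. \<Sum>j\<in>UNIV. A i j) * (h1_norm u * h1_norm v)"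
      by (simp add: sum_distrib_right)
    also have "\<dots> \<le> C * (h1_norm u * h1_norm v)"
      unfolding C_def using n0 by (intro mult_right_mono) auto
    finally show ?thesis by (simp add: mult.assoc)
  qed
  moreover have "C > 0" unfolding C_def by (intro add_nonneg_pos sum_nonneg A) simp
  ultimately show ?thesis using that by blast
qed

lemma ellipticity_constant:
  obtains \<Lambda> where "\<Lambda> > 0" "AE x in lebesgue_on \<Omega>. \<forall>\<xi>::real^'n.
     \<Lambda> * (\<Sum>i\<in>UNIV. (\<xi> $ i)\<^sup>2) \<le> (\<Sum>i\<in>UNIV. \<Sum>j\<in>UNIV. a i j x * \<xi> $ i * \<xi> $ j)"
proof -
  have n: "(norm \<xi>)\<^sup>2 = (\<Sum>i\<in>UNIV. (\<xi> $ i)\<^sup>2)" for \<xi> :: "real^'n"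
    unfolding power2_norm_eq_inner inner_vec_def by (simp add: power2_eq_square)
  show ?thesis using elliptic that unfolding elliptic_def n by blast
qed

lemma dom_norm_bound:
  obtains R where "R \<ge> 0" "\<And>x. x \<in> \<Omega> \<Longrightarrow> norm x \<le> R"
  using bounded_dom unfolding bounded_pos by (metis less_imp_le)

text \<open>Ellipticity controls the gradient part of the norm, and the Poincare inequality recovers
  the function part from it; the loss is the factor \<open>c\<close>.\<close>

lemma bil_coercive:
  obtains \<gamma> where "\<gamma> > 0" "\<And>u. H10 \<Omega> (fst u) (snd u) \<Longrightarrow> \<gamma> * (h1_norm u)\<^sup>2 \<le> bil (snd u) (snd u)"
proof -
  obtain \<Lambda> where \<Lambda>: "\<Lambda> > 0" "AE x in lebesgue_on \<Omega>. \<forall>\<xi>::real^'n.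
     \<Lambda> * (\<Sum>i\<in>UNIV. (\<xi> $ i)\<^sup>2) \<le> (\<Sum>i\<in>UNIV. \<Sum>j\<in>UNIV. a i j x * \<xi> $ i * \<xi> $ j)"
    by (rule ellipticity_constant)
  obtain R where R: "R \<ge> 0" "\<And>x. x \<in> \<Omega> \<Longrightarrow> norm x \<le> R" by (rule dom_norm_bound) blast
  define c where "c = 1 + (2 * R)\<^sup>2"
  have c: "c > 0" unfolding c_def by (simp add: add_pos_nonneg)
  have "\<Lambda> / c * (h1_norm u)\<^sup>2 \<le> bil (snd u) (snd u)" if u: "H10 \<Omega> (fst u) (snd u)" for u
  proof -
    have vu: "vL2 (snd u)" using H10_D(2)[OF u] by simp
    define S where "S = (\<Sum>i\<in>UNIV. (L2_norm \<Omega> (\<lambda>x. snd u x $ i))\<^sup>2)"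
    have "L2_norm \<Omega> (fst u) \<le> 2 * R * L2_norm \<Omega> (\<lambda>x. snd u x $ i)" for i
      by (rule H10_poincare[OF u R(2,1)])
    \<comment> \<open>The Poincare inequality holds in every coordinate direction, so an unspecified
      index serves.\<close>
    then have "(L2_norm \<Omega> (fst u))\<^sup>2 \<le> (2 * R * L2_norm \<Omega> (\<lambda>x. snd u x $ undefined))\<^sup>2"
      using L2.nrm_nonneg[OF H10_D(1)[OF u]] by (intro power_mono)
    also have "\<dots> = (2 * R)\<^sup>2 * (L2_norm \<Omega> (\<lambda>x. snd u x $ undefined))\<^sup>2" by (rule power_mult_distrib)
    also have "\<dots> \<le> (2 * R)\<^sup>2 * S" unfolding S_def by (intro mult_left_mono member_le_sum) auto
    finally have "(h1_norm u)\<^sup>2 \<le> c * S" unfolding h1_norm_sq[OF u] S_def[symmetric] c_def by (simp add: algebra_simps)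
    then have 1: "\<Lambda> / c * (h1_norm u)\<^sup>2 \<le> \<Lambda> / c * (c * S)" using \<Lambda>(1) c by (intro mult_left_mono) auto
    have int: "integrable (lebesgue_on \<Omega>) (\<lambda>x. \<Lambda> * (\<Sum>i\<in>UNIV. (snd u x $ i)\<^sup>2))"
      by (intro Bochner_Integration.integrable_mult_right Bochner_Integration.integrable_sum L2_integrable_square)
        (use vu in simp)
    have "\<Lambda> * S = (LINT x|lebesgue_on \<Omega>. \<Lambda> * (\<Sum>i\<in>UNIV. (snd u x $ i)\<^sup>2))"
      using vu by (simp add: S_def L2_norm_sq L2_integrable_square)
    also have "\<dots> \<le> bil (snd u) (snd u)"
      unfolding bil_def
    proof (rule integral_mono_AE[OF int bil_integrable[OF vu vu]])
      show "AE x in lebesgue_on \<Omega>. \<Lambda> * (\<Sum>i\<in>UNIV. (snd u x $ i)\<^sup>2) \<le>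
          (\<Sum>i\<in>UNIV. \<Sum>j\<in>UNIV. a i j x * snd u x $ i * snd u x $ j)"
        using \<Lambda>(2) by eventually_elim blast
    qed
    finally show ?thesis using 1 c by simp
  qed
  moreover have "\<Lambda> / c > 0" using \<Lambda> c by simp
  ultimately show ?thesis using that by blast
qed

text \<open>Testing with \<open>cutoff (d)\<close> instead of the positive part of \<open>d\<close> avoids weak derivatives of
  non-smooth compositions.\<close>

lemma weak_maximum_principle:
  assumes d: "H10 \<Omega> d G" and \<rho>: "\<rho> \<in> L2 \<Omega>"
    and eq: "\<And>z Z. H10 \<Omega> z Z \<Longrightarrow> bil G Z + L2_inner \<Omega> \<rho> z = 0"
    and sign: "AE x in lebesgue_on \<Omega>. d x > 0 \<longrightarrow> \<rho> x \<ge> 0"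
  shows "AE x in lebesgue_on \<Omega>. d x \<le> 0"
proof -
  obtain \<Lambda> where \<Lambda>: "\<Lambda> > 0" "AE x in lebesgue_on \<Omega>. \<forall>\<xi>::real^'n.
     \<Lambda> * (\<Sum>i\<in>UNIV. (\<xi> $ i)\<^sup>2) \<le> (\<Sum>i\<in>UNIV. \<Sum>j\<in>UNIV. a i j x * \<xi> $ i * \<xi> $ j)"
    by (rule ellipticity_constant)
  obtain R where R: "R \<ge> 0" "\<And>x. x \<in> \<Omega> \<Longrightarrow> norm x \<le> R" by (rule dom_norm_bound) blast
  have H: "H10 \<Omega> (\<lambda>x. cutoff (d x)) (\<lambda>x. cutoff' (d x) *\<^sub>R G x)"
    by (rule H10_compose[OF d cutoff_deriv cutoff_simps(1) cutoff'_bounds(3) cutoff'_lipschitz])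
  note LH = H10_D[OF H]
  have vG: "vL2 G" and vH: "vL2 (\<lambda>x. cutoff' (d x) *\<^sub>R G x)" using H10_D(2)[OF d] LH(2) by simp_all
  \<comment> \<open>The test function is nonnegative and vanishes where \<open>d\<close> is
    nonpositive, so only the region of the sign hypothesis contributes.\<close>
  have "0 \<le> L2_inner \<Omega> \<rho> (\<lambda>x. cutoff (d x))"
    unfolding L2_inner_def
  proof (rule integral_nonneg_AE)
    show "AE x in lebesgue_on \<Omega>. 0 \<le> \<rho> x * cutoff (d x)"
      using sign
    proof eventually_elim
      case (elim x)
      then show ?case using cutoff_simps(2)[of "d x"] cutoff_simps(4)[of "d x"] by (cases "d x > 0") auto
    qed
  qed
  then have le: "bil G (\<lambda>x. cutoff' (d x) *\<^sub>R G x) \<le> 0" using eq[OF H] by linarith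
  \<comment> \<open>The squared length of the gradient of the test function. Ellipticity bounds
    \<open>cutoff'\<close> times the squared length of \<open>G\<close>; \<open>Q\<close> carries
    the square of \<open>cutoff'\<close>, which is smaller because \<open>cutoff'\<close> lies in
    [0, 1].\<close>
  define Q where "Q x = (\<Sum>i\<in>UNIV. ((cutoff' (d x) *\<^sub>R G x) $ i)\<^sup>2)" for x
  have Qint: "integrable (lebesgue_on \<Omega>) Q"
    unfolding Q_def[abs_def] by (intro Bochner_Integration.integrable_sum L2_integrable_square LH(2))
  have Q0: "0 \<le> Q x" for x unfolding Q_def by (intro sum_nonneg) auto
  have "\<Lambda> * (LINT x|lebesgue_on \<Omega>. Q x) = (LINT x|lebesgue_on \<Omega>. \<Lambda> * Q x)" by simp
  also have "\<dots> \<le> bil G (\<lambda>x. cutoff' (d x) *\<^sub>R G x)"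
    unfolding bil_def
  proof (rule integral_mono_AE[OF Bochner_Integration.integrable_mult_right[OF Qint] bil_integrable[OF vG vH]])
    show "AE x in lebesgue_on \<Omega>. \<Lambda> * Q x \<le>
          (\<Sum>i\<in>UNIV. \<Sum>j\<in>UNIV. a i j x * G x $ i * (cutoff' (d x) *\<^sub>R G x) $ j)"
      using \<Lambda>(2)
    proof eventually_elim
      case (elim x)
      have c: "0 \<le> cutoff' (d x)" "cutoff' (d x) \<le> 1" by (rule cutoff'_bounds)+
      have "Q x = cutoff' (d x) * (cutoff' (d x) * (\<Sum>i\<in>UNIV. (G x $ i)\<^sup>2))"
        by (simp add: Q_def power_mult_distrib sum_distrib_left power2_eq_square mult_ac)
      also have "\<dots> \<le> 1 * (cutoff' (d x) * (\<Sum>i\<in>UNIV. (G x $ i)\<^sup>2))"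
        using c by (intro mult_right_mono mult_nonneg_nonneg sum_nonneg) auto
      finally have "\<Lambda> * Q x \<le> \<Lambda> * (cutoff' (d x) * (\<Sum>i\<in>UNIV. (G x $ i)\<^sup>2))"
        using \<Lambda>(1) by simp
      also have "\<dots> = cutoff' (d x) * (\<Lambda> * (\<Sum>i\<in>UNIV. (G x $ i)\<^sup>2))" by simp
      also have "\<dots> \<le> cutoff' (d x) * (\<Sum>i\<in>UNIV. \<Sum>j\<in>UNIV. a i j x * G x $ i * G x $ j)"
        using elim c by (intro mult_left_mono) blast+
      also have "\<dots> = (\<Sum>i\<in>UNIV. \<Sum>j\<in>UNIV. a i j x * G x $ i * (cutoff' (d x) *\<^sub>R G x) $ j)"
        by (simp add: sum_distrib_left mult_ac)
      finally show ?case .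
    qed
  qed
  also note le
  finally have "(LINT x|lebesgue_on \<Omega>. Q x) \<le> 0" using \<Lambda>(1) by (simp add: mult_le_0_iff)
  moreover have "(L2_norm \<Omega> (\<lambda>x. (cutoff' (d x) *\<^sub>R G x) $ i))\<^sup>2 \<le> (LINT x|lebesgue_on \<Omega>. Q x)" for i
    unfolding L2_norm_sq[OF LH(2)]
  proof (rule integral_mono_AE[OF L2_integrable_square[OF LH(2)] Qint], rule AE_I2)
    fix x show "((cutoff' (d x) *\<^sub>R G x) $ i)\<^sup>2 \<le> Q x"
      unfolding Q_def by (rule member_le_sum) auto
  qed
  ultimately have "(L2_norm \<Omega> (\<lambda>x. (cutoff' (d x) *\<^sub>R G x) $ i))\<^sup>2 \<le> 0" for i
    using order_trans by blast
  then have "L2_norm \<Omega> (\<lambda>x. (cutoff' (d x) *\<^sub>R G x) $ i) = 0" for i by simp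
  \<comment> \<open>A zero gradient forces a zero function by the Poincare inequality, and
    \<open>cutoff\<close> vanishes only on nonpositive arguments.\<close>
  then have "L2_norm \<Omega> (\<lambda>x. cutoff (d x)) \<le> 0"
    using H10_poincare[OF H R(2,1), of undefined] by simp
  then have "L2_norm \<Omega> (\<lambda>x. cutoff (d x)) = 0" using L2.nrm_nonneg[OF LH(1)] by simp
  from L2_norm_eq_0_imp_AE[OF LH(1) this] show ?thesis
    by eventually_elim (simp add: cutoff_simps)
qed

end

section \<open>The state equation\<close>

lemma C2_fun_DERIV:
  assumes "C2_fun g"
  shows "(g has_field_derivative deriv g t) (at t)" "(deriv g has_field_derivative deriv (deriv g) t) (at t)"
  using assms by (auto simp: C2_fun_def DERIV_deriv_iff_real_differentiable)

lemma C2_fun_lipschitz: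
  assumes "C2_fun g" "\<bar>s\<bar> \<le> M" "\<bar>t\<bar> \<le> M"
  shows "(\<And>u. \<bar>u\<bar> \<le> M \<Longrightarrow> \<bar>deriv g u\<bar> \<le> C) \<Longrightarrow> \<bar>g s - g t\<bar> \<le> C * \<bar>s - t\<bar>"
    and "(\<And>u. \<bar>u\<bar> \<le> M \<Longrightarrow> \<bar>deriv (deriv g) u\<bar> \<le> C) \<Longrightarrow> \<bar>deriv g s - deriv g t\<bar> \<le> C * \<bar>s - t\<bar>"
proof -
  have S: "s \<in> {-M..M}" "t \<in> {-M..M}" using assms(2,3) by auto
  {
    assume b: "\<And>u. \<bar>u\<bar> \<le> M \<Longrightarrow> \<bar>deriv g u\<bar> \<le> C"
    have "norm (g s - g t) \<le> C * norm (s - t)"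
    proof (rule field_differentiable_bound[OF _ _ _ S])
      fix u assume "u \<in> {-M..M}"
      then show "norm (deriv g u) \<le> C" using b[of u] by auto
      show "(g has_field_derivative deriv g u) (at u within {-M..M})"
        by (rule has_field_derivative_at_within[OF C2_fun_DERIV(1)[OF assms(1)]])
    qed auto
    then show "\<bar>g s - g t\<bar> \<le> C * \<bar>s - t\<bar>" by simp
  next
    assume b: "\<And>u. \<bar>u\<bar> \<le> M \<Longrightarrow> \<bar>deriv (deriv g) u\<bar> \<le> C"
    have "norm (deriv g s - deriv g t) \<le> C * norm (s - t)"
    proof (rule field_differentiable_bound[OF _ _ _ S])
      fix u assume "u \<in> {-M..M}"
      then show "norm (deriv (deriv g) u) \<le> C" using b[of u] by auto
      show "(deriv g has_field_derivative deriv (deriv g) u) (at u within {-M..M})"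
        by (rule has_field_derivative_at_within[OF C2_fun_DERIV(2)[OF assms(1)]])
    qed auto
    then show "\<bar>deriv g s - deriv g t\<bar> \<le> C * \<bar>s - t\<bar>" by simp
  }
qed

text \<open>\<open>A\<close> bounds the first and \<open>C\<close> the second derivative on [-M, M].
  They are kept apart because for a cost integrand \<open>A\<close> is the value of an L2 function
  at the point, while \<open>C\<close> is constant.\<close>

abbreviation C2_bounds :: "(real \<Rightarrow> real) \<Rightarrow> real \<Rightarrow> real \<Rightarrow> real \<Rightarrow> bool" where
  "C2_bounds g M A C \<equiv> \<forall>s t. \<bar>s\<bar> \<le> M \<and> \<bar>t\<bar> \<le> M \<longrightarrow>
      \<bar>g s - g t\<bar> \<le> A * \<bar>s - t\<bar> \<and> \<bar>deriv g s\<bar> \<le> A \<and> \<bar>deriv g s - deriv g t\<bar> \<le> C * \<bar>s - t\<bar> \<and>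
      \<bar>g s - g t - deriv g t * (s - t)\<bar> \<le> C * (s - t)\<^sup>2"

text \<open>Mean value inequality for \<open>g u - deriv g t * u\<close> on the segment between
  \<open>s\<close> and \<open>t\<close>, where its derivative is at most
  \<open>C * \<bar>s - t\<bar>\<close>. This gives the constant \<open>C\<close> in place of the
  sharp \<open>C / 2\<close>.\<close>

lemma C2_fun_taylor:
  assumes "C2_fun g" "\<bar>s\<bar> \<le> M" "\<bar>t\<bar> \<le> M" "C \<ge> 0"
    and b: "\<And>u. \<bar>u\<bar> \<le> M \<Longrightarrow> \<bar>deriv (deriv g) u\<bar> \<le> C"
  shows "\<bar>g s - g t - deriv g t * (s - t)\<bar> \<le> C * (s - t)\<^sup>2"
proof -
  define S where "S = {min s t..max s t}"
  have "norm ((g s - deriv g t * s) - (g t - deriv g t * t)) \<le> (C * \<bar>s - t\<bar>) * norm (s - t)"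
  proof (rule field_differentiable_bound[where S = S])
    fix u assume u: "u \<in> S"
    then have uM: "\<bar>u\<bar> \<le> M" and ut: "\<bar>u - t\<bar> \<le> \<bar>s - t\<bar>" using assms(2,3) by (auto simp: S_def min_def max_def split: if_splits)
    have "\<bar>deriv g u - deriv g t\<bar> \<le> C * \<bar>u - t\<bar>" by (rule C2_fun_lipschitz(2)[OF assms(1) uM assms(3) b])
    also have "\<dots> \<le> C * \<bar>s - t\<bar>" using ut assms(4) by (rule mult_left_mono)
    finally show "norm (deriv g u - deriv g t) \<le> C * \<bar>s - t\<bar>" by simp
    have "((\<lambda>u. g u - deriv g t * u) has_field_derivative deriv g u - deriv g t * 1) (at u)"
      by (intro DERIV_diff C2_fun_DERIV(1) assms(1) DERIV_cmult DERIV_ident)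
    then show "((\<lambda>u. g u - deriv g t * u) has_field_derivative deriv g u - deriv g t) (at u within S)"
      by (simp add: has_field_derivative_at_within)
  qed (auto simp: S_def)
  then show ?thesis by (simp add: power2_eq_square algebra_simps)
qed

section \<open>Superposition operators: measurability and pointwise bounds\<close>

context bounded_open
begin

lemma sets_dom [simp]: "\<Omega> \<in> sets lebesgue"
  using lmeasurable_dom by (rule fmeasurableD)

text \<open>Completeness of Lebesgue measure: whatever \<open>g\<close> does inside the exceptional
  null set, the preimage there is measurable.\<close>

lemma borel_measurable_cong_AE_lebesgue_on:
  fixes g h :: "real^'n \<Rightarrow> real"
  assumes h: "h \<in> borel_measurable (lebesgue_on \<Omega>)" and eq: "AE x in lebesgue_on \<Omega>. h x = g x"
  shows "g \<in> borel_measurable (lebesgue_on \<Omega>)"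
proof (rule measurableI)
  fix S :: "real set" assume S: "S \<in> sets borel"
  from eq obtain N where N: "{x \<in> space (lebesgue_on \<Omega>). h x \<noteq> g x} \<subseteq> N"
    "emeasure (lebesgue_on \<Omega>) N = 0" "N \<in> sets (lebesgue_on \<Omega>)" by (rule AE_E)
  have N\<Omega>: "N \<subseteq> \<Omega>" using N(3) sets.sets_into_space by fastforce
  have "N \<in> null_sets lebesgue"
    using N(2,3) N\<Omega> by (auto simp: null_sets_def sets_restrict_space_iff emeasure_restrict_space)
  then have B: "g -` S \<inter> N \<in> sets lebesgue" "g -` S \<inter> N \<subseteq> \<Omega>"
    using completion.complete2[of "g -` S \<inter> N" N lborel] N\<Omega> by auto
  have A: "h -` S \<inter> space (lebesgue_on \<Omega>) \<in> sets (lebesgue_on \<Omega>)" using h S by (rule measurable_sets)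
  have "g -` S \<inter> space (lebesgue_on \<Omega>) = (h -` S \<inter> space (lebesgue_on \<Omega>) - N) \<union> (g -` S \<inter> N)"
    using N(1) N\<Omega> by auto
  also have "\<dots> \<in> sets (lebesgue_on \<Omega>)"
    using A N(3) B by (intro sets.Un sets.Diff) (auto simp: sets_restrict_space_iff)
  finally show "g -` S \<inter> space (lebesgue_on \<Omega>) \<in> sets (lebesgue_on \<Omega>)" .
qed simp

lemma borel_measurable_AE_limit:
  fixes g :: "real^'n \<Rightarrow> real"
  assumes h: "\<And>n::nat. h n \<in> borel_measurable (lebesgue_on \<Omega>)"
    and lim: "AE x in lebesgue_on \<Omega>. (\<lambda>n. h n x) \<longlonglongrightarrow> g x"
  shows "g \<in> borel_measurable (lebesgue_on \<Omega>)"
proof (rule borel_measurable_cong_AE_lebesgue_on)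
  show "(\<lambda>x. lim (\<lambda>n. h n x)) \<in> borel_measurable (lebesgue_on \<Omega>)"
    using h by (intro borel_measurable_lim_metric)
  show "AE x in lebesgue_on \<Omega>. lim (\<lambda>n. h n x) = g x"
    using lim by eventually_elim (rule limI)
qed

text \<open>For \<open>u\<close> with countably many values the claim follows from measurability in
  \<open>x\<close> at each fixed value; continuity in the second variable then passes to the
  limit.\<close>

lemma caratheodory_measurable:
  fixes h :: "real^'n \<Rightarrow> real \<Rightarrow> real"
  assumes h: "\<And>t. (\<lambda>x. h x t) \<in> borel_measurable (lebesgue_on \<Omega>)"
    and cont: "AE x in lebesgue_on \<Omega>. \<forall>t. isCont (h x) t"
    and u [measurable]: "u \<in> borel_measurable (lebesgue_on \<Omega>)"
  shows "(\<lambda>x. h x (u x)) \<in> borel_measurable (lebesgue_on \<Omega>)"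
proof -
  \<comment> \<open>\<open>u\<close> rounded down to a multiple of
    \<open>1 / real (Suc n)\<close>.\<close>
  define q where "q n x = real_of_int \<lfloor>real (Suc n) * u x\<rfloor> / real (Suc n)" for n x
  have m: "(\<lambda>x. h x (q n x)) \<in> borel_measurable (lebesgue_on \<Omega>)" for n
    unfolding q_def
  proof (rule measurable_compose_countable[where f = "\<lambda>i x. h x (real_of_int i / real (Suc n))"])
    show "(\<lambda>x. \<lfloor>real (Suc n) * u x\<rfloor>) \<in> measurable (lebesgue_on \<Omega>) (count_space UNIV)" by measurable
  qed (rule h)
  have ql: "(\<lambda>n. q n x) \<longlonglongrightarrow> u x" for x
  proof (rule tendsto_sandwich)
    show "\<forall>\<^sub>F n in sequentially. u x - 1 / real (Suc n) \<le> q n x"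
    proof (rule always_eventually, rule allI)
      fix n
      have "real (Suc n) * u x - 1 \<le> real_of_int \<lfloor>real (Suc n) * u x\<rfloor>" by linarith
      then have "(real (Suc n) * u x - 1) / real (Suc n) \<le> q n x"
        unfolding q_def by (rule divide_right_mono) simp
      then show "u x - 1 / real (Suc n) \<le> q n x" by (simp add: diff_divide_distrib del: of_nat_Suc)
    qed
    show "\<forall>\<^sub>F n in sequentially. q n x \<le> u x"
    proof (rule always_eventually, rule allI)
      fix n
      have "q n x \<le> (real (Suc n) * u x) / real (Suc n)"
        unfolding q_def by (rule divide_right_mono) simp_all
      then show "q n x \<le> u x" by (simp del: of_nat_Suc)
    qed
    show "(\<lambda>n. u x - 1 / real (Suc n)) \<longlonglongrightarrow> u x"
      using tendsto_diff[OF tendsto_const LIMSEQ_Suc[OF lim_1_over_n], of "u x"] by simp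
  qed simp
  have "AE x in lebesgue_on \<Omega>. (\<lambda>n. h x (q n x)) \<longlonglongrightarrow> h x (u x)"
    using cont
  proof eventually_elim
    case (elim x)
    show ?case by (rule isCont_tendsto_compose[OF _ ql]) (use elim in blast)
  qed
  then show ?thesis by (rule borel_measurable_AE_limit[OF m])
qed

lemma caratheodory_C2_measurable:
  assumes h: "caratheodory_C2 \<Omega> h" and u: "u \<in> borel_measurable (lebesgue_on \<Omega>)"
  shows "(\<lambda>x. h x (u x)) \<in> borel_measurable (lebesgue_on \<Omega>)"
    "(\<lambda>x. deriv (h x) (u x)) \<in> borel_measurable (lebesgue_on \<Omega>)"
proof -
  have hm: "(\<lambda>x. h x t) \<in> borel_measurable (lebesgue_on \<Omega>)" for t
    using h by (simp add: caratheodory_C2_def)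
  have C2: "AE x in lebesgue_on \<Omega>. C2_fun (h x)"
    using h by (simp add: caratheodory_C2_def)
  have "AE x in lebesgue_on \<Omega>. \<forall>t. isCont (h x) t"
    using C2 by eventually_elim (meson C2_fun_DERIV(1) DERIV_isCont)
  from caratheodory_measurable[OF hm this u] show "(\<lambda>x. h x (u x)) \<in> borel_measurable (lebesgue_on \<Omega>)" .
  \<comment> \<open>Measurability of the derivative at a fixed argument comes from difference
    quotients, of which it is the limit almost everywhere.\<close>
  have dm: "(\<lambda>x. deriv (h x) t) \<in> borel_measurable (lebesgue_on \<Omega>)" for t
  proof (rule borel_measurable_AE_limit)
    show "(\<lambda>x. (h x (t + inverse (real (Suc n))) - h x t) / inverse (real (Suc n))) \<in> borel_measurable (lebesgue_on \<Omega>)" for n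
      using hm by (intro borel_measurable_divide borel_measurable_diff borel_measurable_const)
    show "AE x in lebesgue_on \<Omega>. (\<lambda>n. (h x (t + inverse (real (Suc n))) - h x t) / inverse (real (Suc n))) \<longlonglongrightarrow> deriv (h x) t"
      using C2
    proof eventually_elim
      case (elim x)
      have "((\<lambda>d. (h x (t + d) - h x t) / d) \<longlongrightarrow> deriv (h x) t) (at 0)"
        using C2_fun_DERIV(1)[OF elim, of t] by (simp add: DERIV_def)
      moreover have "filterlim (\<lambda>n. inverse (real (Suc n))) (at 0) sequentially"
        by (simp add: filterlim_at LIMSEQ_inverse_real_of_nat del: of_nat_Suc)
      ultimately show ?case by (rule filterlim_compose)
    qed
  qed
  have "AE x in lebesgue_on \<Omega>. \<forall>t. isCont (deriv (h x)) t"
    using C2 by eventually_elim (meson C2_fun_DERIV(2) DERIV_isCont)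
  from caratheodory_measurable[OF dm this u] show "(\<lambda>x. deriv (h x) (u x)) \<in> borel_measurable (lebesgue_on \<Omega>)" .
qed

lemma integrand_bounds:
  assumes l: "integrand_assms \<Omega> l" and M: "M > 0"
  obtains C \<psi> where "C > 0" "\<psi> \<in> L2 \<Omega>" "AE x in lebesgue_on \<Omega>. C2_bounds (l x) M (\<psi> x) C"
proof -
  have C2: "AE x in lebesgue_on \<Omega>. C2_fun (l x)" using l by (auto simp: integrand_assms_def caratheodory_C2_def)
  have "\<exists>C>0. \<exists>\<psi>\<in>L2 \<Omega>. AE x in lebesgue_on \<Omega>.
        (\<forall>y. \<bar>y\<bar> \<le> M \<longrightarrow> \<bar>deriv (l x) y\<bar> \<le> \<psi> x \<and> \<bar>deriv (deriv (l x)) y\<bar> \<le> C) \<and>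
        (\<forall>y1 y2. \<bar>y1\<bar> \<le> M \<and> \<bar>y2\<bar> \<le> M \<longrightarrow> \<bar>deriv (deriv (l x)) y2 - deriv (deriv (l x)) y1\<bar> \<le> C * \<bar>y2 - y1\<bar>)"
    using l M unfolding integrand_assms_def by blast
  then obtain C \<psi> where C: "C > 0" "\<psi> \<in> L2 \<Omega>" "AE x in lebesgue_on \<Omega>.
        (\<forall>y. \<bar>y\<bar> \<le> M \<longrightarrow> \<bar>deriv (l x) y\<bar> \<le> \<psi> x \<and> \<bar>deriv (deriv (l x)) y\<bar> \<le> C) \<and>
        (\<forall>y1 y2. \<bar>y1\<bar> \<le> M \<and> \<bar>y2\<bar> \<le> M \<longrightarrow> \<bar>deriv (deriv (l x)) y2 - deriv (deriv (l x)) y1\<bar> \<le> C * \<bar>y2 - y1\<bar>)"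
    by blast
  have "AE x in lebesgue_on \<Omega>. C2_bounds (l x) M (\<psi> x) C"
    using C2 C(3)
  proof eventually_elim
    case (elim x)
    then have b: "\<And>u. \<bar>u\<bar> \<le> M \<Longrightarrow> \<bar>deriv (l x) u\<bar> \<le> \<psi> x" "\<And>u. \<bar>u\<bar> \<le> M \<Longrightarrow> \<bar>deriv (deriv (l x)) u\<bar> \<le> C"
      by blast+
    show ?case
    proof (intro allI impI conjI)
      fix s t assume st: "\<bar>s\<bar> \<le> M \<and> \<bar>t\<bar> \<le> M"
      then have s: "\<bar>s\<bar> \<le> M" and t: "\<bar>t\<bar> \<le> M" by auto
      show "\<bar>l x s - l x t\<bar> \<le> \<psi> x * \<bar>s - t\<bar>" by (rule C2_fun_lipschitz(1)[OF elim(1) s t b(1)])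
      show "\<bar>deriv (l x) s\<bar> \<le> \<psi> x" by (rule b(1)[OF s])
      show "\<bar>deriv (l x) s - deriv (l x) t\<bar> \<le> C * \<bar>s - t\<bar>" by (rule C2_fun_lipschitz(2)[OF elim(1) s t b(2)])
      show "\<bar>l x s - l x t - deriv (l x) t * (s - t)\<bar> \<le> C * (s - t)\<^sup>2"
        using C(1) by (intro C2_fun_taylor[OF elim(1) s t _ b(2)]) auto
    qed
  qed
  with C show ?thesis using that by blast
qed

end

section \<open>Comparison and Lipschitz dependence for the state equation\<close>

locale state_equation = elliptic_form \<Omega> a for \<Omega> :: "(real^'n::finite) set" and a +
  fixes f :: "real^'n \<Rightarrow> real \<Rightarrow> real" and y :: "(real^'n \<Rightarrow> real) \<Rightarrow> real^'n \<Rightarrow> real"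
  assumes nonlin: "nonlinearity_assms \<Omega> f" and state: "state_map \<Omega> a f y"
begin

lemma f_cara: "caratheodory_C2 \<Omega> f"
  using nonlin by (simp add: nonlinearity_assms_def)

lemma f_bounds:
  assumes M: "M > 0"
  obtains C where "C > 0" "AE x in lebesgue_on \<Omega>. C2_bounds (f x) M C C"
proof -
  have C2: "AE x in lebesgue_on \<Omega>. C2_fun (f x)" using f_cara by (auto simp: caratheodory_C2_def)
  have "\<exists>C>0. AE x in lebesgue_on \<Omega>. (\<forall>y. \<bar>y\<bar> \<le> M \<longrightarrow> \<bar>deriv (f x) y\<bar> + \<bar>deriv (deriv (f x)) y\<bar> \<le> C) \<and>
        (\<forall>y1 y2. \<bar>y1\<bar> \<le> M \<and> \<bar>y2\<bar> \<le> M \<longrightarrow> \<bar>deriv (deriv (f x)) y2 - deriv (deriv (f x)) y1\<bar> \<le> C * \<bar>y2 - y1\<bar>)"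
    using nonlin M unfolding nonlinearity_assms_def by blast
  then obtain C where C: "C > 0" "AE x in lebesgue_on \<Omega>. (\<forall>y. \<bar>y\<bar> \<le> M \<longrightarrow> \<bar>deriv (f x) y\<bar> + \<bar>deriv (deriv (f x)) y\<bar> \<le> C) \<and>
        (\<forall>y1 y2. \<bar>y1\<bar> \<le> M \<and> \<bar>y2\<bar> \<le> M \<longrightarrow> \<bar>deriv (deriv (f x)) y2 - deriv (deriv (f x)) y1\<bar> \<le> C * \<bar>y2 - y1\<bar>)"
    by blast
  have "AE x in lebesgue_on \<Omega>. C2_bounds (f x) M C C"
    using C2 C(2)
  proof eventually_elim
    case (elim x)
    have b: "\<bar>deriv (f x) u\<bar> \<le> C" "\<bar>deriv (deriv (f x)) u\<bar> \<le> C" if "\<bar>u\<bar> \<le> M" for u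
    proof -
      have "\<bar>deriv (f x) u\<bar> + \<bar>deriv (deriv (f x)) u\<bar> \<le> C" using elim(2) that by blast
      then show "\<bar>deriv (f x) u\<bar> \<le> C" "\<bar>deriv (deriv (f x)) u\<bar> \<le> C" by linarith+
    qed
    show ?case
    proof (intro allI impI conjI)
      fix s t assume st: "\<bar>s\<bar> \<le> M \<and> \<bar>t\<bar> \<le> M"
      then have s: "\<bar>s\<bar> \<le> M" and t: "\<bar>t\<bar> \<le> M" by auto
      show "\<bar>f x s - f x t\<bar> \<le> C * \<bar>s - t\<bar>" by (rule C2_fun_lipschitz(1)[OF elim(1) s t b(1)])
      show "\<bar>deriv (f x) s\<bar> \<le> C" by (rule b(1)[OF s])
      show "\<bar>deriv (f x) s - deriv (f x) t\<bar> \<le> C * \<bar>s - t\<bar>" by (rule C2_fun_lipschitz(2)[OF elim(1) s t b(2)])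
      show "\<bar>f x s - f x t - deriv (f x) t * (s - t)\<bar> \<le> C * (s - t)\<^sup>2"
        using C(1) by (intro C2_fun_taylor[OF elim(1) s t _ b(2)]) auto
    qed
  qed
  with C show ?thesis using that by blast
qed

lemma f_mono: "AE x in lebesgue_on \<Omega>. (\<forall>t. 0 \<le> deriv (f x) t) \<and> (\<forall>s t. s \<le> t \<longrightarrow> f x s \<le> f x t)"
proof -
  have "AE x in lebesgue_on \<Omega>. C2_fun (f x)" using f_cara by (auto simp: caratheodory_C2_def)
  moreover have "AE x in lebesgue_on \<Omega>. \<forall>y. deriv (f x) y \<ge> 0" using nonlin by (simp add: nonlinearity_assms_def)
  ultimately show ?thesis
  proof eventually_elim
    case (elim x)
    have "f x s \<le> f x t" if "s \<le> t" for s t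
      by (rule DERIV_nonneg_imp_nondecreasing[OF that]) (use C2_fun_DERIV(1)[OF elim(1)] elim(2) in blast)
    then show ?case using elim by blast
  qed
qed

text \<open>A weak gradient of the state with which the weak equation holds, fixed once for each
  right-hand side; \<open>state_props\<close> shows that one exists.\<close>

definition grad :: "(real^'n \<Rightarrow> real) \<Rightarrow> real^'n \<Rightarrow> real^'n" where
  "grad w = (SOME G. H10 \<Omega> (y w) G \<and> (\<forall>z Z. H10 \<Omega> z Z \<longrightarrow>
      bil G Z + L2_inner \<Omega> (\<lambda>x. f x (y w x)) z = L2_inner \<Omega> w z))"

lemma state_props:
  assumes w: "w \<in> L2 \<Omega>"
  shows "H10 \<Omega> (y w) (grad w)" and "y w \<in> L2 \<Omega>"
    and "H10 \<Omega> z Z \<Longrightarrow> bil (grad w) Z + L2_inner \<Omega> (\<lambda>x. f x (y w x)) z = L2_inner \<Omega> w z"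
    and "\<exists>M>0. AE x in lebesgue_on \<Omega>. \<bar>y w x\<bar> \<le> M"
proof -
  have ws: "weak_solution \<Omega> a f w (y w)" using state w by (simp add: state_map_def)
  then have "\<exists>G. H10 \<Omega> (y w) G \<and> (\<forall>z Z. H10 \<Omega> z Z \<longrightarrow>
      bil G Z + L2_inner \<Omega> (\<lambda>x. f x (y w x)) z = L2_inner \<Omega> w z)"
    by (auto simp: weak_solution_def bil_def L2_inner_def)
  then have g: "H10 \<Omega> (y w) (grad w) \<and> (\<forall>z Z. H10 \<Omega> z Z \<longrightarrow>
      bil (grad w) Z + L2_inner \<Omega> (\<lambda>x. f x (y w x)) z = L2_inner \<Omega> w z)"
    unfolding grad_def by (rule someI_ex)
  then show "H10 \<Omega> (y w) (grad w)" by blast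
  then show "y w \<in> L2 \<Omega>" by (rule H10_D(1))
  show "H10 \<Omega> z Z \<Longrightarrow> bil (grad w) Z + L2_inner \<Omega> (\<lambda>x. f x (y w x)) z = L2_inner \<Omega> w z"
    using g by blast
  \<comment> \<open>A single state is bounded because it is continuous on the compact closure. This
    bound is not yet uniform in \<open>w\<close>.\<close>
  have "compact (y w ` closure \<Omega>)"
    using ws bounded_dom by (intro compact_continuous_image) (auto simp: weak_solution_def compact_closure)
  then have "bounded (y w ` closure \<Omega>)" by (rule compact_imp_bounded)
  then obtain M where M: "M > 0" "\<And>x. x \<in> closure \<Omega> \<Longrightarrow> \<bar>y w x\<bar> \<le> M" by (auto simp: bounded_pos)
  have "AE x in lebesgue_on \<Omega>. \<bar>y w x\<bar> \<le> M"
  proof (rule AE_I2)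
    fix x assume "x \<in> space (lebesgue_on \<Omega>)"
    then show "\<bar>y w x\<bar> \<le> M" using M(2)[of x] closure_subset[of \<Omega>] by auto
  qed
  with M(1) show "\<exists>M>0. AE x in lebesgue_on \<Omega>. \<bar>y w x\<bar> \<le> M" by blast
qed

text \<open>The nonlinearity is only locally Lipschitz; boundedness of the state is what turns
  \<open>f x 0\<close> in L2 into \<open>f x (y w x)\<close> in L2.\<close>

lemma f_state_L2:
  assumes w: "w \<in> L2 \<Omega>" shows "(\<lambda>x. f x (y w x)) \<in> L2 \<Omega>"
proof -
  obtain M where M: "M > 0" "AE x in lebesgue_on \<Omega>. \<bar>y w x\<bar> \<le> M" using state_props(4)[OF w] by blast
  obtain C where C: "C > 0" "AE x in lebesgue_on \<Omega>. C2_bounds (f x) M C C" using M(1) by (rule f_bounds) blast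
  have f0: "(\<lambda>x. f x 0) \<in> L2 \<Omega>" using nonlin by (simp add: nonlinearity_assms_def)
  show ?thesis
  proof (rule L2_dominated[OF caratheodory_C2_measurable(1)[OF f_cara L2_measurable[OF state_props(2)[OF w]]]])
    show "(\<lambda>x. \<bar>f x 0\<bar> + C * \<bar>y w x\<bar>) \<in> L2 \<Omega>"
      by (intro L2_add L2_scale L2_abs f0 state_props(2) w)
    show "AE x in lebesgue_on \<Omega>. \<bar>f x (y w x)\<bar> \<le> \<bar>\<bar>f x 0\<bar> + C * \<bar>y w x\<bar>\<bar>"
      using M(2) C(2)
    proof eventually_elim
      case (elim x)
      have "\<bar>f x (y w x) - f x 0\<bar> \<le> C * \<bar>y w x - 0\<bar>" using elim M(1) by (metis abs_zero less_imp_le)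
      then show ?case by simp
    qed
  qed
qed

lemma state_diff:
  assumes w: "w \<in> L2 \<Omega>" and w': "w' \<in> L2 \<Omega>"
  shows "H10 \<Omega> (\<lambda>x. y w' x - y w x) (\<lambda>x. grad w' x - grad w x)"
    and "H10 \<Omega> z Z \<Longrightarrow> bil (\<lambda>x. grad w' x - grad w x) Z +
      L2_inner \<Omega> (\<lambda>x. f x (y w' x) - f x (y w x)) z = L2_inner \<Omega> (\<lambda>x. w' x - w x) z"
proof -
  show "H10 \<Omega> (\<lambda>x. y w' x - y w x) (\<lambda>x. grad w' x - grad w x)"
    by (rule H10_diff[OF state_props(1)[OF w'] state_props(1)[OF w]])
  assume z: "H10 \<Omega> z Z"
  have v: "vL2 (grad w)" "vL2 (grad w')" "vL2 Z"
    using H10_D(2)[OF state_props(1)[OF w]] H10_D(2)[OF state_props(1)[OF w']] H10_D(2)[OF z] by simp_all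
  have "bil (\<lambda>x. grad w' x - grad w x) Z = bil (grad w') Z - bil (grad w) Z"
    using bil_linear_left[OF v(2,1,3), of 1 "-1"] by simp
  then show "bil (\<lambda>x. grad w' x - grad w x) Z +
      L2_inner \<Omega> (\<lambda>x. f x (y w' x) - f x (y w x)) z = L2_inner \<Omega> (\<lambda>x. w' x - w x) z"
    using state_props(3)[OF w z] state_props(3)[OF w' z]
    by (simp add: L2.ip_rules f_state_L2 w w' H10_D(1)[OF z])
qed

text \<open>Comparison principle. Where \<open>y w\<close> exceeds \<open>y w'\<close>, monotonicity
  of \<open>f\<close> and the order of the right-hand sides give the zero-order term the sign
  required by the maximum principle.\<close>

lemma state_mono:
  assumes w: "w \<in> L2 \<Omega>" and w': "w' \<in> L2 \<Omega>" and le: "AE x in lebesgue_on \<Omega>. w x \<le> w' x"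
  shows "AE x in lebesgue_on \<Omega>. y w x \<le> y w' x"
proof -
  have "AE x in lebesgue_on \<Omega>. y w x - y w' x \<le> 0"
  proof (rule weak_maximum_principle[OF state_diff(1)[OF w' w]])
    show "(\<lambda>x. (f x (y w x) - f x (y w' x)) - (w x - w' x)) \<in> L2 \<Omega>"
      by (intro L2_diff f_state_L2 w w')
    show "bil (\<lambda>x. grad w x - grad w' x) Z + L2_inner \<Omega> (\<lambda>x. (f x (y w x) - f x (y w' x)) - (w x - w' x)) z = 0"
      if z: "H10 \<Omega> z Z" for z Z
      using state_diff(2)[OF w' w z]
      by (simp add: L2.ip_sub_left[OF L2_diff[OF f_state_L2[OF w] f_state_L2[OF w']] L2_diff[OF w w'] H10_D(1)[OF z]])
    show "AE x in lebesgue_on \<Omega>. 0 < y w x - y w' x \<longrightarrow> 0 \<le> (f x (y w x) - f x (y w' x)) - (w x - w' x)"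
      using f_mono le
    proof eventually_elim
      case (elim x)
      have "f x (y w' x) \<le> f x (y w x)" if "0 < y w x - y w' x" using elim(1) that by simp
      then show ?case using elim(2) by auto
    qed
  qed
  then show ?thesis by eventually_elim simp
qed

text \<open>Coercivity with one factor of the norm cancelled, the form in which energy estimates for
  differences of states and for adjoint states are concluded.\<close>

lemma L2_norm_le_of_coercive:
  obtains \<gamma> where "\<gamma> > 0" "\<And>d D K. H10 \<Omega> d D \<Longrightarrow> bil D D \<le> K * L2_norm \<Omega> d \<Longrightarrow> 0 \<le> K \<Longrightarrow> L2_norm \<Omega> d \<le> K / \<gamma>"
proof -
  obtain \<gamma> where \<gamma>: "\<gamma> > 0" "\<And>u. H10 \<Omega> (fst u) (snd u) \<Longrightarrow> \<gamma> * (h1_norm u)\<^sup>2 \<le> bil (snd u) (snd u)"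
    by (rule bil_coercive) blast
  have "L2_norm \<Omega> d \<le> K / \<gamma>" if d: "H10 \<Omega> d D" and le: "bil D D \<le> K * L2_norm \<Omega> d" and K: "0 \<le> K" for d D K
  proof -
    have n: "L2_norm \<Omega> d \<le> h1_norm (d, D)" "0 \<le> L2_norm \<Omega> d"
      using L2_norm_le_h1_norm(1)[of "(d, D)"] d L2.nrm_nonneg[OF H10_D(1)[OF d]] by simp_all
    have "\<gamma> * (L2_norm \<Omega> d)\<^sup>2 \<le> \<gamma> * (h1_norm (d, D))\<^sup>2"
      using n \<gamma>(1) by (intro mult_left_mono power_mono) auto
    also have "\<dots> \<le> bil D D" using \<gamma>(2)[of "(d, D)"] d by simp
    also note le
    finally have "(\<gamma> * L2_norm \<Omega> d) * L2_norm \<Omega> d \<le> K * L2_norm \<Omega> d" by (simp add: power2_eq_square mult.assoc)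
    then have "\<gamma> * L2_norm \<Omega> d \<le> K"
      using n K by (cases "L2_norm \<Omega> d = 0") (simp_all add: mult_le_cancel_right)
    then show ?thesis using \<gamma>(1) by (simp add: field_simps)
  qed
  with \<gamma>(1) show ?thesis using that by blast
qed

text \<open>The equation for the difference is tested with the difference itself. The contribution
  of \<open>f\<close> is nonnegative and is dropped, so the constant is global and independent of
  \<open>f\<close>.\<close>

lemma state_lipschitz_L2:
  obtains c where "c > 0" "\<And>w w'. w \<in> L2 \<Omega> \<Longrightarrow> w' \<in> L2 \<Omega> \<Longrightarrow>
    L2_dist \<Omega> (y w') (y w) \<le> c * L2_dist \<Omega> w' w"
proof -
  obtain \<gamma> where \<gamma>: "\<gamma> > 0" "\<And>d D K. H10 \<Omega> d D \<Longrightarrow> bil D D \<le> K * L2_norm \<Omega> d \<Longrightarrow> 0 \<le> K \<Longrightarrow> L2_norm \<Omega> d \<le> K / \<gamma>"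
    by (rule L2_norm_le_of_coercive) blast
  have "L2_dist \<Omega> (y w') (y w) \<le> (1 / \<gamma>) * L2_dist \<Omega> w' w" if w: "w \<in> L2 \<Omega>" and w': "w' \<in> L2 \<Omega>" for w w'
  proof -
    note d = state_diff[OF w w']
    have h: "(\<lambda>x. w' x - w x) \<in> L2 \<Omega>" by (rule L2_diff[OF w' w])
    have "0 \<le> L2_inner \<Omega> (\<lambda>x. f x (y w' x) - f x (y w x)) (\<lambda>x. y w' x - y w x)"
      unfolding L2_inner_def
    proof (rule integral_nonneg_AE)
      show "AE x in lebesgue_on \<Omega>. 0 \<le> (f x (y w' x) - f x (y w x)) * (y w' x - y w x)"
        using f_mono
      proof eventually_elim
        case (elim x)
        show ?case
        proof (cases "y w x \<le> y w' x")
          case True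
          then have "f x (y w x) \<le> f x (y w' x)" using elim by blast
          then show ?thesis using True by simp
        next
          case False
          then have "f x (y w' x) \<le> f x (y w x)" using elim by simp
          then show ?thesis using False by (simp add: mult_nonpos_nonpos)
        qed
      qed
    qed
    then have "bil (\<lambda>x. grad w' x - grad w x) (\<lambda>x. grad w' x - grad w x) \<le> L2_inner \<Omega> (\<lambda>x. w' x - w x) (\<lambda>x. y w' x - y w x)"
      using d(2)[OF d(1)] by linarith
    also have "\<dots> \<le> L2_dist \<Omega> w' w * L2_dist \<Omega> (y w') (y w)"
      using L2.cauchy_schwarz[OF h H10_D(1)[OF d(1)]] by linarith
    finally show ?thesis using \<gamma>(2)[OF d(1) _ L2.nrm_nonneg[OF h]] by simp
  qed
  moreover have "1 / \<gamma> > 0" using \<gamma>(1) by simp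
  ultimately show ?thesis using that by blast
qed

text \<open>A sequence \<open>w0 + h n\<close> with \<open>h n\<close> small in \<open>L\<^sup>2\<close> is squeezed between \<open>w0 - H\<close> and \<open>w0 + H\<close>, so
  that the comparison principle replaces an \<open>L\<^sup>\<infinity>\<close> estimate of Stampacchia type.\<close>

lemma state_locally_bounded:
  assumes w0: "w0 \<in> L2 \<Omega>"
  shows "\<exists>r>0. \<exists>M>0. \<forall>w\<in>L2 \<Omega>. L2_dist \<Omega> w w0 < r \<longrightarrow> (AE x in lebesgue_on \<Omega>. \<bar>y w x\<bar> \<le> M)"
proof (rule ccontr)
  assume neg: "\<not> ?thesis"
  \<comment> \<open>The negated claim is used with radius \<open>(1/2) ^ n\<close> and bound
    \<open>Suc n\<close>, the successor because the bound has to be positive.\<close>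
  have "\<forall>n. \<exists>w. w \<in> L2 \<Omega> \<and> L2_dist \<Omega> w w0 < (1/2) ^ n \<and> \<not> (AE x in lebesgue_on \<Omega>. \<bar>y w x\<bar> \<le> real (Suc n))"
  proof
    fix n :: nat
    have "(0::real) < (1/2) ^ n" "0 < real (Suc n)" by simp_all
    then show "\<exists>w. w \<in> L2 \<Omega> \<and> L2_dist \<Omega> w w0 < (1/2) ^ n \<and> \<not> (AE x in lebesgue_on \<Omega>. \<bar>y w x\<bar> \<le> real (Suc n))"
      using neg by blast
  qed
  from choice[OF this] obtain w where w: "\<And>n. w n \<in> L2 \<Omega>" "\<And>n. L2_dist \<Omega> (w n) w0 < (1/2) ^ n"
    "\<And>n. \<not> (AE x in lebesgue_on \<Omega>. \<bar>y (w n) x\<bar> \<le> real (Suc n))" by blast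
  have d: "(\<lambda>x. w n x - w0 x) \<in> L2 \<Omega>" for n by (rule L2_diff[OF w(1) w0])
  \<comment> \<open>Geometric decay of the distances is what makes a common L2 majorant
    available.\<close>
  have "summable (\<lambda>n. (L2_dist \<Omega> (w n) w0)\<^sup>2)"
  proof (rule summable_comparison_test')
    show "summable (\<lambda>n. (1/4::real) ^ n)" by (intro summable_geometric) auto
    fix n
    have "(L2_dist \<Omega> (w n) w0)\<^sup>2 \<le> ((1/2) ^ n)\<^sup>2"
      using w(2)[of n] L2.nrm_nonneg[OF d] by (intro power_mono) auto
    also have "\<dots> = (1/4::real) ^ n" by (simp add: power2_eq_square power_divide flip: power_mult_distrib)
    finally show "norm ((L2_dist \<Omega> (w n) w0)\<^sup>2) \<le> (1/4) ^ n" by simp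
  qed
  from L2_dominating_function[OF d this] obtain H where H: "H \<in> L2 \<Omega>"
    "AE x in lebesgue_on \<Omega>. \<forall>k. \<bar>w k x - w0 x\<bar> \<le> H x" by blast
  have up: "(\<lambda>x. w0 x + H x) \<in> L2 \<Omega>" and lo: "(\<lambda>x. w0 x - H x) \<in> L2 \<Omega>"
    by (rule L2_add[OF w0 H(1)], rule L2_diff[OF w0 H(1)])
  \<comment> \<open>Only the two extremal states have to be bounded, each by its own constant; an
    index beyond both constants contradicts the choice of \<open>w n\<close>.\<close>
  obtain M1 where M1: "AE x in lebesgue_on \<Omega>. \<bar>y (\<lambda>x. w0 x + H x) x\<bar> \<le> M1" using state_props(4)[OF up] by blast
  obtain M2 where M2: "AE x in lebesgue_on \<Omega>. \<bar>y (\<lambda>x. w0 x - H x) x\<bar> \<le> M2" using state_props(4)[OF lo] by blast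
  obtain n where n: "max M1 M2 \<le> real n" using real_arch_simple by blast
  have "AE x in lebesgue_on \<Omega>. w n x \<le> w0 x + H x" using H(2)
  proof eventually_elim
    case (elim x) then have "\<bar>w n x - w0 x\<bar> \<le> H x" by blast
    then show ?case by linarith
  qed
  note a1 = state_mono[OF w(1) up this]
  have "AE x in lebesgue_on \<Omega>. w0 x - H x \<le> w n x" using H(2)
  proof eventually_elim
    case (elim x) then have "\<bar>w n x - w0 x\<bar> \<le> H x" by blast
    then show ?case by linarith
  qed
  note a2 = state_mono[OF lo w(1) this]
  have "AE x in lebesgue_on \<Omega>. \<bar>y (w n) x\<bar> \<le> real (Suc n)"
    using a1 a2 M1 M2 by eventually_elim (use n in auto)
  with w(3) show False by blast
qed

text \<open>Bounding the state difference \<open>d\<close> by a multiple \<open>t * D\<close> of another one: since \<open>f\<close> is Lipschitz on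
  the bounded range of the states, \<open>D = y (w + q) - y w\<close> with \<open>t * q = \<bar>w' - w\<bar> + C * \<bar>d\<bar>\<close> is a supersolution.\<close>

lemma state_lipschitz_sup:
  assumes w0: "w0 \<in> L2 \<Omega>"
  obtains r M K where "r > 0" "M > 0" "K > 0"
    "\<And>w. w \<in> L2 \<Omega> \<Longrightarrow> L2_dist \<Omega> w w0 < r \<Longrightarrow> AE x in lebesgue_on \<Omega>. \<bar>y w x\<bar> \<le> M"
    "\<And>w w'. w \<in> L2 \<Omega> \<Longrightarrow> w' \<in> L2 \<Omega> \<Longrightarrow> L2_dist \<Omega> w w0 < r \<Longrightarrow> L2_dist \<Omega> w' w0 < r \<Longrightarrow>
       AE x in lebesgue_on \<Omega>. \<bar>y w' x - y w x\<bar> \<le> K * L2_dist \<Omega> w' w"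
proof -
  obtain R M where R: "R > 0" "M > 0"
    and bd: "\<And>w. w \<in> L2 \<Omega> \<Longrightarrow> L2_dist \<Omega> w w0 < R \<Longrightarrow> AE x in lebesgue_on \<Omega>. \<bar>y w x\<bar> \<le> M"
    using state_locally_bounded[OF w0] by blast
  obtain C where C: "C > 0" "AE x in lebesgue_on \<Omega>. C2_bounds (f x) M C C" using R(2) by (rule f_bounds) blast
  obtain c where c: "c > 0" "\<And>w w'. w \<in> L2 \<Omega> \<Longrightarrow> w' \<in> L2 \<Omega> \<Longrightarrow>
    L2_dist \<Omega> (y w') (y w) \<le> c * L2_dist \<Omega> w' w" by (rule state_lipschitz_L2) blast
  \<comment> \<open>Half of the radius is reserved for the auxiliary perturbation
    \<open>q\<close>.\<close>
  define r where "r = R / 2"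
  \<comment> \<open>\<open>K1 * N\<close> bounds the norm of
    \<open>\<bar>w' - w\<bar> + C * \<bar>d\<bar>\<close>, by the L2 estimate for
    \<open>d\<close>.\<close>
  define K1 where "K1 = 1 + C * c"
  \<comment> \<open>Equals \<open>2 * M * t / N\<close> for the \<open>t\<close> chosen below: the
    comparison difference is at most \<open>2 * M\<close>.\<close>
  define K where "K = 2 * M * K1 / r"
  have r: "r > 0" using R by (simp add: r_def)
  have K1: "K1 > 0" using C c by (simp add: K1_def add_pos_pos)
  have K: "K > 0" using r K1 R by (simp add: K_def)
  have one: "AE x in lebesgue_on \<Omega>. y w' x - y w x \<le> K * L2_dist \<Omega> w' w"
    if w: "w \<in> L2 \<Omega>" and w': "w' \<in> L2 \<Omega>" and wr: "L2_dist \<Omega> w w0 < r" and w'r: "L2_dist \<Omega> w' w0 < r" for w w'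
  proof -
    define N where "N = L2_dist \<Omega> w' w"
    have h: "(\<lambda>x. w' x - w x) \<in> L2 \<Omega>" by (rule L2_diff[OF w' w])
    have N0: "N \<ge> 0" using L2.nrm_nonneg[OF h] by (simp add: N_def)
    define d where "d x = y w' x - y w x" for x
    have dL: "d \<in> L2 \<Omega>" unfolding d_def[abs_def] by (rule L2_diff[OF state_props(2)[OF w'] state_props(2)[OF w]])
    have dN: "L2_norm \<Omega> d \<le> c * N" using c(2)[OF w w'] by (simp add: d_def[abs_def] N_def)
    show ?thesis
    proof (cases "N = 0")
      case True
      then have "L2_norm \<Omega> d = 0" using dN L2.nrm_nonneg[OF dL] by simp
      from L2_norm_eq_0_imp_AE[OF dL this] show ?thesis
        by eventually_elim (use True in \<open>simp add: d_def flip: N_def\<close>)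
    next
      case False
      with N0 have N: "N > 0" by simp
      \<comment> \<open>Chosen so that \<open>q\<close> has norm at most \<open>r\<close>, which
        leaves \<open>w + q\<close> in the ball where states are bounded by \<open>M\<close>. Being
        proportional to \<open>N\<close>, it yields the Lipschitz bound; the case
        \<open>N = 0\<close> is separate because \<open>t\<close> divides.\<close>
      define t where "t = K1 * N / r"
      have t: "t > 0" using K1 N r by (simp add: t_def)
      define q where "q x = (1 / t) * (\<bar>w' x - w x\<bar> + C * \<bar>d x\<bar>)" for x
      have kL: "(\<lambda>x. \<bar>w' x - w x\<bar> + C * \<bar>d x\<bar>) \<in> L2 \<Omega>" by (intro L2_add L2_abs L2_scale h dL)
      have qL: "q \<in> L2 \<Omega>" unfolding q_def[abs_def] by (rule L2_scale[OF kL])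
      have "L2_norm \<Omega> (\<lambda>x. \<bar>w' x - w x\<bar> + C * \<bar>d x\<bar>) \<le> L2_norm \<Omega> (\<lambda>x. \<bar>w' x - w x\<bar>) + L2_norm \<Omega> (\<lambda>x. C * \<bar>d x\<bar>)"
        by (rule L2.nrm_add_le[OF L2_abs[OF h] L2_scale[OF L2_abs[OF dL]]])
      also have "L2_norm \<Omega> (\<lambda>x. C * \<bar>d x\<bar>) = C * L2_norm \<Omega> d"
        using C(1) L2.nrm_sc[OF L2_abs[OF dL], of C] by (simp add: L2_norm_def L2_inner_def)
      also have "L2_norm \<Omega> (\<lambda>x. \<bar>w' x - w x\<bar>) = N" by (simp add: N_def L2_norm_def L2_inner_def)
      finally have "L2_norm \<Omega> (\<lambda>x. \<bar>w' x - w x\<bar> + C * \<bar>d x\<bar>) \<le> N + C * (c * N)"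
        using mult_left_mono[OF dN, of C] C(1) by linarith
      also have "\<dots> = K1 * N" by (simp add: K1_def algebra_simps)
      finally have kn: "L2_norm \<Omega> (\<lambda>x. \<bar>w' x - w x\<bar> + C * \<bar>d x\<bar>) \<le> K1 * N" .
      have "L2_norm \<Omega> q = (1 / t) * L2_norm \<Omega> (\<lambda>x. \<bar>w' x - w x\<bar> + C * \<bar>d x\<bar>)"
        unfolding q_def[abs_def] using L2.nrm_sc[OF kL, of "1 / t"] t by simp
      also have "\<dots> \<le> (1 / t) * (K1 * N)" using kn t by (intro mult_left_mono) auto
      also have "\<dots> = r" using K1 N r by (simp add: t_def)
      finally have qr: "L2_norm \<Omega> q \<le> r" .
      define v where "v x = w x + q x" for x
      have v: "v \<in> L2 \<Omega>" unfolding v_def[abs_def] by (rule L2_add[OF w qL])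
      have "L2_dist \<Omega> v w0 = L2_norm \<Omega> (\<lambda>x. (w x - w0 x) + q x)"
        by (simp add: v_def algebra_simps)
      also have "\<dots> \<le> L2_dist \<Omega> w w0 + L2_norm \<Omega> q" by (rule L2.nrm_add_le[OF L2_diff[OF w w0] qL])
      also have "\<dots> < R" using wr qr by (simp add: r_def)
      finally have vR: "L2_dist \<Omega> v w0 < R" .
      have R2: "L2_dist \<Omega> w w0 < R" "L2_dist \<Omega> w' w0 < R" using wr w'r R by (simp_all add: r_def)
      note bds = bd[OF w R2(1)] bd[OF w' R2(2)] bd[OF v vR]
      have q0: "0 \<le> q x" for x unfolding q_def using t C by simp
      have "AE x in lebesgue_on \<Omega>. w x \<le> v x" using q0 by (simp add: v_def)
      note mono = state_mono[OF w v this]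
      note dw = state_diff[OF w w'] and dv = state_diff[OF w v]
      \<comment> \<open>The zero-order term in the equation satisfied by \<open>d\<close> minus
        \<open>t\<close> times the comparison difference.\<close>
      define \<rho> where "\<rho> x = ((f x (y w' x) - f x (y w x)) - (w' x - w x)) - t * ((f x (y v x) - f x (y w x)) - (v x - w x))" for x
      have L: "(\<lambda>x. f x (y w' x) - f x (y w x)) \<in> L2 \<Omega>" "(\<lambda>x. f x (y v x) - f x (y w x)) \<in> L2 \<Omega>" "(\<lambda>x. v x - w x) \<in> L2 \<Omega>"
        by (intro L2_diff f_state_L2 w w' v)+
      have H: "H10 \<Omega> (\<lambda>x. 1 * (y w' x - y w x) + (- t) * (y v x - y w x))
          (\<lambda>x. 1 *\<^sub>R (grad w' x - grad w x) + (- t) *\<^sub>R (grad v x - grad w x))"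
        by (rule H10_linear[OF dw(1) dv(1)])
      have "AE x in lebesgue_on \<Omega>. 1 * (y w' x - y w x) + (- t) * (y v x - y w x) \<le> 0"
      proof (rule weak_maximum_principle[OF H])
        show "\<rho> \<in> L2 \<Omega>" unfolding \<rho>_def[abs_def] by (intro L2_diff L2_scale f_state_L2 w w' v)
        show "bil (\<lambda>x. 1 *\<^sub>R (grad w' x - grad w x) + (- t) *\<^sub>R (grad v x - grad w x)) Z + L2_inner \<Omega> \<rho> z = 0"
          if z: "H10 \<Omega> z Z" for z Z
        proof -
          have vL: "vL2 (\<lambda>x. grad w' x - grad w x)" "vL2 (\<lambda>x. grad v x - grad w x)" "vL2 Z"
            using H10_D(2)[OF dw(1)] H10_D(2)[OF dv(1)] H10_D(2)[OF z] by simp_all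
          have "L2_inner \<Omega> \<rho> z = (L2_inner \<Omega> (\<lambda>x. f x (y w' x) - f x (y w x)) z - L2_inner \<Omega> (\<lambda>x. w' x - w x) z)
             - t * (L2_inner \<Omega> (\<lambda>x. f x (y v x) - f x (y w x)) z - L2_inner \<Omega> (\<lambda>x. v x - w x) z)"
            unfolding \<rho>_def[abs_def]
            by (simp only: L2.ip_sub_left[OF L2_diff[OF L(1) h] L2_scale[OF L2_diff[OF L(2,3)]] H10_D(1)[OF z]]
                L2.ip_sub_left[OF L(1) h H10_D(1)[OF z]] L2.ip_sc_left[OF L2_diff[OF L(2,3)] H10_D(1)[OF z]]
                L2.ip_sub_left[OF L(2,3) H10_D(1)[OF z]])
          moreover have "L2_inner \<Omega> (\<lambda>x. f x (y w' x) - f x (y w x)) z - L2_inner \<Omega> (\<lambda>x. w' x - w x) z = - bil (\<lambda>x. grad w' x - grad w x) Z"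
            using dw(2)[OF z] by linarith
          moreover have "L2_inner \<Omega> (\<lambda>x. f x (y v x) - f x (y w x)) z - L2_inner \<Omega> (\<lambda>x. v x - w x) z = - bil (\<lambda>x. grad v x - grad w x) Z"
            using dv(2)[OF z] by linarith
          ultimately show ?thesis unfolding bil_linear_left[OF vL] by simp
        qed
        \<comment> \<open>On this set the first difference of \<open>f\<close> is nonnegative, and
          \<open>t\<close> times the second is at most \<open>C * d\<close>, since \<open>t\<close>
          times the comparison difference lies below \<open>d\<close>. The term
          \<open>C * \<bar>d\<bar>\<close> built into \<open>q\<close> pays for exactly
          that.\<close>
        show "AE x in lebesgue_on \<Omega>. 0 < 1 * (y w' x - y w x) + (- t) * (y v x - y w x) \<longrightarrow> 0 \<le> \<rho> x"
          using C(2) bds mono f_mono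
        proof eventually_elim
          case (elim x)
          show ?case
          proof
            assume "0 < 1 * (y w' x - y w x) + (- t) * (y v x - y w x)"
            then have p: "t * (y v x - y w x) < d x" by (simp add: d_def)
            have D0: "0 \<le> y v x - y w x" using elim by simp
            then have "0 \<le> t * (y v x - y w x)" using t by simp
            then have d0: "0 < d x" using p by linarith
            then have f1: "f x (y w x) \<le> f x (y w' x)" using elim(6) by (simp add: d_def)
            have "\<bar>f x (y v x) - f x (y w x)\<bar> \<le> C * \<bar>y v x - y w x\<bar>" using elim(1,2,4) by blast
            then have "f x (y v x) - f x (y w x) \<le> C * (y v x - y w x)" using D0 by linarith
            then have "t * (f x (y v x) - f x (y w x)) \<le> t * (C * (y v x - y w x))" using t by (intro mult_left_mono) auto
            moreover have "t * (C * (y v x - y w x)) \<le> C * d x"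
              using mult_left_mono[OF less_imp_le[OF p], of C] C(1) by (simp add: mult.left_commute)
            moreover have "t * (v x - w x) = \<bar>w' x - w x\<bar> + C * d x"
              using t d0 by (simp add: v_def q_def)
            ultimately show "0 \<le> \<rho> x" unfolding \<rho>_def right_diff_distrib[of t "f x (y v x) - f x (y w x)" "v x - w x"]
              using f1 by linarith
          qed
        qed
      qed
      then show ?thesis using bds
      proof eventually_elim
        case (elim x)
        then have "y w' x - y w x \<le> t * (y v x - y w x)" by simp
        also have "\<dots> \<le> t * (2 * M)" using elim t by (intro mult_left_mono) linarith+
        also have "\<dots> = K * N" using r by (simp add: t_def K_def)
        finally show ?case by (simp add: N_def)
      qed
    qed
  qed
  have "AE x in lebesgue_on \<Omega>. \<bar>y w' x - y w x\<bar> \<le> K * L2_dist \<Omega> w' w"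
    if w: "w \<in> L2 \<Omega>" and w': "w' \<in> L2 \<Omega>" and wr: "L2_dist \<Omega> w w0 < r" "L2_dist \<Omega> w' w0 < r" for w w'
    using one[OF w w' wr] one[OF w' w wr(2,1)]
  proof eventually_elim
    case (elim x)
    then show ?case using L2.nrm_sub_commute[OF w w'] by (simp add: abs_le_iff)
  qed
  moreover have "AE x in lebesgue_on \<Omega>. \<bar>y w x\<bar> \<le> M" if "w \<in> L2 \<Omega>" "L2_dist \<Omega> w w0 < r" for w
    using bd[OF that(1)] that(2) R by (simp add: r_def)
  ultimately show ?thesis using that r K R(2) by blast
qed

end

section \<open>Adjoint states\<close>

context state_equation
begin

lemma linearization_coeff:
  assumes w: "w \<in> L2 \<Omega>"
  obtains C where "C > 0" "(\<lambda>x. deriv (f x) (y w x)) \<in> borel_measurable (lebesgue_on \<Omega>)"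
    "AE x in lebesgue_on \<Omega>. 0 \<le> deriv (f x) (y w x)" "AE x in lebesgue_on \<Omega>. \<bar>deriv (f x) (y w x)\<bar> \<le> C"
proof -
  obtain M where M: "M > 0" "AE x in lebesgue_on \<Omega>. \<bar>y w x\<bar> \<le> M" using state_props(4)[OF w] by blast
  obtain C where C: "C > 0" "AE x in lebesgue_on \<Omega>. C2_bounds (f x) M C C" using M(1) by (rule f_bounds) blast
  have 1: "(\<lambda>x. deriv (f x) (y w x)) \<in> borel_measurable (lebesgue_on \<Omega>)"
    by (rule caratheodory_C2_measurable(2)[OF f_cara L2_measurable[OF state_props(2)[OF w]]])
  have 2: "AE x in lebesgue_on \<Omega>. 0 \<le> deriv (f x) (y w x)" using f_mono by eventually_elim blast
  have 3: "AE x in lebesgue_on \<Omega>. \<bar>deriv (f x) (y w x)\<bar> \<le> C" using C(2) M(2) by eventually_elim blast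
  show ?thesis using that[OF C(1) 1 2 3] .
qed

lemma linearization_mult:
  assumes w: "w \<in> L2 \<Omega>" and z: "z \<in> L2 \<Omega>"
  shows "(\<lambda>x. deriv (f x) (y w x) * z x) \<in> L2 \<Omega>"
    and "0 \<le> L2_inner \<Omega> (\<lambda>x. deriv (f x) (y w x) * z x) z"
proof -
  obtain C where C: "C > 0" "(\<lambda>x. deriv (f x) (y w x)) \<in> borel_measurable (lebesgue_on \<Omega>)"
    "AE x in lebesgue_on \<Omega>. 0 \<le> deriv (f x) (y w x)" "AE x in lebesgue_on \<Omega>. \<bar>deriv (f x) (y w x)\<bar> \<le> C"
    using w by (rule linearization_coeff) blast
  show "(\<lambda>x. deriv (f x) (y w x) * z x) \<in> L2 \<Omega>" by (rule L2_mult_bounded(1)[OF C(2) z C(4)])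
  show "0 \<le> L2_inner \<Omega> (\<lambda>x. deriv (f x) (y w x) * z x) z"
    unfolding L2_inner_def
  proof (rule integral_nonneg_AE)
    show "AE x in lebesgue_on \<Omega>. 0 \<le> deriv (f x) (y w x) * z x * z x"
      using C(3) by eventually_elim (simp add: mult.assoc)
  qed
qed

text \<open>The zero-order coefficient \<open>deriv f\<close> is nonnegative and bounded along the
  state. It therefore leaves the coercivity constant of \<open>bil\<close> unchanged and only
  enlarges the continuity constant.\<close>

lemma adjoint_state_exists:
  assumes w: "w \<in> L2 \<Omega>" and \<psi>: "\<psi> \<in> L2 \<Omega>"
  shows "\<exists>p P. H10 \<Omega> p P \<and> (\<forall>z Z. H10 \<Omega> z Z \<longrightarrow>
    bil Z P + L2_inner \<Omega> (\<lambda>x. deriv (f x) (y w x) * p x) z = L2_inner \<Omega> \<psi> z)"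
proof -
  obtain Cf where Cf: "Cf > 0" "(\<lambda>x. deriv (f x) (y w x)) \<in> borel_measurable (lebesgue_on \<Omega>)"
    "AE x in lebesgue_on \<Omega>. 0 \<le> deriv (f x) (y w x)" "AE x in lebesgue_on \<Omega>. \<bar>deriv (f x) (y w x)\<bar> \<le> Cf"
    using w by (rule linearization_coeff) blast
  obtain CA where CA: "CA > 0" "\<And>u v. H10 \<Omega> (fst u) (snd u) \<Longrightarrow> H10 \<Omega> (fst v) (snd v) \<Longrightarrow>
    \<bar>bil (snd u) (snd v)\<bar> \<le> CA * h1_norm u * h1_norm v" by (rule bil_bounded) blast
  obtain \<gamma> where \<gamma>: "\<gamma> > 0" "\<And>u. H10 \<Omega> (fst u) (snd u) \<Longrightarrow> \<gamma> * (h1_norm u)\<^sup>2 \<le> bil (snd u) (snd u)"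
    by (rule bil_coercive) blast
  define c where "c x = deriv (f x) (y w x)" for x
  \<comment> \<open>The arguments of \<open>bil\<close> are exchanged: the unknown of the adjoint
    equation is on the right.\<close>
  define b where "b u v = bil (snd v) (snd u) + L2_inner \<Omega> (\<lambda>x. c x * fst u x) (fst v)"
    for u v :: "(real^'n \<Rightarrow> real) \<times> (real^'n \<Rightarrow> real^'n)"
  have cL: "(\<lambda>x. c x * z x) \<in> L2 \<Omega>" if "z \<in> L2 \<Omega>" for z
    unfolding c_def by (rule linearization_mult(1)[OF w that])
  have "\<exists>u\<in>{u. H10 \<Omega> (fst u) (snd u)}. \<forall>v\<in>{u. H10 \<Omega> (fst u) (snd u)}. b u v = L2_inner \<Omega> \<psi> (fst v)"
  proof (rule H10.lax_milgram[where C = "CA + Cf" and \<gamma> = \<gamma> and C' = "L2_norm \<Omega> \<psi>"])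
    show "CA + Cf > 0" "\<gamma> > 0" using CA Cf \<gamma> by simp_all
  next
    fix u v :: "(real^'n \<Rightarrow> real) \<times> (real^'n \<Rightarrow> real^'n)"
    assume "u \<in> {u. H10 \<Omega> (fst u) (snd u)}" "v \<in> {u. H10 \<Omega> (fst u) (snd u)}"
    then have u: "H10 \<Omega> (fst u) (snd u)" and v: "H10 \<Omega> (fst v) (snd v)" by simp_all
    show "L2_inner \<Omega> \<psi> (fst (\<lambda>x. fst u x + fst v x, \<lambda>x. snd u x + snd v x)) = L2_inner \<Omega> \<psi> (fst u) + L2_inner \<Omega> \<psi> (fst v)"
      by (simp add: L2.ip_add_right H10_D(1)[OF u] H10_D(1)[OF v] \<psi>)
    have n: "L2_norm \<Omega> (fst u) \<le> h1_norm u" "L2_norm \<Omega> (fst v) \<le> h1_norm v" "0 \<le> h1_norm u" "0 \<le> h1_norm v"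
      using L2_norm_le_h1_norm(1)[OF u] L2_norm_le_h1_norm(1)[OF v] H10.nrm_nonneg u v by simp_all
    have "\<bar>L2_inner \<Omega> (\<lambda>x. c x * fst u x) (fst v)\<bar> \<le> L2_norm \<Omega> (\<lambda>x. c x * fst u x) * L2_norm \<Omega> (fst v)"
      by (rule L2.cauchy_schwarz[OF cL[OF H10_D(1)[OF u]] H10_D(1)[OF v]])
    also have "\<dots> \<le> (Cf * h1_norm u) * h1_norm v"
    proof (rule mult_mono)
      have "L2_norm \<Omega> (\<lambda>x. c x * fst u x) \<le> Cf * L2_norm \<Omega> (fst u)"
        unfolding c_def by (rule L2_mult_bounded(2)[OF Cf(2) H10_D(1)[OF u] Cf(4)]) (use Cf in simp)
      also have "\<dots> \<le> Cf * h1_norm u" using n Cf by simp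
      finally show "L2_norm \<Omega> (\<lambda>x. c x * fst u x) \<le> Cf * h1_norm u" .
    qed (use n Cf L2.nrm_nonneg[OF H10_D(1)[OF v]] in simp_all)
    finally have "\<bar>L2_inner \<Omega> (\<lambda>x. c x * fst u x) (fst v)\<bar> \<le> Cf * h1_norm u * h1_norm v" .
    moreover have "\<bar>bil (snd v) (snd u)\<bar> \<le> CA * h1_norm v * h1_norm u" by (rule CA(2)[OF v u])
    then have "\<bar>bil (snd v) (snd u)\<bar> \<le> CA * h1_norm u * h1_norm v" by (simp add: mult_ac)
    ultimately show "\<bar>b u v\<bar> \<le> (CA + Cf) * h1_norm u * h1_norm v"
      unfolding b_def distrib_right by linarith
  next
    fix u :: "(real^'n \<Rightarrow> real) \<times> (real^'n \<Rightarrow> real^'n)" and s :: real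
    assume "u \<in> {u. H10 \<Omega> (fst u) (snd u)}"
    then have u: "H10 \<Omega> (fst u) (snd u)" by simp
    show "L2_inner \<Omega> \<psi> (fst (\<lambda>x. s * fst u x, \<lambda>x. s *\<^sub>R snd u x)) = s * L2_inner \<Omega> \<psi> (fst u)"
      by (simp add: L2.ip_sc_right H10_D(1)[OF u] \<psi>)
    have "\<bar>L2_inner \<Omega> \<psi> (fst u)\<bar> \<le> L2_norm \<Omega> \<psi> * L2_norm \<Omega> (fst u)" by (rule L2.cauchy_schwarz[OF \<psi> H10_D(1)[OF u]])
    also have "\<dots> \<le> L2_norm \<Omega> \<psi> * h1_norm u"
      by (intro mult_left_mono L2_norm_le_h1_norm(1)[OF u] L2.nrm_nonneg[OF \<psi>])
    finally show "\<bar>L2_inner \<Omega> \<psi> (fst u)\<bar> \<le> L2_norm \<Omega> \<psi> * h1_norm u" .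
    have "0 \<le> L2_inner \<Omega> (\<lambda>x. c x * fst u x) (fst u)"
      unfolding c_def by (rule linearization_mult(2)[OF w H10_D(1)[OF u]])
    then show "\<gamma> * (h1_norm u)\<^sup>2 \<le> b u u" unfolding b_def using \<gamma>(2)[OF u] by linarith
  next
    fix u v q :: "(real^'n \<Rightarrow> real) \<times> (real^'n \<Rightarrow> real^'n)"
    assume "u \<in> {u. H10 \<Omega> (fst u) (snd u)}" "v \<in> {u. H10 \<Omega> (fst u) (snd u)}" "q \<in> {u. H10 \<Omega> (fst u) (snd u)}"
    then have u: "H10 \<Omega> (fst u) (snd u)" and v: "H10 \<Omega> (fst v) (snd v)" and q: "H10 \<Omega> (fst q) (snd q)" by simp_all
    have vL: "vL2 (snd u)" "vL2 (snd v)" "vL2 (snd q)"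
      using H10_D(2)[OF u] H10_D(2)[OF v] H10_D(2)[OF q] by simp_all
    show "b q (\<lambda>x. fst u x + fst v x, \<lambda>x. snd u x + snd v x) = b q u + b q v"
      using bil_linear_left[OF vL, of 1 1]
      by (simp add: b_def L2.ip_add_right[OF H10_D(1)[OF u] H10_D(1)[OF v] cL[OF H10_D(1)[OF q]]])
    have e: "(\<lambda>x. c x * (fst u x - fst v x)) = (\<lambda>x. c x * fst u x - c x * fst v x)" by (simp add: right_diff_distrib)
    show "b (\<lambda>x. fst u x - fst v x, \<lambda>x. snd u x - snd v x) q = b u q - b v q"
      using bil_linear_right[OF vL(3,1,2), of 1 "-1"]
      by (simp add: b_def e L2.ip_sub_left[OF cL[OF H10_D(1)[OF u]] cL[OF H10_D(1)[OF v]] H10_D(1)[OF q]])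
  next
    fix u q :: "(real^'n \<Rightarrow> real) \<times> (real^'n \<Rightarrow> real^'n)" and s :: real
    assume "u \<in> {u. H10 \<Omega> (fst u) (snd u)}" "q \<in> {u. H10 \<Omega> (fst u) (snd u)}"
    then have u: "H10 \<Omega> (fst u) (snd u)" and q: "H10 \<Omega> (fst q) (snd q)" by simp_all
    have vL: "vL2 (snd u)" "vL2 (snd q)" using H10_D(2)[OF u] H10_D(2)[OF q] by simp_all
    show "b q (\<lambda>x. s * fst u x, \<lambda>x. s *\<^sub>R snd u x) = s * b q u"
      using bil_linear_left[OF vL(1,1,2), of s 0]
      by (simp add: b_def L2.ip_sc_right[OF H10_D(1)[OF u] cL[OF H10_D(1)[OF q]]] distrib_left)
  qed
  then obtain u where u: "H10 \<Omega> (fst u) (snd u)" "\<And>v. H10 \<Omega> (fst v) (snd v) \<Longrightarrow> b u v = L2_inner \<Omega> \<psi> (fst v)" by blast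
  show ?thesis
  proof (intro exI conjI allI impI)
    show "H10 \<Omega> (fst u) (snd u)" by (rule u)
    fix z Z assume "H10 \<Omega> z Z"
    then show "bil Z (snd u) + L2_inner \<Omega> (\<lambda>x. deriv (f x) (y w x) * fst u x) z = L2_inner \<Omega> \<psi> z"
      using u(2)[of "(z, Z)"] by (simp add: b_def c_def)
  qed
qed

text \<open>The gradient of the reduced functional at \<open>w\<close> is the adjoint state \<open>P w\<close>.\<close>

lemma reduced_functional_expansion:
  assumes w0: "w0 \<in> L2 \<Omega>" and l: "integrand_assms \<Omega> l"
  obtains r C P where "r > 0" "C > 0"
    "\<And>w. w \<in> L2 \<Omega> \<Longrightarrow> L2_dist \<Omega> w w0 < r \<Longrightarrow> P w \<in> L2 \<Omega>"
    "\<And>w w'. w \<in> L2 \<Omega> \<Longrightarrow> w' \<in> L2 \<Omega> \<Longrightarrow> L2_dist \<Omega> w w0 < r \<Longrightarrow> L2_dist \<Omega> w' w0 < r \<Longrightarrow>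
      \<bar>(LINT x|lebesgue_on \<Omega>. l x (y w' x)) - (LINT x|lebesgue_on \<Omega>. l x (y w x)) - L2_inner \<Omega> (P w) (\<lambda>x. w' x - w x)\<bar>
        \<le> C * (L2_dist \<Omega> w' w)\<^sup>2"
    "\<And>w w'. w \<in> L2 \<Omega> \<Longrightarrow> w' \<in> L2 \<Omega> \<Longrightarrow> L2_dist \<Omega> w w0 < r \<Longrightarrow> L2_dist \<Omega> w' w0 < r \<Longrightarrow>
      L2_dist \<Omega> (P w') (P w) \<le> C * L2_dist \<Omega> w' w"
proof -
  obtain r M K where r: "r > 0" "M > 0" "K > 0"
    and bd: "\<And>w. w \<in> L2 \<Omega> \<Longrightarrow> L2_dist \<Omega> w w0 < r \<Longrightarrow> AE x in lebesgue_on \<Omega>. \<bar>y w x\<bar> \<le> M"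
    and sup: "\<And>w w'. w \<in> L2 \<Omega> \<Longrightarrow> w' \<in> L2 \<Omega> \<Longrightarrow> L2_dist \<Omega> w w0 < r \<Longrightarrow> L2_dist \<Omega> w' w0 < r \<Longrightarrow>
       AE x in lebesgue_on \<Omega>. \<bar>y w' x - y w x\<bar> \<le> K * L2_dist \<Omega> w' w"
    using w0 by (rule state_lipschitz_sup) blast
  obtain Cf where Cf: "Cf > 0" "AE x in lebesgue_on \<Omega>. C2_bounds (f x) M Cf Cf" using r(2) by (rule f_bounds) blast
  obtain Cl \<psi> where Cl: "Cl > 0" "\<psi> \<in> L2 \<Omega>" "AE x in lebesgue_on \<Omega>. C2_bounds (l x) M (\<psi> x) Cl"
    using l r(2) by (rule integrand_bounds) blast
  obtain c where c: "c > 0" "\<And>w w'. w \<in> L2 \<Omega> \<Longrightarrow> w' \<in> L2 \<Omega> \<Longrightarrow>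
    L2_dist \<Omega> (y w') (y w) \<le> c * L2_dist \<Omega> w' w" by (rule state_lipschitz_L2) blast
  obtain \<gamma> where \<gamma>: "\<gamma> > 0" "\<And>d D K. H10 \<Omega> d D \<Longrightarrow> bil D D \<le> K * L2_norm \<Omega> d \<Longrightarrow> 0 \<le> K \<Longrightarrow> L2_norm \<Omega> d \<le> K / \<gamma>"
    by (rule L2_norm_le_of_coercive) blast
  have lc: "caratheodory_C2 \<Omega> l" and l0: "integrable (lebesgue_on \<Omega>) (\<lambda>x. l x 0)"
    using l by (simp_all add: integrand_assms_def)
  define dl where "dl w x = deriv (l x) (y w x)" for w x
  define cf where "cf w x = deriv (f x) (y w x)" for w x
  have dlm: "dl w \<in> borel_measurable (lebesgue_on \<Omega>)" if "w \<in> L2 \<Omega>" for w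
    unfolding dl_def[abs_def] by (rule caratheodory_C2_measurable(2)[OF lc L2_measurable[OF state_props(2)[OF that]]])
  have dlb: "AE x in lebesgue_on \<Omega>. \<bar>dl w x\<bar> \<le> \<bar>\<psi> x\<bar>"
    if "w \<in> L2 \<Omega>" "L2_dist \<Omega> w w0 < r" for w
    using bd[OF that] Cl(3)
  proof eventually_elim
    case (elim x)
    then have "\<bar>deriv (l x) (y w x)\<bar> \<le> \<psi> x" by blast
    then show ?case by (simp add: dl_def)
  qed
  have dlL: "dl w \<in> L2 \<Omega>" if "w \<in> L2 \<Omega>" "L2_dist \<Omega> w w0 < r" for w
    by (rule L2_dominated[OF dlm[OF that(1)] Cl(2) dlb[OF that]])
  have lint: "integrable (lebesgue_on \<Omega>) (\<lambda>x. l x (y w x))"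
    if w: "w \<in> L2 \<Omega>" and wr: "L2_dist \<Omega> w w0 < r" for w
  proof (rule Bochner_Integration.integrable_bound)
    show "integrable (lebesgue_on \<Omega>) (\<lambda>x. \<bar>l x 0\<bar> + \<bar>\<psi> x * y w x\<bar>)"
      by (intro Bochner_Integration.integrable_add integrable_abs l0 L2_integrable_mult Cl state_props(2) w)
    show "(\<lambda>x. l x (y w x)) \<in> borel_measurable (lebesgue_on \<Omega>)"
      by (rule caratheodory_C2_measurable(1)[OF lc L2_measurable[OF state_props(2)[OF w]]])
    show "AE x in lebesgue_on \<Omega>. norm (l x (y w x)) \<le> norm (\<bar>l x 0\<bar> + \<bar>\<psi> x * y w x\<bar>)"
      using bd[OF w wr] Cl(3)
    proof eventually_elim
      case (elim x)
      have "\<bar>(0::real)\<bar> \<le> M" using r(2) by simp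
      with elim have "\<bar>l x (y w x) - l x 0\<bar> \<le> \<psi> x * \<bar>y w x - 0\<bar>" by blast
      also have "\<dots> \<le> \<bar>\<psi> x * y w x\<bar>" by (simp add: abs_mult mult_right_mono)
      finally show ?case by simp
    qed
  qed
  \<comment> \<open>An adjoint state with its gradient is chosen for every \<open>w\<close> in the
    ball; off the ball the choice is arbitrary.\<close>
  have "\<forall>w. \<exists>pP. w \<in> L2 \<Omega> \<and> L2_dist \<Omega> w w0 < r \<longrightarrow> H10 \<Omega> (fst pP) (snd pP) \<and>
      (\<forall>z Z. H10 \<Omega> z Z \<longrightarrow> bil Z (snd pP) + L2_inner \<Omega> (\<lambda>x. cf w x * fst pP x) z = L2_inner \<Omega> (dl w) z)"
  proof
    fix w
    show "\<exists>pP. w \<in> L2 \<Omega> \<and> L2_dist \<Omega> w w0 < r \<longrightarrow> H10 \<Omega> (fst pP) (snd pP) \<and>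
      (\<forall>z Z. H10 \<Omega> z Z \<longrightarrow> bil Z (snd pP) + L2_inner \<Omega> (\<lambda>x. cf w x * fst pP x) z = L2_inner \<Omega> (dl w) z)"
    proof (cases "w \<in> L2 \<Omega> \<and> L2_dist \<Omega> w w0 < r")
      case True
      from adjoint_state_exists[OF conjunct1[OF True] dlL[OF conjunct1[OF True] conjunct2[OF True]]]
      show ?thesis unfolding cf_def by auto
    qed blast
  qed
  from choice[OF this] obtain pP where pP: "\<And>w. w \<in> L2 \<Omega> \<Longrightarrow> L2_dist \<Omega> w w0 < r \<Longrightarrow> H10 \<Omega> (fst (pP w)) (snd (pP w))"
    "\<And>w z Z. w \<in> L2 \<Omega> \<Longrightarrow> L2_dist \<Omega> w w0 < r \<Longrightarrow> H10 \<Omega> z Z \<Longrightarrow>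
      bil Z (snd (pP w)) + L2_inner \<Omega> (\<lambda>x. cf w x * fst (pP w) x) z = L2_inner \<Omega> (dl w) z" by blast
  define p where "p w = fst (pP w)" for w
  define P where "P w = snd (pP w)" for w
  note pP = pP[folded p_def P_def]
  note pL = H10_D(1)[OF pP(1)]
  have cfL: "(\<lambda>x. cf w x * z x) \<in> L2 \<Omega>" "0 \<le> L2_inner \<Omega> (\<lambda>x. cf w x * z x) z" if "w \<in> L2 \<Omega>" "z \<in> L2 \<Omega>" for w z
    unfolding cf_def by (rule linearization_mult[OF that])+
  \<comment> \<open>Energy bound for the adjoint states, uniform on the ball because
    \<open>\<psi>\<close> dominates all derivatives of the integrand there.\<close>
  define B where "B = L2_norm \<Omega> \<psi> / \<gamma>"
  have B0: "B \<ge> 0" using L2.nrm_nonneg[OF Cl(2)] \<gamma>(1) by (simp add: B_def)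
  have pB: "L2_norm \<Omega> (p w) \<le> B" if w: "w \<in> L2 \<Omega>" "L2_dist \<Omega> w w0 < r" for w
    unfolding B_def
  proof (rule \<gamma>(2)[OF pP(1)[OF w] _ L2.nrm_nonneg[OF Cl(2)]])
    have "bil (P w) (P w) \<le> L2_inner \<Omega> (dl w) (p w)"
      using pP(2)[OF w pP(1)[OF w]] cfL(2)[OF w(1) pL[OF w]] by linarith
    also have "\<dots> \<le> L2_norm \<Omega> (dl w) * L2_norm \<Omega> (p w)"
      using L2.cauchy_schwarz[OF dlL[OF w] pL[OF w]] by linarith
    also have "\<dots> \<le> L2_norm \<Omega> \<psi> * L2_norm \<Omega> (p w)"
      by (intro mult_right_mono L2_norm_mono dlL[OF w] Cl(2) dlb[OF w] L2.nrm_nonneg[OF pL[OF w]])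
    finally show "bil (P w) (P w) \<le> L2_norm \<Omega> \<psi> * L2_norm \<Omega> (p w)" .
  qed
  \<comment> \<open>In \<open>C1\<close> the first term is the Taylor remainder of the integrand,
    the second that of \<open>f\<close> paired with the adjoint state. In \<open>C2\<close> the
    terms are the change of the adjoint right-hand side and that of the adjoint coefficient, divided
    by the coercivity constant.\<close>
  define C1 where "C1 = Cl * c\<^sup>2 + Cf * K * c * B"
  define C2 where "C2 = (Cl * c + Cf * K * B) / \<gamma>"
  have C0: "C1 > 0" "C2 > 0"
    unfolding C1_def C2_def using Cl(1) Cf(1) c(1) r(3) B0 \<gamma>(1)
    by (auto intro!: add_pos_nonneg mult_nonneg_nonneg divide_pos_pos)
  have est: "\<bar>(LINT x|lebesgue_on \<Omega>. l x (y w' x)) - (LINT x|lebesgue_on \<Omega>. l x (y w x)) - L2_inner \<Omega> (p w) (\<lambda>x. w' x - w x)\<bar>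
        \<le> C1 * (L2_dist \<Omega> w' w)\<^sup>2"
      "L2_dist \<Omega> (p w') (p w) \<le> C2 * L2_dist \<Omega> w' w"
    if w: "w \<in> L2 \<Omega>" and w': "w' \<in> L2 \<Omega>" and wr: "L2_dist \<Omega> w w0 < r" and w'r: "L2_dist \<Omega> w' w0 < r" for w w'
  proof -
    define N where "N = L2_dist \<Omega> w' w"
    define d where "d x = y w' x - y w x" for x
    define D where "D x = grad w' x - grad w x" for x
    have h: "(\<lambda>x. w' x - w x) \<in> L2 \<Omega>" by (rule L2_diff[OF w' w])
    have N0: "N \<ge> 0" using L2.nrm_nonneg[OF h] by (simp add: N_def)
    have dH: "H10 \<Omega> d D" unfolding d_def[abs_def] D_def[abs_def] by (rule state_diff(1)[OF w w'])
    note dL = H10_D(1)[OF dH]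
    have dN: "L2_norm \<Omega> d \<le> c * N" using c(2)[OF w w'] by (simp add: d_def[abs_def] N_def)
    have d0: "0 \<le> L2_norm \<Omega> d" by (rule L2.nrm_nonneg[OF dL])
    have dsup: "AE x in lebesgue_on \<Omega>. \<bar>d x\<bar> \<le> K * N" using sup[OF w w' wr w'r] by (simp add: d_def N_def)
    have p: "p w \<in> L2 \<Omega>" "p w' \<in> L2 \<Omega>" by (rule pL[OF w wr], rule pL[OF w' w'r])
    have pBw: "L2_norm \<Omega> (p w) \<le> B" by (rule pB[OF w wr])
    \<comment> \<open>Linearization error of \<open>f\<close>, quadratic in \<open>d\<close>. The
      supremum bound \<open>K * N\<close> on one factor is what makes it quadratic in
      \<open>N\<close> in the L2 norm.\<close>
    define R where "R x = (f x (y w' x) - f x (y w x)) - cf w x * d x" for x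
    have fdL: "(\<lambda>x. f x (y w' x) - f x (y w x)) \<in> L2 \<Omega>" by (rule L2_diff[OF f_state_L2[OF w'] f_state_L2[OF w]])
    have RL: "R \<in> L2 \<Omega>" unfolding R_def[abs_def] by (rule L2_diff[OF fdL cfL(1)[OF w dL]])
    have "AE x in lebesgue_on \<Omega>. \<bar>R x\<bar> \<le> \<bar>(Cf * K * N) * d x\<bar>"
      using Cf(2) bd[OF w wr] bd[OF w' w'r] dsup
    proof eventually_elim
      case (elim x)
      have "\<bar>f x (y w' x) - f x (y w x) - deriv (f x) (y w x) * (y w' x - y w x)\<bar> \<le> Cf * (y w' x - y w x)\<^sup>2"
        using elim(1,2,3) by blast
      then have "\<bar>R x\<bar> \<le> Cf * (\<bar>d x\<bar> * \<bar>d x\<bar>)" by (simp add: R_def cf_def d_def power2_eq_square)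
      also have "\<dots> \<le> Cf * ((K * N) * \<bar>d x\<bar>)" using elim(4) Cf(1) by (intro mult_left_mono mult_right_mono) auto
      also have "\<dots> = \<bar>(Cf * K * N) * d x\<bar>" using Cf(1) r(3) N0 by (simp add: abs_mult)
      finally show ?case .
    qed
    from L2_norm_mono[OF RL L2_scale[OF dL] this] have "L2_norm \<Omega> R \<le> (Cf * K * N) * L2_norm \<Omega> d"
      using Cf(1) r(3) N0 by (simp add: L2.nrm_sc[OF dL])
    also have "\<dots> \<le> (Cf * K * N) * (c * N)" using dN Cf(1) r(3) N0 by (intro mult_left_mono) auto
    finally have RN: "L2_norm \<Omega> R \<le> (Cf * K * N) * (c * N)" .
    have "\<bar>L2_inner \<Omega> R (p w)\<bar> \<le> L2_norm \<Omega> R * L2_norm \<Omega> (p w)" by (rule L2.cauchy_schwarz[OF RL p(1)])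
    also have "\<dots> \<le> ((Cf * K * N) * (c * N)) * B"
      by (rule mult_mono[OF RN pBw]) (use Cf(1) c(1) r(3) N0 L2.nrm_nonneg[OF p(1)] in auto)
    finally have Rp: "\<bar>L2_inner \<Omega> R (p w)\<bar> \<le> (Cf * K * c * B) * N\<^sup>2" by (simp add: power2_eq_square mult_ac)
    \<comment> \<open>The adjoint equation is tested with the state difference and the equation of
      the state difference with the adjoint state. The \<open>bil\<close> terms cancel, so no
      linearized state equation has to be solved.\<close>
    have e1: "bil D (P w) + L2_inner \<Omega> (\<lambda>x. cf w x * p w x) d = L2_inner \<Omega> (dl w) d" by (rule pP(2)[OF w wr dH])
    have e2: "bil D (P w) + L2_inner \<Omega> (\<lambda>x. f x (y w' x) - f x (y w x)) (p w) = L2_inner \<Omega> (\<lambda>x. w' x - w x) (p w)"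
      unfolding D_def[abs_def] by (rule state_diff(2)[OF w w' pP(1)[OF w wr]])
    have e3: "L2_inner \<Omega> (\<lambda>x. cf w x * p w x) d = L2_inner \<Omega> (\<lambda>x. cf w x * d x) (p w)"
      by (simp add: L2_inner_def mult_ac)
    have e4: "L2_inner \<Omega> R (p w) = L2_inner \<Omega> (\<lambda>x. f x (y w' x) - f x (y w x)) (p w) - L2_inner \<Omega> (\<lambda>x. cf w x * d x) (p w)"
      unfolding R_def[abs_def] by (rule L2.ip_sub_left[OF fdL cfL(1)[OF w dL] p(1)])
    have e5: "L2_inner \<Omega> (dl w) d = L2_inner \<Omega> (p w) (\<lambda>x. w' x - w x) - L2_inner \<Omega> R (p w)"
      using e1 e2 e3 e4 L2.ip_sym[OF h p(1)] by linarith
    have int: "integrable (lebesgue_on \<Omega>) (\<lambda>x. l x (y w' x) - l x (y w x) - dl w x * d x)"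
      by (intro Bochner_Integration.integrable_diff lint w w' wr w'r L2_integrable_mult dlL[OF w wr] dL)
    have "(LINT x|lebesgue_on \<Omega>. l x (y w' x) - l x (y w x) - dl w x * d x)
        = (LINT x|lebesgue_on \<Omega>. l x (y w' x)) - (LINT x|lebesgue_on \<Omega>. l x (y w x)) - L2_inner \<Omega> (dl w) d"
      by (simp add: L2_inner_def lint w w' wr w'r L2_integrable_mult dlL[OF w wr] dL)
    moreover have "\<bar>LINT x|lebesgue_on \<Omega>. l x (y w' x) - l x (y w x) - dl w x * d x\<bar> \<le> Cl * (c * N)\<^sup>2"
    proof -
      have "\<bar>LINT x|lebesgue_on \<Omega>. l x (y w' x) - l x (y w x) - dl w x * d x\<bar>
          \<le> (LINT x|lebesgue_on \<Omega>. \<bar>l x (y w' x) - l x (y w x) - dl w x * d x\<bar>)"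
        by (rule integral_abs_bound)
      also have "\<dots> \<le> (LINT x|lebesgue_on \<Omega>. Cl * (d x)\<^sup>2)"
      proof (rule integral_mono_AE[OF integrable_abs[OF int] Bochner_Integration.integrable_mult_right[OF L2_integrable_square[OF dL]]])
        show "AE x in lebesgue_on \<Omega>. \<bar>l x (y w' x) - l x (y w x) - dl w x * d x\<bar> \<le> Cl * (d x)\<^sup>2"
          using Cl(3) bd[OF w wr] bd[OF w' w'r]
        proof eventually_elim
          case (elim x)
          then show ?case unfolding dl_def d_def by blast
        qed
      qed
      also have "\<dots> = Cl * (L2_norm \<Omega> d)\<^sup>2" by (simp add: L2_norm_sq[OF dL])
      also have "\<dots> \<le> Cl * (c * N)\<^sup>2" using dN d0 Cl(1) by (intro mult_left_mono power_mono) auto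
      finally show ?thesis .
    qed
    ultimately have "\<bar>(LINT x|lebesgue_on \<Omega>. l x (y w' x)) - (LINT x|lebesgue_on \<Omega>. l x (y w x)) - L2_inner \<Omega> (p w) (\<lambda>x. w' x - w x)\<bar>
        \<le> Cl * (c * N)\<^sup>2 + (Cf * K * c * B) * N\<^sup>2"
      using e5 Rp by linarith
    also have "\<dots> = C1 * N\<^sup>2" by (simp add: C1_def power_mult_distrib distrib_right)
    finally show "\<bar>(LINT x|lebesgue_on \<Omega>. l x (y w' x)) - (LINT x|lebesgue_on \<Omega>. l x (y w x)) - L2_inner \<Omega> (p w) (\<lambda>x. w' x - w x)\<bar>
        \<le> C1 * (L2_dist \<Omega> w' w)\<^sup>2" by (simp add: N_def)

    define q where "q x = p w' x - p w x" for x
    define Q where "Q x = P w' x - P w x" for x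
    have qH: "H10 \<Omega> q Q" unfolding q_def[abs_def] Q_def[abs_def] by (rule H10_diff[OF pP(1)[OF w' w'r] pP(1)[OF w wr]])
    note qL = H10_D(1)[OF qH]
    \<comment> \<open>The adjoint state lies only in L2, so the coefficient change must be small in
      the supremum norm; again the supremum estimate for states supplies this.\<close>
    define S where "S x = (cf w' x - cf w x) * p w x" for x
    have cfm: "cf w \<in> borel_measurable (lebesgue_on \<Omega>)" "cf w' \<in> borel_measurable (lebesgue_on \<Omega>)"
      unfolding cf_def[abs_def]
      by (rule caratheodory_C2_measurable(2)[OF f_cara L2_measurable[OF state_props(2)[OF w]]],
          rule caratheodory_C2_measurable(2)[OF f_cara L2_measurable[OF state_props(2)[OF w']]])
    have cfd: "AE x in lebesgue_on \<Omega>. \<bar>cf w' x - cf w x\<bar> \<le> Cf * (K * N)"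
      using Cf(2) bd[OF w wr] bd[OF w' w'r] dsup
    proof eventually_elim
      case (elim x)
      have "\<bar>cf w' x - cf w x\<bar> \<le> Cf * \<bar>d x\<bar>" using elim(1,2,3) unfolding cf_def d_def by blast
      also have "\<dots> \<le> Cf * (K * N)" using elim(4) Cf(1) by (intro mult_left_mono) auto
      finally show ?case .
    qed
    have SL: "S \<in> L2 \<Omega>"
      unfolding S_def[abs_def] by (rule L2_mult_bounded(1)[OF borel_measurable_diff[OF cfm(2,1)] p(1) cfd])
    have "L2_norm \<Omega> S \<le> Cf * (K * N) * L2_norm \<Omega> (p w)"
      unfolding S_def[abs_def] by (rule L2_mult_bounded(2)[OF borel_measurable_diff[OF cfm(2,1)] p(1) cfd])
        (use Cf(1) r(3) N0 in auto)
    also have "\<dots> \<le> Cf * (K * N) * B" using pBw Cf(1) r(3) N0 by (intro mult_left_mono) auto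
    finally have SN: "L2_norm \<Omega> S \<le> Cf * (K * N) * B" .
    define T where "T x = dl w' x - dl w x" for x
    have TL: "T \<in> L2 \<Omega>" unfolding T_def[abs_def] by (rule L2_diff[OF dlL[OF w' w'r] dlL[OF w wr]])
    have "AE x in lebesgue_on \<Omega>. \<bar>T x\<bar> \<le> \<bar>Cl * d x\<bar>"
      using Cl(3) bd[OF w wr] bd[OF w' w'r]
    proof eventually_elim
      case (elim x)
      then have "\<bar>T x\<bar> \<le> Cl * \<bar>d x\<bar>" unfolding T_def dl_def d_def by blast
      then show ?case using Cl(1) by (simp add: abs_mult)
    qed
    from L2_norm_mono[OF TL L2_scale[OF dL] this] have "L2_norm \<Omega> T \<le> Cl * L2_norm \<Omega> d"
      using Cl(1) by (simp add: L2.nrm_sc[OF dL])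
    also have "\<dots> \<le> Cl * (c * N)" using dN Cl(1) by (intro mult_left_mono) auto
    finally have TN: "L2_norm \<Omega> T \<le> Cl * (c * N)" .
    have vL: "vL2 Q" "vL2 (P w')" "vL2 (P w)"
      using H10_D(2)[OF qH] H10_D(2)[OF pP(1)[OF w' w'r]] H10_D(2)[OF pP(1)[OF w wr]] by simp_all
    have b1: "bil Q Q = bil Q (P w') - bil Q (P w)"
      using bil_linear_right[OF vL, of 1 "-1"] by (simp add: Q_def[abs_def])
    have b2: "bil Q (P w') + L2_inner \<Omega> (\<lambda>x. cf w' x * p w' x) q = L2_inner \<Omega> (dl w') q" by (rule pP(2)[OF w' w'r qH])
    have b3: "bil Q (P w) + L2_inner \<Omega> (\<lambda>x. cf w x * p w x) q = L2_inner \<Omega> (dl w) q" by (rule pP(2)[OF w wr qH])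
    \<comment> \<open>The new coefficient stays attached to \<open>q\<close>, where its sign makes
      the term nonnegative when tested with \<open>q\<close>; everything else goes into
      \<open>S\<close>.\<close>
    have e: "(\<lambda>x. cf w' x * p w' x) = (\<lambda>x. (cf w' x * q x + S x) + cf w x * p w x)"
      by (simp add: q_def S_def algebra_simps)
    have b4: "L2_inner \<Omega> (\<lambda>x. cf w' x * p w' x) q = L2_inner \<Omega> (\<lambda>x. cf w' x * q x) q + L2_inner \<Omega> S q + L2_inner \<Omega> (\<lambda>x. cf w x * p w x) q"
      unfolding e
      by (simp only: L2.ip_add_left[OF L2_add[OF cfL(1)[OF w' qL] SL] cfL(1)[OF w p(1)] qL] L2.ip_add_left[OF cfL(1)[OF w' qL] SL qL])
    have b5: "L2_inner \<Omega> T q = L2_inner \<Omega> (dl w') q - L2_inner \<Omega> (dl w) q"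
      unfolding T_def[abs_def] by (rule L2.ip_sub_left[OF dlL[OF w' w'r] dlL[OF w wr] qL])
    have "bil Q Q \<le> L2_inner \<Omega> T q - L2_inner \<Omega> S q"
      using b1 b2 b3 b4 b5 cfL(2)[OF w' qL] by linarith
    also have "\<dots> \<le> L2_norm \<Omega> T * L2_norm \<Omega> q + L2_norm \<Omega> S * L2_norm \<Omega> q"
      using L2.cauchy_schwarz[OF TL qL] L2.cauchy_schwarz[OF SL qL] by linarith
    also have "\<dots> \<le> (Cl * (c * N)) * L2_norm \<Omega> q + (Cf * (K * N) * B) * L2_norm \<Omega> q"
      by (intro add_mono mult_right_mono TN SN L2.nrm_nonneg[OF qL])
    also have "\<dots> = (Cl * (c * N) + Cf * (K * N) * B) * L2_norm \<Omega> q" by (simp add: distrib_right)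
    finally have "L2_norm \<Omega> q \<le> (Cl * (c * N) + Cf * (K * N) * B) / \<gamma>"
      by (rule \<gamma>(2)[OF qH]) (use Cl(1) Cf(1) c(1) r(3) N0 B0 in auto)
    also have "\<dots> = C2 * N" by (simp add: C2_def field_simps)
    finally show "L2_dist \<Omega> (p w') (p w) \<le> C2 * L2_dist \<Omega> w' w" by (simp add: N_def q_def[abs_def])
  qed
  have m: "C1 * (L2_dist \<Omega> w' w)\<^sup>2 \<le> max C1 C2 * (L2_dist \<Omega> w' w)\<^sup>2" for w w'
    by (rule mult_right_mono) auto
  have m': "C2 * L2_dist \<Omega> w' w \<le> max C1 C2 * L2_dist \<Omega> w' w" if "w \<in> L2 \<Omega>" "w' \<in> L2 \<Omega>" for w w'
    by (rule mult_right_mono) (simp_all add: L2.nrm_nonneg[OF L2_diff[OF that(2,1)]])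
  show ?thesis
  proof (rule that[of r "max C1 C2" p])
    show "max C1 C2 > 0" using C0 by simp
  next
    fix w w' assume w: "w \<in> L2 \<Omega>" "w' \<in> L2 \<Omega>" "L2_dist \<Omega> w w0 < r" "L2_dist \<Omega> w' w0 < r"
    show "\<bar>(LINT x|lebesgue_on \<Omega>. l x (y w' x)) - (LINT x|lebesgue_on \<Omega>. l x (y w x)) - L2_inner \<Omega> (p w) (\<lambda>x. w' x - w x)\<bar>
        \<le> max C1 C2 * (L2_dist \<Omega> w' w)\<^sup>2"
      by (rule order_trans[OF est(1)[OF w] m])
    show "L2_dist \<Omega> (p w') (p w) \<le> max C1 C2 * L2_dist \<Omega> w' w"
      by (rule order_trans[OF est(2)[OF w] m'[OF w(1,2)]])
  qed (use r pL in auto)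
qed

end

section \<open>Gradients of the cost functionals\<close>

text \<open>\<open>L2_gradient\<close> is an arbitrary choice among gradients; this identifies it
  almost everywhere with the one built from adjoint states.\<close>

lemma has_L2_gradient_unique:
  assumes "has_L2_gradient \<Omega> \<Phi> u g" "has_L2_gradient \<Omega> \<Phi> u g'"
  shows "AE x in lebesgue_on \<Omega>. g x = g' x"
proof -
  have g: "g \<in> L2 \<Omega>" "g' \<in> L2 \<Omega>" using assms by (auto simp: has_L2_gradient_def)
  define d where "d x = g x - g' x" for x
  have d: "d \<in> L2 \<Omega>" unfolding d_def[abs_def] by (rule L2_diff[OF g])
  have n0: "0 \<le> L2_norm \<Omega> d" by (rule L2.nrm_nonneg[OF d])
  have "L2_norm \<Omega> d = 0"
  proof (rule ccontr)
    assume "L2_norm \<Omega> d \<noteq> 0"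
    then have n: "L2_norm \<Omega> d > 0" using n0 by simp
    \<comment> \<open>With a quarter of the norm, the two errors together reach only half of the gap
      between the linear parts in direction \<open>d\<close>.\<close>
    define \<epsilon> where "\<epsilon> = L2_norm \<Omega> d / 4"
    have \<epsilon>: "\<epsilon> > 0" using n by (simp add: \<epsilon>_def)
    obtain \<delta>1 where \<delta>1: "\<delta>1 > 0" "\<And>h. h \<in> L2 \<Omega> \<Longrightarrow> L2_norm \<Omega> h < \<delta>1 \<Longrightarrow>
        \<bar>\<Phi> (\<lambda>x. u x + h x) - \<Phi> u - L2_inner \<Omega> g h\<bar> \<le> \<epsilon> * L2_norm \<Omega> h"
      using assms(1) \<epsilon> unfolding has_L2_gradient_def by blast
    obtain \<delta>2 where \<delta>2: "\<delta>2 > 0" "\<And>h. h \<in> L2 \<Omega> \<Longrightarrow> L2_norm \<Omega> h < \<delta>2 \<Longrightarrow>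
        \<bar>\<Phi> (\<lambda>x. u x + h x) - \<Phi> u - L2_inner \<Omega> g' h\<bar> \<le> \<epsilon> * L2_norm \<Omega> h"
      using assms(2) \<epsilon> unfolding has_L2_gradient_def by blast
    define t where "t = min \<delta>1 \<delta>2 / (2 * L2_norm \<Omega> d)"
    have t: "t > 0" using \<delta>1(1) \<delta>2(1) n by (simp add: t_def)
    define h where "h x = t * d x" for x
    have h: "h \<in> L2 \<Omega>" unfolding h_def[abs_def] by (rule L2_scale[OF d])
    have hn: "L2_norm \<Omega> h = t * L2_norm \<Omega> d" unfolding h_def[abs_def] using t by (simp add: L2.nrm_sc[OF d])
    define m where "m = min \<delta>1 \<delta>2"
    have m: "0 < m" "m \<le> \<delta>1" "m \<le> \<delta>2" using \<delta>1(1) \<delta>2(1) by (auto simp: m_def)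
    have "L2_norm \<Omega> h = m / 2" using n by (simp add: hn t_def m_def)
    then have s: "L2_norm \<Omega> h < \<delta>1" "L2_norm \<Omega> h < \<delta>2" using m by linarith+
    have "\<bar>L2_inner \<Omega> g h - L2_inner \<Omega> g' h\<bar> \<le> 2 * (\<epsilon> * L2_norm \<Omega> h)"
      using \<delta>1(2)[OF h s(1)] \<delta>2(2)[OF h s(2)] by linarith
    moreover have "L2_inner \<Omega> g h - L2_inner \<Omega> g' h = t * (L2_norm \<Omega> d)\<^sup>2"
      unfolding L2.ip_sub_left[OF g h, symmetric] d_def[symmetric]
      unfolding h_def[abs_def] by (simp add: L2.ip_sc_right[OF d d] L2.nrm_sq[OF d])
    ultimately have "t * (L2_norm \<Omega> d)\<^sup>2 \<le> 2 * (\<epsilon> * (t * L2_norm \<Omega> d))" by (simp add: hn)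
    also have "\<dots> = t * (L2_norm \<Omega> d)\<^sup>2 / 2" by (simp add: \<epsilon>_def power2_eq_square)
    finally show False using t n by simp
  qed
  from L2_norm_eq_0_imp_AE[OF d this] show ?thesis by eventually_elim (simp add: d_def)
qed

section \<open>The product space of controls\<close>

interpretation L2m: semi_ip "L2m \<Omega>" "\<lambda>u v k x. u k x + v k x" "\<lambda>u v k x. u k x - v k x" "\<lambda>c u k x. c * u k x"
  "L2m_inner \<Omega>" "L2m_norm \<Omega>" for \<Omega> :: "(real^'n::finite) set"
proof
  show "(L2m \<Omega> :: ('n, 'm::finite) control set) \<noteq> {}" for \<Omega> :: "(real^'n) set"
    using L2_zero by (auto simp: L2m_def intro!: exI[of _ "\<lambda>k x. 0"])
next
  fix u v :: "('n, 'm::finite) control" and \<Omega> :: "(real^'n) set"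
  assume "u \<in> L2m \<Omega>" "v \<in> L2m \<Omega>"
  then show "L2m_inner \<Omega> u v = L2m_inner \<Omega> v u" by (simp add: L2m_inner_def L2_inner_def mult.commute)
qed (auto simp: L2m_def L2_add L2_diff L2_scale L2m_inner_def L2m_norm_def L2.ip_rules sum.distrib
    sum_subtractf sum_distrib_left L2.ip_nonneg sum_nonneg)

lemma L2m_D: "u \<in> L2m \<Omega> \<Longrightarrow> u k \<in> L2 \<Omega>"
  by (simp add: L2m_def)

lemma L2m_update: "u \<in> L2m \<Omega> \<Longrightarrow> v \<in> L2 \<Omega> \<Longrightarrow> u(k := v) \<in> L2m \<Omega>"
  by (simp add: L2m_def)

lemma L2m_norm_le_sum:
  assumes u: "u \<in> L2m \<Omega>" shows "L2m_norm \<Omega> u \<le> (\<Sum>k\<in>UNIV. L2_norm \<Omega> (u k))"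
proof -
  have "L2m_inner \<Omega> u u = (\<Sum>k\<in>UNIV. (L2_norm \<Omega> (u k))\<^sup>2)"
    using L2m_D[OF u] by (simp add: L2m_inner_def L2.nrm_sq)
  then have "L2m_norm \<Omega> u = L2_set (\<lambda>k. L2_norm \<Omega> (u k)) UNIV" by (simp add: L2m_norm_def L2_set_def)
  also have "\<dots> \<le> (\<Sum>k\<in>UNIV. L2_norm \<Omega> (u k))"
    by (rule L2_set_le_sum) (use L2.nrm_nonneg L2m_D[OF u] in blast)
  finally show ?thesis .
qed

lemma L2m_norm_cong_AE:
  assumes "u \<in> L2m \<Omega>" "v \<in> L2m \<Omega>" "ae_eq \<Omega> u v"
  shows "L2m_norm \<Omega> u = L2m_norm \<Omega> v"
proof -
  have "L2_norm \<Omega> (u k) = L2_norm \<Omega> (v k)" for k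
    by (rule L2_norm_cong_AE) (use assms in \<open>auto simp: L2m_def ae_eq_def\<close>)
  then have "L2_inner \<Omega> (u k) (u k) = L2_inner \<Omega> (v k) (v k)" for k
    using assms L2.nrm_sq[of "u k" \<Omega>] L2.nrm_sq[of "v k" \<Omega>] L2m_D by metis
  then show ?thesis by (simp add: L2m_norm_def L2m_inner_def)
qed

lemma total_control_update:
  "total_control B (u(k := v)) x = total_control B u x + B k x * (v x - u k x)"
proof -
  have "total_control B (u(k := v)) x = B k x * v x + (\<Sum>i\<in>UNIV - {k}. B i x * u i x)"
    unfolding total_control_def by (subst sum.remove[of _ k]) (auto intro!: sum.cong)
  moreover have "total_control B u x = B k x * u k x + (\<Sum>i\<in>UNIV - {k}. B i x * u i x)"
    unfolding total_control_def by (subst sum.remove[of _ k]) auto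
  ultimately show ?thesis by (simp add: right_diff_distrib)
qed

lemma total_control_L2:
  assumes "\<And>i. B i \<in> Linf \<Omega>" "u \<in> L2m \<Omega>" shows "total_control B u \<in> L2 \<Omega>"
  unfolding total_control_def by (intro L2_sum L2_mult_Linf assms L2m_D) auto

text \<open>\<open>G U\<close> is the gradient of \<open>J\<close> in the \<open>j\<close>-th component at \<open>U\<close>.  Its Lipschitz estimate concerns a change
  of any one component \<open>i\<close>.\<close>

abbreviation partial_gradient ::
  "(real^'n::finite) set \<Rightarrow> (('n, 'm::finite) control \<Rightarrow> real) \<Rightarrow> ('n, 'm) control \<Rightarrow> 'm \<Rightarrow> real \<Rightarrow> real \<Rightarrow>
    (('n, 'm) control \<Rightarrow> 'n scal) \<Rightarrow> bool" where
  "partial_gradient \<Omega> J ubar j r C G \<equiv> r > 0 \<and> C > 0 \<and>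
    (\<forall>U. U \<in> L2m \<Omega> \<and> (\<forall>i. L2_dist \<Omega> (U i) (ubar i) < r) \<longrightarrow> G U \<in> L2 \<Omega> \<and>
      (\<forall>v\<in>L2 \<Omega>. L2_dist \<Omega> v (ubar j) < r \<longrightarrow>
        \<bar>J (U(j := v)) - J U - L2_inner \<Omega> (G U) (\<lambda>x. v x - U j x)\<bar> \<le> C * (L2_dist \<Omega> v (U j))\<^sup>2) \<and>
      (\<forall>i. \<forall>v\<in>L2 \<Omega>. L2_dist \<Omega> v (ubar i) < r \<longrightarrow>
        L2_norm \<Omega> (\<lambda>x. G (U(i := v)) x - G U x) \<le> C * L2_dist \<Omega> v (U i)))"

context state_equation
begin

text \<open>Treats the pairing of \<open>eJ\<close> with the state as an integral cost, so that the
  expansion of the reduced functional also covers the parameter term.\<close>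

lemma integrand_linear:
  assumes e: "e \<in> L2 \<Omega>" shows "integrand_assms \<Omega> (\<lambda>x t. e x * t)"
proof -
  have d: "deriv (\<lambda>t. e x * t) = (\<lambda>t. e x)" for x
    by (rule ext, rule DERIV_imp_deriv) (auto intro!: derivative_eq_intros)
  have dd: "deriv (deriv (\<lambda>t. e x * t)) = (\<lambda>t. 0)" for x
    unfolding d by simp
  have "C2_fun (\<lambda>t. e x * t)" for x
    unfolding C2_fun_def dd unfolding d by (auto intro!: derivative_intros)
  moreover have "(\<lambda>x. e x * t) \<in> borel_measurable (lebesgue_on \<Omega>)" for t
    using L2_measurable[OF e] by measurable
  ultimately have c: "caratheodory_C2 \<Omega> (\<lambda>x t. e x * t)" by (simp add: caratheodory_C2_def)
  have "\<exists>C>0. \<exists>\<psi>\<in>L2 \<Omega>. AE x in lebesgue_on \<Omega>.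
        (\<forall>y. \<bar>y\<bar> \<le> M \<longrightarrow> \<bar>deriv (\<lambda>t. e x * t) y\<bar> \<le> \<psi> x \<and> \<bar>deriv (deriv (\<lambda>t. e x * t)) y\<bar> \<le> C) \<and>
        (\<forall>y1 y2. \<bar>y1\<bar> \<le> M \<and> \<bar>y2\<bar> \<le> M \<longrightarrow>
           \<bar>deriv (deriv (\<lambda>t. e x * t)) y2 - deriv (deriv (\<lambda>t. e x * t)) y1\<bar> \<le> C * \<bar>y2 - y1\<bar>)" for M :: real
    unfolding dd unfolding d
    by (rule exI[of _ 1], rule conjI, simp, rule bexI[OF _ L2_abs[OF e]]) simp
  then show ?thesis using c by (simp add: integrand_assms_def)
qed

text \<open>The perturbed cost contains states for two different right-hand sides, \<open>W1\<close>
  and \<open>W2\<close>, so the reduced expansion is used twice, around different centres.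
  Multiplication by \<open>B j\<close> carries the adjoint states back to the control, and the
  quadratic control cost expands exactly.\<close>

lemma perturbed_cost_expansion:
  fixes B \<zeta> ubar :: "('n, 'm::finite) control"
  assumes B: "\<And>i. B i \<in> Linf \<Omega>" and \<zeta>: "\<zeta> j \<in> Linf \<Omega>" and L: "integrand_assms \<Omega> (L j)"
    and eY: "eY e \<in> L2 \<Omega>" and eJ: "eJ e j \<in> L2 \<Omega>" and ubar: "ubar \<in> L2m \<Omega>"
  shows "\<exists>r C G. partial_gradient \<Omega> (J_pert \<Omega> \<zeta> B L y j e) ubar j r C G"
proof -
  define W1 where "W1 U x = total_control B U x + B j x * eY e x" for U x
  define W2 where "W2 U x = total_control B U x + eY e x" for U x
  have BeY: "(\<lambda>x. B j x * eY e x) \<in> L2 \<Omega>" by (rule L2_mult_Linf[OF B eY])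
  have WL: "W1 U \<in> L2 \<Omega>" "W2 U \<in> L2 \<Omega>" if "U \<in> L2m \<Omega>" for U
    unfolding W1_def[abs_def] W2_def[abs_def]
    by (rule L2_add[OF total_control_L2[OF B that] BeY], rule L2_add[OF total_control_L2[OF B that] eY])
  have J_eq: "J_pert \<Omega> \<zeta> B L y j e U = (LINT x|lebesgue_on \<Omega>. L j x (y (W1 U) x)) +
      1/2 * (LINT x|lebesgue_on \<Omega>. \<zeta> j x * (U j x + eY e x)\<^sup>2) + (LINT x|lebesgue_on \<Omega>. eJ e j x * y (W2 U) x)" for U
  proof -
    have "total_control B (U(j := \<lambda>x. U j x + eY e x)) = W1 U"
      by (rule ext) (simp add: W1_def total_control_update)
    then show ?thesis by (simp add: J_pert_def J_cost_def L2_inner_def W2_def[abs_def])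
  qed
  have "\<forall>i. \<exists>C\<ge>0. AE x in lebesgue_on \<Omega>. \<bar>B i x\<bar> \<le> C"
  proof
    fix i show "\<exists>C\<ge>0. AE x in lebesgue_on \<Omega>. \<bar>B i x\<bar> \<le> C" using B[of i] by (rule Linf_bound) blast
  qed
  from choice[OF this] obtain CB where CB: "\<And>i. CB i \<ge> 0" "\<And>i. AE x in lebesgue_on \<Omega>. \<bar>B i x\<bar> \<le> CB i" by blast
  obtain C\<zeta> where C\<zeta>: "C\<zeta> \<ge> 0" "AE x in lebesgue_on \<Omega>. \<bar>\<zeta> j x\<bar> \<le> C\<zeta>" using \<zeta> by (rule Linf_bound) blast
  \<comment> \<open>A common bound for all \<open>B i\<close>; the additional 1 makes it positive
    and the estimate in \<open>W_near\<close> strict.\<close>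
  define b where "b = (\<Sum>i\<in>UNIV. CB i) + 1"
  have b: "b > 0" unfolding b_def by (intro add_nonneg_pos sum_nonneg CB) simp
  have CBb: "CB i \<le> b" for i
    unfolding b_def using member_le_sum[of i UNIV CB] CB(1) by auto
  have BL: "(\<lambda>x. B i x * u x) \<in> L2 \<Omega>" "L2_norm \<Omega> (\<lambda>x. B i x * u x) \<le> b * L2_norm \<Omega> u" if "u \<in> L2 \<Omega>" for i u
  proof -
    show "(\<lambda>x. B i x * u x) \<in> L2 \<Omega>" by (rule L2_mult_Linf[OF B that])
    have "L2_norm \<Omega> (\<lambda>x. B i x * u x) \<le> CB i * L2_norm \<Omega> u"
      by (rule L2_mult_bounded(2)[OF Linf_measurable[OF B] that CB(2,1)])
    also have "\<dots> \<le> b * L2_norm \<Omega> u" by (intro mult_right_mono CBb L2.nrm_nonneg that)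
    finally show "L2_norm \<Omega> (\<lambda>x. B i x * u x) \<le> b * L2_norm \<Omega> u" .
  qed
  obtain r1 C1 P1 where P1: "r1 > 0" "C1 > 0"
    "\<And>w. w \<in> L2 \<Omega> \<Longrightarrow> L2_dist \<Omega> w (W1 ubar) < r1 \<Longrightarrow> P1 w \<in> L2 \<Omega>"
    "\<And>w w'. w \<in> L2 \<Omega> \<Longrightarrow> w' \<in> L2 \<Omega> \<Longrightarrow> L2_dist \<Omega> w (W1 ubar) < r1 \<Longrightarrow> L2_dist \<Omega> w' (W1 ubar) < r1 \<Longrightarrow>
      \<bar>(LINT x|lebesgue_on \<Omega>. L j x (y w' x)) - (LINT x|lebesgue_on \<Omega>. L j x (y w x)) - L2_inner \<Omega> (P1 w) (\<lambda>x. w' x - w x)\<bar>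
        \<le> C1 * (L2_dist \<Omega> w' w)\<^sup>2"
    "\<And>w w'. w \<in> L2 \<Omega> \<Longrightarrow> w' \<in> L2 \<Omega> \<Longrightarrow> L2_dist \<Omega> w (W1 ubar) < r1 \<Longrightarrow> L2_dist \<Omega> w' (W1 ubar) < r1 \<Longrightarrow>
      L2_dist \<Omega> (P1 w') (P1 w) \<le> C1 * L2_dist \<Omega> w' w"
    using WL(1)[OF ubar] L by (rule reduced_functional_expansion) blast
  obtain r2 C2 P2 where P2: "r2 > 0" "C2 > 0"
    "\<And>w. w \<in> L2 \<Omega> \<Longrightarrow> L2_dist \<Omega> w (W2 ubar) < r2 \<Longrightarrow> P2 w \<in> L2 \<Omega>"
    "\<And>w w'. w \<in> L2 \<Omega> \<Longrightarrow> w' \<in> L2 \<Omega> \<Longrightarrow> L2_dist \<Omega> w (W2 ubar) < r2 \<Longrightarrow> L2_dist \<Omega> w' (W2 ubar) < r2 \<Longrightarrow>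
      \<bar>(LINT x|lebesgue_on \<Omega>. eJ e j x * y w' x) - (LINT x|lebesgue_on \<Omega>. eJ e j x * y w x) - L2_inner \<Omega> (P2 w) (\<lambda>x. w' x - w x)\<bar>
        \<le> C2 * (L2_dist \<Omega> w' w)\<^sup>2"
    "\<And>w w'. w \<in> L2 \<Omega> \<Longrightarrow> w' \<in> L2 \<Omega> \<Longrightarrow> L2_dist \<Omega> w (W2 ubar) < r2 \<Longrightarrow> L2_dist \<Omega> w' (W2 ubar) < r2 \<Longrightarrow>
      L2_dist \<Omega> (P2 w') (P2 w) \<le> C2 * L2_dist \<Omega> w' w"
    using WL(2)[OF ubar] integrand_linear[OF eJ] by (rule reduced_functional_expansion) blast
  \<comment> \<open>Moving every component by less than \<open>r\<close> moves either right-hand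
    side by less than \<open>b * r\<close>, which stays within both radii.\<close>
  define r where "r = min r1 r2 / b"
  have r: "r > 0" using P1(1) P2(1) b by (simp add: r_def)
  define near where "near U \<longleftrightarrow> U \<in> L2m \<Omega> \<and> (\<forall>i. L2_dist \<Omega> (U i) (ubar i) < r)" for U
  have W_near: "L2_dist \<Omega> (W1 U) (W1 ubar) < r1" "L2_dist \<Omega> (W2 U) (W2 ubar) < r2" if "near U" for U
  proof -
    have U: "U \<in> L2m \<Omega>" and Ur: "\<And>i. L2_dist \<Omega> (U i) (ubar i) < r" using that by (auto simp: near_def)
    have dL: "(\<lambda>x. U i x - ubar i x) \<in> L2 \<Omega>" for i by (rule L2_diff[OF L2m_D[OF U] L2m_D[OF ubar]])
    have fin: "(\<lambda>x. \<Sum>i\<in>I. B i x * (U i x - ubar i x)) \<in> L2 \<Omega> \<and>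
        L2_norm \<Omega> (\<lambda>x. \<Sum>i\<in>I. B i x * (U i x - ubar i x)) \<le> (\<Sum>i\<in>I. CB i * r)" if "finite I" for I
      using that
    proof (induction I rule: finite_induct)
      case empty
      show ?case by (simp add: L2_zero L2_norm_def L2_inner_def)
    next
      case (insert i I)
      have "L2_norm \<Omega> (\<lambda>x. B i x * (U i x - ubar i x)) \<le> CB i * L2_dist \<Omega> (U i) (ubar i)"
        by (rule L2_mult_bounded(2)[OF Linf_measurable[OF B] dL CB(2,1)])
      also have "\<dots> \<le> CB i * r" using Ur[of i] CB(1) by (intro mult_left_mono) auto
      finally have 1: "L2_norm \<Omega> (\<lambda>x. B i x * (U i x - ubar i x)) \<le> CB i * r" .
      show ?case
        using insert L2_add[OF BL(1)[OF dL] conjunct1[OF insert.IH]] L2.nrm_add_le[OF BL(1)[OF dL] conjunct1[OF insert.IH]] 1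
        by (simp, meson add_mono order_trans)
    qed
    have "(\<Sum>i\<in>UNIV. CB i * r) < b * r" using r by (simp add: b_def sum_distrib_right distrib_right)
    then have lt: "L2_norm \<Omega> (\<lambda>x. \<Sum>i\<in>UNIV. B i x * (U i x - ubar i x)) < b * r"
      using fin[of UNIV] by auto
    have br: "b * r \<le> r1" "b * r \<le> r2" using b by (simp_all add: r_def)
    have "(\<lambda>x. W1 U x - W1 ubar x) = (\<lambda>x. \<Sum>i\<in>UNIV. B i x * (U i x - ubar i x))"
      by (simp add: W1_def total_control_def right_diff_distrib sum_subtractf)
    then show "L2_dist \<Omega> (W1 U) (W1 ubar) < r1" using lt br by simp
    have "(\<lambda>x. W2 U x - W2 ubar x) = (\<lambda>x. \<Sum>i\<in>UNIV. B i x * (U i x - ubar i x))"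
      by (simp add: W2_def total_control_def right_diff_distrib sum_subtractf)
    then show "L2_dist \<Omega> (W2 U) (W2 ubar) < r2" using lt br by simp
  qed
  have near_upd: "near (U(i := v))" if "near U" "v \<in> L2 \<Omega>" "L2_dist \<Omega> v (ubar i) < r" for U i v
    using that by (auto simp: near_def L2m_update)
  have W_upd: "(\<lambda>x. W1 (U(i := v)) x - W1 U x) = (\<lambda>x. B i x * (v x - U i x))"
    "(\<lambda>x. W2 (U(i := v)) x - W2 U x) = (\<lambda>x. B i x * (v x - U i x))" for U i v
    by (simp_all add: W1_def W2_def total_control_update)
  \<comment> \<open>Two adjoint contributions and the derivative of the quadratic control cost at
    the shifted control.\<close>
  define G where "G U x = (B j x * P1 (W1 U) x + B j x * P2 (W2 U) x) + \<zeta> j x * (U j x + eY e x)" for U x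
  have PL: "P1 (W1 U) \<in> L2 \<Omega>" "P2 (W2 U) \<in> L2 \<Omega>" if "near U" for U
    using P1(3)[OF WL(1) W_near(1)[OF that]] P2(3)[OF WL(2) W_near(2)[OF that]] that by (auto simp: near_def)
  have UL: "(\<lambda>x. U j x + eY e x) \<in> L2 \<Omega>" if "near U" for U
    using that by (intro L2_add L2m_D eY) (simp add: near_def)
  have GL: "G U \<in> L2 \<Omega>" if "near U" for U
    unfolding G_def[abs_def] by (intro L2_add BL(1) PL[OF that] L2_mult_Linf[OF \<zeta>] UL[OF that])
  \<comment> \<open>One factor \<open>b\<close> comes from moving the right-hand side, the other
    from multiplying by \<open>B j\<close>. The summand with the bound of \<open>\<zeta> j\<close>
    accounts for the control cost.\<close>
  define C where "C = (C1 + C2) * b\<^sup>2 + C\<zeta>"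
  have C: "C > 0" unfolding C_def using P1(2) P2(2) b C\<zeta>(1) by (intro add_pos_nonneg mult_pos_pos) auto
  have expand: "\<bar>J_pert \<Omega> \<zeta> B L y j e (U(j := v)) - J_pert \<Omega> \<zeta> B L y j e U - L2_inner \<Omega> (G U) (\<lambda>x. v x - U j x)\<bar>
          \<le> C * (L2_dist \<Omega> v (U j))\<^sup>2"
    if U: "near U" and v: "v \<in> L2 \<Omega>" "L2_dist \<Omega> v (ubar j) < r" for U v
  proof -
    have U': "U \<in> L2m \<Omega>" using U by (simp add: near_def)
    note V = near_upd[OF U v]
    have V': "U(j := v) \<in> L2m \<Omega>" using V by (simp add: near_def)
    define h where "h x = v x - U j x" for x
    have hL: "h \<in> L2 \<Omega>" unfolding h_def[abs_def] by (rule L2_diff[OF v(1) L2m_D[OF U']])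
    note Bh = BL[OF hL, of j]
    have h0: "0 \<le> L2_norm \<Omega> h" by (rule L2.nrm_nonneg[OF hL])
    have sq: "(L2_norm \<Omega> (\<lambda>x. B j x * h x))\<^sup>2 \<le> b\<^sup>2 * (L2_norm \<Omega> h)\<^sup>2"
      using power_mono[OF Bh(2) L2.nrm_nonneg[OF Bh(1)], of 2] by (simp add: power_mult_distrib)
    have t1: "\<bar>(LINT x|lebesgue_on \<Omega>. L j x (y (W1 (U(j := v))) x)) - (LINT x|lebesgue_on \<Omega>. L j x (y (W1 U) x)) - L2_inner \<Omega> (\<lambda>x. B j x * P1 (W1 U) x) h\<bar>
        \<le> C1 * (b\<^sup>2 * (L2_norm \<Omega> h)\<^sup>2)"
    proof -
      have "L2_inner \<Omega> (\<lambda>x. B j x * P1 (W1 U) x) h = L2_inner \<Omega> (P1 (W1 U)) (\<lambda>x. B j x * h x)"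
        by (simp add: L2_inner_def mult_ac)
      then have "\<bar>(LINT x|lebesgue_on \<Omega>. L j x (y (W1 (U(j := v))) x)) - (LINT x|lebesgue_on \<Omega>. L j x (y (W1 U) x)) - L2_inner \<Omega> (\<lambda>x. B j x * P1 (W1 U) x) h\<bar>
        \<le> C1 * (L2_norm \<Omega> (\<lambda>x. B j x * h x))\<^sup>2"
        using P1(4)[OF WL(1)[OF U'] WL(1)[OF V'] W_near(1)[OF U] W_near(1)[OF V]] unfolding W_upd h_def[symmetric] by simp
      also have "\<dots> \<le> C1 * (b\<^sup>2 * (L2_norm \<Omega> h)\<^sup>2)" using sq P1(2) by (intro mult_left_mono) auto
      finally show ?thesis .
    qed
    have t2: "\<bar>(LINT x|lebesgue_on \<Omega>. eJ e j x * y (W2 (U(j := v))) x) - (LINT x|lebesgue_on \<Omega>. eJ e j x * y (W2 U) x) - L2_inner \<Omega> (\<lambda>x. B j x * P2 (W2 U) x) h\<bar>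
        \<le> C2 * (b\<^sup>2 * (L2_norm \<Omega> h)\<^sup>2)"
    proof -
      have "L2_inner \<Omega> (\<lambda>x. B j x * P2 (W2 U) x) h = L2_inner \<Omega> (P2 (W2 U)) (\<lambda>x. B j x * h x)"
        by (simp add: L2_inner_def mult_ac)
      then have "\<bar>(LINT x|lebesgue_on \<Omega>. eJ e j x * y (W2 (U(j := v))) x) - (LINT x|lebesgue_on \<Omega>. eJ e j x * y (W2 U) x) - L2_inner \<Omega> (\<lambda>x. B j x * P2 (W2 U) x) h\<bar>
        \<le> C2 * (L2_norm \<Omega> (\<lambda>x. B j x * h x))\<^sup>2"
        using P2(4)[OF WL(2)[OF U'] WL(2)[OF V'] W_near(2)[OF U] W_near(2)[OF V]] unfolding W_upd h_def[symmetric] by simp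
      also have "\<dots> \<le> C2 * (b\<^sup>2 * (L2_norm \<Omega> h)\<^sup>2)" using sq P2(2) by (intro mult_left_mono) auto
      finally show ?thesis .
    qed
    define s where "s x = U j x + eY e x" for x
    have sL: "s \<in> L2 \<Omega>" unfolding s_def[abs_def] by (rule UL[OF U])
    note \<zeta>s = L2_mult_Linf[OF \<zeta> sL] and \<zeta>h = L2_mult_Linf[OF \<zeta> hL]
    have t3: "1/2 * (LINT x|lebesgue_on \<Omega>. \<zeta> j x * (v x + eY e x)\<^sup>2) - 1/2 * (LINT x|lebesgue_on \<Omega>. \<zeta> j x * (U j x + eY e x)\<^sup>2)
        = L2_inner \<Omega> (\<lambda>x. \<zeta> j x * s x) h + 1/2 * L2_inner \<Omega> (\<lambda>x. \<zeta> j x * h x) h"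
    proof -
      have "(\<lambda>x. \<zeta> j x * (v x + eY e x)\<^sup>2) = (\<lambda>x. \<zeta> j x * s x * s x + 2 * (\<zeta> j x * s x * h x) + \<zeta> j x * h x * h x)"
        by (rule ext) (simp add: s_def h_def power2_eq_square algebra_simps)
      then have "(LINT x|lebesgue_on \<Omega>. \<zeta> j x * (v x + eY e x)\<^sup>2)
          = (LINT x|lebesgue_on \<Omega>. \<zeta> j x * s x * s x) + 2 * L2_inner \<Omega> (\<lambda>x. \<zeta> j x * s x) h + L2_inner \<Omega> (\<lambda>x. \<zeta> j x * h x) h"
        using L2_integrable_mult[OF \<zeta>s sL] L2_integrable_mult[OF \<zeta>s hL] L2_integrable_mult[OF \<zeta>h hL]
        by (simp add: L2_inner_def)
      moreover have "(LINT x|lebesgue_on \<Omega>. \<zeta> j x * (U j x + eY e x)\<^sup>2) = (LINT x|lebesgue_on \<Omega>. \<zeta> j x * s x * s x)"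
        by (simp add: s_def power2_eq_square mult.assoc)
      ultimately show ?thesis by (simp add: add_divide_distrib)
    qed
    have "\<bar>L2_inner \<Omega> (\<lambda>x. \<zeta> j x * h x) h\<bar> \<le> L2_norm \<Omega> (\<lambda>x. \<zeta> j x * h x) * L2_norm \<Omega> h" by (rule L2.cauchy_schwarz[OF \<zeta>h hL])
    also have "\<dots> \<le> (C\<zeta> * L2_norm \<Omega> h) * L2_norm \<Omega> h"
      by (intro mult_right_mono L2_mult_bounded(2)[OF Linf_measurable[OF \<zeta>] hL C\<zeta>(2,1)] h0)
    finally have t4: "\<bar>L2_inner \<Omega> (\<lambda>x. \<zeta> j x * h x) h\<bar> \<le> C\<zeta> * (L2_norm \<Omega> h)\<^sup>2" by (simp add: power2_eq_square mult.assoc)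
    have "L2_inner \<Omega> (G U) h = L2_inner \<Omega> (\<lambda>x. B j x * P1 (W1 U) x) h + L2_inner \<Omega> (\<lambda>x. B j x * P2 (W2 U) x) h
        + L2_inner \<Omega> (\<lambda>x. \<zeta> j x * s x) h"
      unfolding G_def[abs_def] s_def[symmetric]
      by (simp only: L2.ip_add_left[OF L2_add[OF BL(1)[OF PL(1)[OF U]] BL(1)[OF PL(2)[OF U]]] \<zeta>s hL]
          L2.ip_add_left[OF BL(1)[OF PL(1)[OF U]] BL(1)[OF PL(2)[OF U]] hL])
    moreover have "J_pert \<Omega> \<zeta> B L y j e (U(j := v)) = (LINT x|lebesgue_on \<Omega>. L j x (y (W1 (U(j := v))) x)) +
      1/2 * (LINT x|lebesgue_on \<Omega>. \<zeta> j x * (v x + eY e x)\<^sup>2) + (LINT x|lebesgue_on \<Omega>. eJ e j x * y (W2 (U(j := v))) x)"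
      by (simp add: J_eq)
    moreover have "0 \<le> C\<zeta> * (L2_norm \<Omega> h)\<^sup>2" using C\<zeta>(1) by simp
    ultimately have "\<bar>J_pert \<Omega> \<zeta> B L y j e (U(j := v)) - J_pert \<Omega> \<zeta> B L y j e U - L2_inner \<Omega> (G U) h\<bar>
        \<le> C1 * (b\<^sup>2 * (L2_norm \<Omega> h)\<^sup>2) + C2 * (b\<^sup>2 * (L2_norm \<Omega> h)\<^sup>2) + C\<zeta> * (L2_norm \<Omega> h)\<^sup>2"
      using t1 t2 t3 t4 J_eq[of U] by linarith
    also have "\<dots> = C * (L2_norm \<Omega> h)\<^sup>2" by (simp add: C_def algebra_simps)
    finally show ?thesis by (simp add: h_def[abs_def])
  qed
  have lip: "L2_norm \<Omega> (\<lambda>x. G (U(i := v)) x - G U x) \<le> C * L2_dist \<Omega> v (U i)"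
    if U: "near U" and v: "v \<in> L2 \<Omega>" "L2_dist \<Omega> v (ubar i) < r" for U i v
  proof -
    have U': "U \<in> L2m \<Omega>" using U by (simp add: near_def)
    note V = near_upd[OF U v]
    have V': "U(i := v) \<in> L2m \<Omega>" using V by (simp add: near_def)
    define h where "h x = v x - U i x" for x
    have hL: "h \<in> L2 \<Omega>" unfolding h_def[abs_def] by (rule L2_diff[OF v(1) L2m_D[OF U']])
    have h0: "0 \<le> L2_norm \<Omega> h" by (rule L2.nrm_nonneg[OF hL])
    note Bh = BL[OF hL, of i]
    define p1 where "p1 x = P1 (W1 (U(i := v))) x - P1 (W1 U) x" for x
    define p2 where "p2 x = P2 (W2 (U(i := v))) x - P2 (W2 U) x" for x
    have pL: "p1 \<in> L2 \<Omega>" "p2 \<in> L2 \<Omega>"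
      unfolding p1_def[abs_def] p2_def[abs_def] by (intro L2_diff PL U V)+
    have "L2_norm \<Omega> p1 \<le> C1 * L2_norm \<Omega> (\<lambda>x. B i x * h x)"
      using P1(5)[OF WL(1)[OF U'] WL(1)[OF V'] W_near(1)[OF U] W_near(1)[OF V]] unfolding W_upd h_def[symmetric] p1_def[symmetric] .
    also have "\<dots> \<le> C1 * (b * L2_norm \<Omega> h)" using Bh(2) P1(2) by (intro mult_left_mono) auto
    finally have n1: "L2_norm \<Omega> p1 \<le> C1 * (b * L2_norm \<Omega> h)" .
    have "L2_norm \<Omega> p2 \<le> C2 * L2_norm \<Omega> (\<lambda>x. B i x * h x)"
      using P2(5)[OF WL(2)[OF U'] WL(2)[OF V'] W_near(2)[OF U] W_near(2)[OF V]] unfolding W_upd h_def[symmetric] p2_def[symmetric] .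
    also have "\<dots> \<le> C2 * (b * L2_norm \<Omega> h)" using Bh(2) P2(2) by (intro mult_left_mono) auto
    finally have n2: "L2_norm \<Omega> p2 \<le> C2 * (b * L2_norm \<Omega> h)" .
    \<comment> \<open>The control cost reacts only to the player's own control: \<open>s\<close>
      vanishes unless the component moved is \<open>j\<close>.\<close>
    define s where "s x = (U(i := v)) j x - U j x" for x
    have sL: "s \<in> L2 \<Omega>" unfolding s_def[abs_def] by (rule L2_diff[OF L2m_D[OF V'] L2m_D[OF U']])
    have n3: "L2_norm \<Omega> s \<le> L2_norm \<Omega> h"
    proof (cases "i = j")
      case True
      then have "s = h" by (simp add: s_def h_def fun_eq_iff)
      then show ?thesis by simp
    next
      case False
      then have "s = (\<lambda>x. 0)" by (simp add: s_def fun_eq_iff)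
      then show ?thesis using h0 by (simp add: L2_norm_def L2_inner_def)
    qed
    have "(\<lambda>x. G (U(i := v)) x - G U x) = (\<lambda>x. (B j x * p1 x + B j x * p2 x) + \<zeta> j x * s x)"
      by (rule ext) (simp add: G_def p1_def p2_def s_def algebra_simps)
    then have "L2_norm \<Omega> (\<lambda>x. G (U(i := v)) x - G U x) \<le> L2_norm \<Omega> (\<lambda>x. B j x * p1 x + B j x * p2 x) + L2_norm \<Omega> (\<lambda>x. \<zeta> j x * s x)"
      using L2.nrm_add_le[OF L2_add[OF BL(1)[OF pL(1)] BL(1)[OF pL(2)]] L2_mult_Linf[OF \<zeta> sL], of j j] by simp
    also have "L2_norm \<Omega> (\<lambda>x. B j x * p1 x + B j x * p2 x) \<le> L2_norm \<Omega> (\<lambda>x. B j x * p1 x) + L2_norm \<Omega> (\<lambda>x. B j x * p2 x)"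
      by (rule L2.nrm_add_le[OF BL(1)[OF pL(1)] BL(1)[OF pL(2)]])
    also have "L2_norm \<Omega> (\<lambda>x. B j x * p1 x) \<le> b * (C1 * (b * L2_norm \<Omega> h))"
      using BL(2)[OF pL(1), of j] mult_left_mono[OF n1, of b] b by linarith
    also have "L2_norm \<Omega> (\<lambda>x. B j x * p2 x) \<le> b * (C2 * (b * L2_norm \<Omega> h))"
      using BL(2)[OF pL(2), of j] mult_left_mono[OF n2, of b] b by linarith
    also have "L2_norm \<Omega> (\<lambda>x. \<zeta> j x * s x) \<le> C\<zeta> * L2_norm \<Omega> h"
      using L2_mult_bounded(2)[OF Linf_measurable[OF \<zeta>] sL C\<zeta>(2,1)] mult_left_mono[OF n3 C\<zeta>(1)] by linarith
    also have "b * (C1 * (b * L2_norm \<Omega> h)) + b * (C2 * (b * L2_norm \<Omega> h)) + C\<zeta> * L2_norm \<Omega> h = C * L2_norm \<Omega> h"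
      by (simp add: C_def power2_eq_square algebra_simps)
    finally show ?thesis by (simp add: h_def[abs_def])
  qed
  have "\<forall>U. near U \<longrightarrow> G U \<in> L2 \<Omega> \<and>
      (\<forall>v\<in>L2 \<Omega>. L2_dist \<Omega> v (ubar j) < r \<longrightarrow>
        \<bar>J_pert \<Omega> \<zeta> B L y j e (U(j := v)) - J_pert \<Omega> \<zeta> B L y j e U - L2_inner \<Omega> (G U) (\<lambda>x. v x - U j x)\<bar>
          \<le> C * (L2_dist \<Omega> v (U j))\<^sup>2) \<and>
      (\<forall>i. \<forall>v\<in>L2 \<Omega>. L2_dist \<Omega> v (ubar i) < r \<longrightarrow>
        L2_norm \<Omega> (\<lambda>x. G (U(i := v)) x - G U x) \<le> C * L2_dist \<Omega> v (U i))"
    using GL expand lip by blast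
  then show ?thesis unfolding near_def using r C by blast
qed

end

section \<open>Full stability and Nash equilibria\<close>

text \<open>With both parameters equal to \<open>ebar\<close>, the parameter term disappears from
  the stability estimate.\<close>

lemma param_dist_self: "param_dist \<Omega> e e = 0"
proof -
  have z: "L2_norm \<Omega> (\<lambda>x. 0) = 0" by (simp add: L2_norm_def L2_inner_def)
  have "Linf_norm \<Omega> (\<lambda>x. 0) = 0"
  \<comment> \<open>On a domain of measure zero the essential supremum is -\<infinity>, which
    \<open>real_of_ereal\<close> sends to 0.\<close>
  proof (cases "emeasure (lebesgue_on \<Omega>) (space (lebesgue_on \<Omega>)) = 0")
    case True
    then have "ae_filter (lebesgue_on \<Omega>) = bot" by (simp only: ae_filter_eq_bot_iff)
    then show ?thesis by (simp add: Linf_norm_def esssup_def Limsup_bot bot_ereal_def)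
  next
    case False
    then show ?thesis using esssup_const[of "lebesgue_on \<Omega>" "0::ereal"] by (simp add: Linf_norm_def zero_ereal_def)
  qed
  with z show ?thesis by (simp add: param_dist_def)
qed

text \<open>Pointwise truncation to the interval. At almost every point the truncated value lies
  between \<open>x\<close> and the admissible \<open>u\<close>, which bounds it by
  \<open>\<bar>x\<bar> + \<bar>u\<bar>\<close> and puts it in L2; the variational inequality holds
  already pointwise.\<close>

lemma box_projection:
  assumes lo: "lo \<in> Linf \<Omega>" and hi: "hi \<in> Linf \<Omega>" and le: "AE x in lebesgue_on \<Omega>. lo x \<le> hi x"
    and x: "x \<in> L2 \<Omega>" and u: "u \<in> L2 \<Omega>" "AE t in lebesgue_on \<Omega>. lo t \<le> u t \<and> u t \<le> hi t"
  shows "\<exists>v\<in>L2 \<Omega>. (AE t in lebesgue_on \<Omega>. lo t \<le> v t \<and> v t \<le> hi t) \<and>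
    (\<forall>w\<in>L2 \<Omega>. (AE t in lebesgue_on \<Omega>. lo t \<le> w t \<and> w t \<le> hi t) \<longrightarrow>
      L2_inner \<Omega> (\<lambda>t. x t - v t) (\<lambda>t. w t - v t) \<le> 0)"
proof (intro bexI conjI ballI impI)
  define v where "v t = max (lo t) (min (hi t) (x t))" for t
  note [measurable] = Linf_measurable[OF lo] Linf_measurable[OF hi] L2_measurable[OF x]
  have vm: "v \<in> borel_measurable (lebesgue_on \<Omega>)" unfolding v_def[abs_def] by measurable
  show v: "v \<in> L2 \<Omega>"
  proof (rule L2_dominated[OF vm L2_add[OF L2_abs[OF x] L2_abs[OF u(1)]]])
    show "AE t in lebesgue_on \<Omega>. \<bar>v t\<bar> \<le> \<bar>\<bar>x t\<bar> + \<bar>u t\<bar>\<bar>"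
      using u(2) by eventually_elim (auto simp: v_def)
  qed
  show "AE t in lebesgue_on \<Omega>. lo t \<le> v t \<and> v t \<le> hi t" using le by eventually_elim (simp add: v_def)
  fix w assume w: "w \<in> L2 \<Omega>" and wb: "AE t in lebesgue_on \<Omega>. lo t \<le> w t \<and> w t \<le> hi t"
  have "AE t in lebesgue_on \<Omega>. (x t - v t) * (w t - v t) \<le> 0"
    using wb
  proof eventually_elim
    case (elim t)
    consider "x t < lo t" | "hi t < x t" | "lo t \<le> x t" "x t \<le> hi t" by linarith
    then show ?case
    proof cases
      case 1
      then have "v t = lo t" using elim by (simp add: v_def)
      then show ?thesis using 1 elim by (simp add: mult_nonpos_nonneg)
    next
      case 2
      then have "v t = hi t" using elim by (simp add: v_def)
      then show ?thesis using 2 elim by (simp add: mult_nonneg_nonpos)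
    next
      case 3
      then have "v t = x t" by (simp add: v_def)
      then show ?thesis by simp
    qed
  qed
  then have "AE t in lebesgue_on \<Omega>. 0 \<le> - ((x t - v t) * (w t - v t))" by eventually_elim simp
  then have "0 \<le> (LINT t|lebesgue_on \<Omega>. - ((x t - v t) * (w t - v t)))" by (rule integral_nonneg_AE)
  then show "L2_inner \<Omega> (\<lambda>t. x t - v t) (\<lambda>t. w t - v t) \<le> 0" by (simp add: L2_inner_def)
qed

lemma has_L2_gradientI:
  assumes g: "g \<in> L2 \<Omega>" and C: "C > 0" and \<delta>: "\<delta> > 0"
    and est: "\<And>h. h \<in> L2 \<Omega> \<Longrightarrow> L2_norm \<Omega> h < \<delta> \<Longrightarrow>
      \<bar>\<Phi> (\<lambda>x. u x + h x) - \<Phi> u - L2_inner \<Omega> g h\<bar> \<le> C * (L2_norm \<Omega> h)\<^sup>2"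
  shows "has_L2_gradient \<Omega> \<Phi> u g"
  unfolding has_L2_gradient_def
proof (intro conjI allI impI g)
  fix \<epsilon> :: real assume \<epsilon>: "\<epsilon> > 0"
  show "\<exists>\<delta>>0. \<forall>h\<in>L2 \<Omega>. L2_norm \<Omega> h < \<delta> \<longrightarrow>
        \<bar>\<Phi> (\<lambda>x. u x + h x) - \<Phi> u - L2_inner \<Omega> g h\<bar> \<le> \<epsilon> * L2_norm \<Omega> h"
  proof (intro exI[of _ "min \<delta> (\<epsilon> / C)"] conjI ballI impI)
    show "min \<delta> (\<epsilon> / C) > 0" using \<delta> \<epsilon> C by simp
    fix h assume h: "h \<in> L2 \<Omega>" and s: "L2_norm \<Omega> h < min \<delta> (\<epsilon> / C)"
    have "\<bar>\<Phi> (\<lambda>x. u x + h x) - \<Phi> u - L2_inner \<Omega> g h\<bar> \<le> C * (L2_norm \<Omega> h)\<^sup>2" using s by (intro est h) simp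
    also have "\<dots> = (C * L2_norm \<Omega> h) * L2_norm \<Omega> h" by (simp add: power2_eq_square)
    also have "\<dots> \<le> \<epsilon> * L2_norm \<Omega> h"
      using s C by (intro mult_right_mono L2.nrm_nonneg h) (simp add: field_simps)
    finally show "\<bar>\<Phi> (\<lambda>x. u x + h x) - \<Phi> u - L2_inner \<Omega> g h\<bar> \<le> \<epsilon> * L2_norm \<Omega> h" .
  qed
qed

text \<open>For equal parameters the stability estimate says \<open>\<parallel>a - 2\<kappa>b\<parallel> \<le> \<parallel>a\<parallel>\<close>, which is strong
  monotonicity \<open>\<langle>a, b\<rangle> \<ge> \<kappa>\<parallel>b\<parallel>\<^sup>2\<close> of the inverse of the localization.\<close>

lemma fully_stable_strongly_monotone:
  assumes fs: "fully_stable_exp 1 \<Omega> E S pbar ebar ubar" and ebar: "ebar \<in> E"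
    and SL: "\<And>p u. u \<in> S p ebar \<Longrightarrow> u \<in> L2m \<Omega>" and pbar: "pbar \<in> L2m \<Omega>"
  obtains r \<kappa> where "r > 0" "\<kappa> > 0"
    "\<And>p u. p \<in> L2m \<Omega> \<Longrightarrow> u \<in> S p ebar \<Longrightarrow> L2m_norm \<Omega> (\<lambda>k x. p k x - pbar k x) < r \<Longrightarrow>
      L2m_norm \<Omega> (\<lambda>k x. u k x - ubar k x) < r \<Longrightarrow>
      \<kappa> * (L2m_norm \<Omega> (\<lambda>k x. u k x - ubar k x))\<^sup>2 \<le> L2m_inner \<Omega> (\<lambda>k x. p k x - pbar k x) (\<lambda>k x. u k x - ubar k x)"
proof -
  have ubarS: "ubar \<in> S pbar ebar" using fs by (simp add: fully_stable_exp_def)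
  obtain Vp Ve Vu \<theta> \<kappa> l where V: "nbhd_L2m \<Omega> pbar Vp" "nbhd_param \<Omega> E ebar Ve" "nbhd_L2m \<Omega> ubar Vu"
    and \<kappa>: "\<kappa> > 0"
    and loc: "\<forall>p\<in>Vp. \<forall>e\<in>Ve. \<theta> p e \<in> S p e \<inter> Vu \<and> (\<forall>v\<in>S p e \<inter> Vu. ae_eq \<Omega> v (\<theta> p e))"
    and est: "\<forall>p1\<in>Vp. \<forall>p2\<in>Vp. \<forall>e1\<in>Ve. \<forall>e2\<in>Ve.
           L2m_norm \<Omega> (\<lambda>k x. (p1 k x - p2 k x) - 2 * \<kappa> * (\<theta> p1 e1 k x - \<theta> p2 e2 k x))
             \<le> L2m_norm \<Omega> (\<lambda>k x. p1 k x - p2 k x) + l * param_dist \<Omega> e1 e2 powr 1"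
    using fs unfolding fully_stable_exp_def by blast
  obtain rp where rp: "rp > 0" "\<And>v. v \<in> L2m \<Omega> \<Longrightarrow> L2m_norm \<Omega> (\<lambda>k x. v k x - pbar k x) < rp \<Longrightarrow> v \<in> Vp"
    using V(1) unfolding nbhd_L2m_def by blast
  obtain ru where ru: "ru > 0" "\<And>v. v \<in> L2m \<Omega> \<Longrightarrow> L2m_norm \<Omega> (\<lambda>k x. v k x - ubar k x) < ru \<Longrightarrow> v \<in> Vu"
    using V(3) unfolding nbhd_L2m_def by blast
  have eV: "ebar \<in> Ve" using V(2) ebar param_dist_self[of \<Omega> ebar] unfolding nbhd_param_def by auto
  have ubarL: "ubar \<in> L2m \<Omega>" by (rule SL[OF ubarS])
  have pV: "pbar \<in> Vp"
    by (rule rp(2)[OF pbar]) (simp add: rp(1) L2m_norm_def L2m_inner_def L2_inner_def)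
  have uV: "ubar \<in> Vu"
    by (rule ru(2)[OF ubarL]) (simp add: ru(1) L2m_norm_def L2m_inner_def L2_inner_def)
  have mono: "\<kappa> * (L2m_norm \<Omega> (\<lambda>k x. u k x - ubar k x))\<^sup>2 \<le> L2m_inner \<Omega> (\<lambda>k x. p k x - pbar k x) (\<lambda>k x. u k x - ubar k x)"
    if p: "p \<in> L2m \<Omega>" and u: "u \<in> S p ebar" and pr: "L2m_norm \<Omega> (\<lambda>k x. p k x - pbar k x) < rp"
      and ur: "L2m_norm \<Omega> (\<lambda>k x. u k x - ubar k x) < ru" for p u
  proof -
    have pVp: "p \<in> Vp" by (rule rp(2)[OF p pr])
    have uL: "u \<in> L2m \<Omega>" by (rule SL[OF u])
    have uVu: "u \<in> Vu" by (rule ru(2)[OF uL ur])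
    define a where "a k x = p k x - pbar k x" for k x
    define b where "b k x = u k x - ubar k x" for k x
    \<comment> \<open>The localization returns some representative of the solution. The estimate is
      available for \<open>b'\<close> and is carried over to \<open>b\<close> by equality almost
      everywhere.\<close>
    define b' where "b' k x = \<theta> p ebar k x - \<theta> pbar ebar k x" for k x
    have \<theta>S: "\<theta> p ebar \<in> S p ebar" "\<theta> pbar ebar \<in> S pbar ebar" using loc pVp pV eV by blast+
    have eq: "ae_eq \<Omega> u (\<theta> p ebar)" "ae_eq \<Omega> ubar (\<theta> pbar ebar)"
      using loc pVp pV eV u ubarS uVu uV by blast+
    have aL: "a \<in> L2m \<Omega>" unfolding a_def[abs_def] by (rule L2m.sub_closed[OF p pbar])
    have bL: "b \<in> L2m \<Omega>" unfolding b_def[abs_def] by (rule L2m.sub_closed[OF uL ubarL])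
    have b'L: "b' \<in> L2m \<Omega>" unfolding b'_def[abs_def] by (rule L2m.sub_closed[OF SL SL]; rule \<theta>S)
    have c: "(\<lambda>k x. a k x - 2 * \<kappa> * b k x) \<in> L2m \<Omega>" "(\<lambda>k x. a k x - 2 * \<kappa> * b' k x) \<in> L2m \<Omega>"
      using L2m.sub_closed[OF aL L2m.sc_closed[OF bL, of "2 * \<kappa>"]] L2m.sub_closed[OF aL L2m.sc_closed[OF b'L, of "2 * \<kappa>"]] by simp_all
    have "ae_eq \<Omega> (\<lambda>k x. a k x - 2 * \<kappa> * b k x) (\<lambda>k x. a k x - 2 * \<kappa> * b' k x)"
      unfolding ae_eq_def
    proof
      fix k
      have "AE x in lebesgue_on \<Omega>. u k x = \<theta> p ebar k x" "AE x in lebesgue_on \<Omega>. ubar k x = \<theta> pbar ebar k x"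
        using eq by (auto simp: ae_eq_def)
      then show "AE x in lebesgue_on \<Omega>. a k x - 2 * \<kappa> * b k x = a k x - 2 * \<kappa> * b' k x"
        by eventually_elim (simp add: b_def b'_def)
    qed
    from L2m_norm_cong_AE[OF c this]
    have "L2m_norm \<Omega> (\<lambda>k x. a k x - 2 * \<kappa> * b k x) = L2m_norm \<Omega> (\<lambda>k x. a k x - 2 * \<kappa> * b' k x)" .
    also have "\<dots> \<le> L2m_norm \<Omega> (\<lambda>k x. p k x - pbar k x) + l * param_dist \<Omega> ebar ebar powr 1"
      unfolding a_def b'_def using est pVp pV eV by blast
    also have "\<dots> = L2m_norm \<Omega> a" by (simp add: param_dist_self a_def[abs_def])
    finally have "(L2m_norm \<Omega> (\<lambda>k x. a k x - 2 * \<kappa> * b k x))\<^sup>2 \<le> (L2m_norm \<Omega> a)\<^sup>2"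
      by (rule power_mono) (rule L2m.nrm_nonneg[OF c(1)])
    \<comment> \<open>Expanding the square cancels the norm of \<open>a\<close>; dividing by
      \<open>4 * \<kappa>\<close> leaves strong monotonicity.\<close>
    moreover have "(L2m_norm \<Omega> (\<lambda>k x. a k x - 2 * \<kappa> * b k x))\<^sup>2
        = (L2m_norm \<Omega> a)\<^sup>2 - 4 * \<kappa> * L2m_inner \<Omega> a b + 4 * \<kappa>\<^sup>2 * (L2m_norm \<Omega> b)\<^sup>2"
      using L2m.nrm_sq[OF L2m.sub_closed[OF aL L2m.sc_closed[OF bL, of "2 * \<kappa>"]]]
        L2m.ip_sym[OF bL aL] L2m.nrm_sq[OF aL] L2m.nrm_sq[OF bL]
      by (simp add: L2m.ip_rules aL bL L2m.sc_closed L2m.sub_closed power2_eq_square algebra_simps)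
    ultimately have "(4 * \<kappa>) * (\<kappa> * (L2m_norm \<Omega> b)\<^sup>2) \<le> (4 * \<kappa>) * L2m_inner \<Omega> a b"
      by (simp add: power2_eq_square)
    then have "\<kappa> * (L2m_norm \<Omega> b)\<^sup>2 \<le> L2m_inner \<Omega> a b" using \<kappa> by simp
    then show ?thesis by (simp add: a_def[abs_def] b_def[abs_def])
  qed
  show ?thesis
    by (rule that[of "min rp ru" \<kappa>]) (use rp(1) ru(1) \<kappa> mono in auto)
qed

theorem theorem4p13:
  fixes \<Omega> :: "(real^'n::finite) set"
    and a :: "'n \<Rightarrow> 'n \<Rightarrow> real^'n \<Rightarrow> real"
    and f :: "real^'n \<Rightarrow> real \<Rightarrow> real"
    and L :: "'m::finite \<Rightarrow> real^'n \<Rightarrow> real \<Rightarrow> real"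
    and \<zeta> B \<alpha> \<beta> :: "'m \<Rightarrow> real^'n \<Rightarrow> real"
    and y :: "(real^'n \<Rightarrow> real) \<Rightarrow> real^'n \<Rightarrow> real"
    and E\<^sub>Y :: "(real^'n \<Rightarrow> real) set"
    and E\<^sub>J :: "'m \<Rightarrow> (real^'n \<Rightarrow> real) set"
    and E\<^sub>B :: "'m \<Rightarrow> ((real^'n \<Rightarrow> real) \<times> (real^'n \<Rightarrow> real)) set"
    and E :: "(real^'n, 'm) param set"
    and S :: "('m \<Rightarrow> real^'n \<Rightarrow> real) \<Rightarrow> (real^'n, 'm) param \<Rightarrow> ('m \<Rightarrow> real^'n \<Rightarrow> real) set"
    and ubarstar ubar :: "'m \<Rightarrow> real^'n \<Rightarrow> real"
    and ebar :: "(real^'n, 'm) param"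
    and \<rho> :: real
  assumes "CARD('n) \<in> {1, 2, 3}"
    and "open \<Omega>" and "bounded \<Omega>" and "connected \<Omega>" and "\<Omega> \<noteq> {}" and "lipschitz_boundary \<Omega>"
    and "\<And>i j. a i j \<in> Linf \<Omega>" and "elliptic \<Omega> a"
    and "\<And>k. \<zeta> k \<in> Linf \<Omega>" and "\<And>k. B k \<in> Linf \<Omega>"
    and "\<And>k. \<exists>\<zeta>\<^sub>0>0. AE x in lebesgue_on \<Omega>. \<zeta> k x \<ge> \<zeta>\<^sub>0"
    and "nonlinearity_assms \<Omega> f" and "\<And>k. integrand_assms \<Omega> (L k)"
    and "state_map \<Omega> a f y"
    and "E\<^sub>Y \<subseteq> L2 \<Omega>" and "\<And>k. E\<^sub>J k \<subseteq> L2 \<Omega>" and "\<And>k. E\<^sub>B k \<subseteq> Linf \<Omega> \<times> Linf \<Omega>"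
    and E: "E = param_space E\<^sub>Y E\<^sub>J E\<^sub>B"
    and "\<And>k. \<alpha> k \<in> Linf \<Omega>" and "\<And>k. \<beta> k \<in> Linf \<Omega>"
    and "\<And>k. AE x in lebesgue_on \<Omega>. \<alpha> k x < \<beta> k x"
    and S: "S = solution_map \<Omega> \<zeta> B L y \<alpha> \<beta>"
    and "ubarstar \<in> L2m \<Omega>" and "ebar \<in> E" and "ubar \<in> S ubarstar ebar"
    and "\<rho> > 0" and "\<And>e. e \<in> E \<Longrightarrow> param_dist \<Omega> e ebar \<le> \<rho> \<Longrightarrow> Uad \<Omega> \<alpha> \<beta> e \<noteq> {}"
    and "fully_stable \<Omega> E S ubarstar ebar ubar"
  shows "local_nash_equilibrium \<Omega> \<zeta> B L y \<alpha> \<beta> ubarstar ebar ubar"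
proof -
  note \<zeta> = assms(9) and B = assms(10) and L = assms(13) and pbar = assms(23) and ebar = assms(24)
    and ubarS = assms(25) and stable = assms(28)
  interpret state_equation \<Omega> a f y
    by unfold_locales (rule assms(2), rule assms(3), rule assms(7), rule assms(8), rule assms(12), rule assms(14))
  have eY: "eY ebar \<in> L2 \<Omega>" and eJ: "\<And>k. eJ ebar k \<in> L2 \<Omega>"
    using ebar assms(15,16) unfolding E param_space_def by blast+
  have eB: "(e\<alpha> ebar k, e\<beta> ebar k) \<in> E\<^sub>B k" for k
    using ebar unfolding E param_space_def by blast
  have e\<alpha>: "e\<alpha> ebar k \<in> Linf \<Omega>" and e\<beta>: "e\<beta> ebar k \<in> Linf \<Omega>" for k
    using eB[of k] assms(17)[of k] by blast+
  have ubar_ad: "ubar k \<in> Uad_k \<Omega> \<alpha> \<beta> ebar k" for k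
    using ubarS unfolding S solution_map_def Uad_def by blast
  have Uad_L2: "Uad_k \<Omega> \<alpha> \<beta> ebar k \<subseteq> L2 \<Omega>" for k unfolding Uad_k_def by blast
  have ubar: "ubar \<in> L2m \<Omega>" using ubar_ad Uad_L2 unfolding L2m_def by blast
  obtain N where N: "N \<in> normal_cone \<Omega> ubar (Uad \<Omega> \<alpha> \<beta> ebar)"
    and pbar_eq: "ae_eq \<Omega> ubarstar (\<lambda>k x. F_map \<Omega> \<zeta> B L y ubar ebar k x + N k x)"
    using ubarS unfolding S solution_map_def by blast
  have NL: "N \<in> L2m \<Omega>" and N_le: "\<And>v. v \<in> Uad \<Omega> \<alpha> \<beta> ebar \<Longrightarrow> L2m_inner \<Omega> N (\<lambda>k x. v k x - ubar k x) \<le> 0"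
    using N unfolding normal_cone_def by (auto split: if_splits)
  \<comment> \<open>Pairing with a deviation of one player sees that player's component only. This
    reduces statements about the game to statements about one player.\<close>
  have inner_upd: "L2m_inner \<Omega> p (\<lambda>j x. (ubar(k := v)) j x - ubar j x) = L2_inner \<Omega> (p k) (\<lambda>x. v x - ubar k x)" for p k v
  proof -
    have "L2m_inner \<Omega> p (\<lambda>j x. (ubar(k := v)) j x - ubar j x)
        = (\<Sum>j\<in>UNIV. if j = k then L2_inner \<Omega> (p k) (\<lambda>x. v x - ubar k x) else 0)"
      unfolding L2m_inner_def by (rule sum.cong) (auto simp: L2_inner_def)
    then show ?thesis by simp
  qed
  have upd_ad: "ubar(k := v) \<in> Uad \<Omega> \<alpha> \<beta> ebar" if "v \<in> Uad_k \<Omega> \<alpha> \<beta> ebar k" for k v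
    using ubar_ad that unfolding Uad_def by simp
  have N_le': "L2_inner \<Omega> (N k) (\<lambda>x. v x - ubar k x) \<le> 0" if "v \<in> Uad_k \<Omega> \<alpha> \<beta> ebar k" for k v
    using N_le[OF upd_ad[OF that]] unfolding inner_upd .
  \<comment> \<open>Radius, constant and gradient are packed into one triple per player, so that a
    single choice covers all players.\<close>
  have "\<forall>j. \<exists>p. (\<lambda>(r, C, G). partial_gradient \<Omega> (J_pert \<Omega> \<zeta> B L y j ebar) ubar j r C G) p"
    unfolding split_paired_Ex split_conv
    by (intro allI perturbed_cost_expansion B \<zeta> L eY eJ ubar)
  from choice[OF this] obtain q where q: "\<And>j. (\<lambda>(r, C, G). partial_gradient \<Omega> (J_pert \<Omega> \<zeta> B L y j ebar) ubar j r C G) (q j)" by blast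
  define R where "R j = fst (q j)" for j
  define C where "C j = fst (snd (q j))" for j
  define G where "G j = snd (snd (q j))" for j
  note q' = q[unfolded case_prod_beta, folded R_def C_def G_def]
  have R: "R j > 0" and C: "C j > 0" for j using q'[of j] by blast+
  define r0 where "r0 = Min (range R)"
  have r0: "r0 > 0" "\<And>j. r0 \<le> R j" using R by (auto simp: r0_def)
  define near where "near U \<longleftrightarrow> U \<in> L2m \<Omega> \<and> (\<forall>i. L2_dist \<Omega> (U i) (ubar i) < r0)" for U
  have nearR: "U \<in> L2m \<Omega> \<and> (\<forall>i. L2_dist \<Omega> (U i) (ubar i) < R j)" if "near U" for U j
    using that order_less_le_trans[OF _ r0(2)[of j]] unfolding near_def by blast
  have GL: "G j U \<in> L2 \<Omega>" if "near U" for j U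
    using q'[of j] nearR[OF that, of j] by blast
  have expand: "\<bar>J_pert \<Omega> \<zeta> B L y j ebar (U(j := v)) - J_pert \<Omega> \<zeta> B L y j ebar U - L2_inner \<Omega> (G j U) (\<lambda>x. v x - U j x)\<bar>
          \<le> C j * (L2_dist \<Omega> v (U j))\<^sup>2"
    if "near U" "v \<in> L2 \<Omega>" "L2_dist \<Omega> v (ubar j) < r0" for U v j
    using q'[of j] nearR[OF that(1), of j] that(2,3) order_less_le_trans[OF that(3) r0(2)[of j]] by blast
  have lip: "L2_norm \<Omega> (\<lambda>x. G j (U(i := v)) x - G j U x) \<le> C j * L2_dist \<Omega> v (U i)"
    if "near U" "v \<in> L2 \<Omega>" "L2_dist \<Omega> v (ubar i) < r0" for U v i j
    using q'[of j] nearR[OF that(1), of j] that(2,3) order_less_le_trans[OF that(3) r0(2)[of j]] by blast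
  have zero: "L2_dist \<Omega> u u = 0" for u by (simp add: L2_norm_def L2_inner_def)
  have near_upd: "near (ubar(k := v))" if "v \<in> L2 \<Omega>" "L2_dist \<Omega> v (ubar k) < r0" for k v
    using that ubar r0(1) zero unfolding near_def by (auto intro: L2m_update)
  have near_ubar: "near ubar" unfolding near_def using ubar r0(1) zero by auto
  have grad_G: "has_L2_gradient \<Omega> (\<lambda>v. J_pert \<Omega> \<zeta> B L y j ebar (U(j := v))) (U j) (G j U)" if U: "near U" for j U
  proof (rule has_L2_gradientI[OF GL[OF U] C])
    have U': "U \<in> L2m \<Omega>" "L2_dist \<Omega> (U j) (ubar j) < r0" using U unfolding near_def by blast+
    show "r0 - L2_dist \<Omega> (U j) (ubar j) > 0" using U' by simp
    fix h assume h: "h \<in> L2 \<Omega>" "L2_norm \<Omega> h < r0 - L2_dist \<Omega> (U j) (ubar j)"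
    have v: "(\<lambda>x. U j x + h x) \<in> L2 \<Omega>" by (rule L2_add[OF L2m_D[OF U'(1)] h(1)])
    have "(\<lambda>x. U j x + h x - ubar j x) = (\<lambda>x. (U j x - ubar j x) + h x)" by (simp add: algebra_simps)
    then have "L2_norm \<Omega> (\<lambda>x. U j x + h x - ubar j x) < r0"
      using L2.nrm_add_le[OF L2_diff[OF L2m_D[OF U'(1)] L2m_D[OF ubar]] h(1), of j j] h(2) by simp
    from expand[OF U v this]
    show "\<bar>J_pert \<Omega> \<zeta> B L y j ebar (U(j := \<lambda>x. U j x + h x)) - J_pert \<Omega> \<zeta> B L y j ebar (U(j := U j)) - L2_inner \<Omega> (G j U) h\<bar>
        \<le> C j * (L2_norm \<Omega> h)\<^sup>2" by simp
  qed
  have F_grad: "has_L2_gradient \<Omega> (\<lambda>v. J_pert \<Omega> \<zeta> B L y j ebar (U(j := v))) (U j) (F_map \<Omega> \<zeta> B L y U ebar j)" if "near U" for j U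
    unfolding F_map_def L2_gradient_def by (rule someI[of _ "G j U"]) (rule grad_G[OF that])
  \<comment> \<open>\<open>F_map\<close> is some gradient, \<open>G\<close> the one with the
    Lipschitz estimate. They agree only almost everywhere, hence the almost-everywhere transfers
    below.\<close>
  have F_eq: "AE x in lebesgue_on \<Omega>. F_map \<Omega> \<zeta> B L y U ebar j x = G j U x" if "near U" for j U
    by (rule has_L2_gradient_unique[OF F_grad[OF that] grad_G[OF that]])
  have FL: "F_map \<Omega> \<zeta> B L y U ebar j \<in> L2 \<Omega>" if "near U" for j U
    using F_grad[OF that, of j] by (simp add: has_L2_gradient_def)
  have SL: "u \<in> L2m \<Omega>" if "u \<in> S p ebar" for p u
    using that Uad_L2 unfolding S solution_map_def Uad_def L2m_def by blast
  obtain s \<kappa> where s: "s > 0" and \<kappa>: "\<kappa> > 0"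
    and strong: "\<And>p u. p \<in> L2m \<Omega> \<Longrightarrow> u \<in> S p ebar \<Longrightarrow> L2m_norm \<Omega> (\<lambda>k x. p k x - ubarstar k x) < s \<Longrightarrow>
      L2m_norm \<Omega> (\<lambda>k x. u k x - ubar k x) < s \<Longrightarrow>
      \<kappa> * (L2m_norm \<Omega> (\<lambda>k x. u k x - ubar k x))\<^sup>2 \<le> L2m_inner \<Omega> (\<lambda>k x. p k x - ubarstar k x) (\<lambda>k x. u k x - ubar k x)"
    using stable ebar SL pbar unfolding fully_stable_def lipschitzian_fully_stable_def
    by (elim conjE) (rule fully_stable_strongly_monotone[of \<Omega> E S ubarstar ebar ubar]; blast)

  \<comment> \<open>The problem of a single player\<close>
  show ?thesis
    unfolding local_nash_equilibrium_def
  proof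
    fix k
    define K where "K = Uad_k \<Omega> \<alpha> \<beta> ebar k"
    define \<phi> where "\<phi> v = J_pert \<Omega> \<zeta> B L y k ebar (ubar(k := v)) - L2_inner \<Omega> (ubarstar k) v" for v
    \<comment> \<open>The gradient of \<open>\<phi>\<close>.\<close>
    define g where "g v x = G k (ubar(k := v)) x - ubarstar k x" for v x
    \<comment> \<open>Moving the control of player \<open>k\<close> changes the gradients of all
      players; their constants add up.\<close>
    define Cs where "Cs = (\<Sum>j\<in>UNIV. C j)"
    have Cs: "Cs > 0" unfolding Cs_def by (intro sum_pos C) auto
    \<comment> \<open>The three bounds keep the gradients defined, keep \<open>U\<close> in the
      range of strong monotonicity, and limit the gradient changes of all players to
      \<open>s / 2\<close>. The remaining \<open>s / 2\<close> is left for the residual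
      \<open>g v + n\<close> of player \<open>k\<close>.\<close>
    define r where "r = min r0 (min s (s / (2 * Cs)))"
    have r: "r > 0" "r \<le> r0" "r \<le> s" "Cs * r \<le> s / 2"
    proof -
      show "r > 0" using r0(1) s Cs by (simp add: r_def)
      show "r \<le> r0" "r \<le> s" by (simp_all add: r_def)
      have "r \<le> s / (2 * Cs)" by (simp add: r_def)
      then show "Cs * r \<le> s / 2" using Cs by (simp add: field_simps)
    qed
    have KL: "v \<in> L2 \<Omega>" if "v \<in> K" for v using that Uad_L2 unfolding K_def by blast
    have pk: "ubarstar k \<in> L2 \<Omega>" by (rule L2m_D[OF pbar])
    have uk: "ubar k \<in> L2 \<Omega>" by (rule L2m_D[OF ubar])
    have nv: "near (ubar(k := v))" if "v \<in> K" "L2_dist \<Omega> v (ubar k) < r" for v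
      using near_upd[OF KL[OF that(1)]] that(2) r(2) by simp
    have "\<exists>\<epsilon>>0. \<forall>v\<in>K. L2_dist \<Omega> v (ubar k) \<le> \<epsilon> \<longrightarrow> \<phi> (ubar k) \<le> \<phi> v"
    proof (rule L2.projected_gradient_minimum[where r = r and Lp = "C k" and s = "s / 2" and \<kappa> = \<kappa> and g = g and \<Omega> = \<Omega>])
      show "K \<subseteq> L2 \<Omega>" using KL by blast
      show "ubar k \<in> K" unfolding K_def by (rule ubar_ad)
      show "r > 0" "C k > 0" "s / 2 > 0" "\<kappa> > 0" using r C s \<kappa> by simp_all
    next
      fix v assume v: "v \<in> K" "L2_dist \<Omega> v (ubar k) < r"
      show "g v \<in> L2 \<Omega>" unfolding g_def[abs_def] by (rule L2_diff[OF GL[OF nv[OF v]] pk])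
    next
      fix v w assume vw: "v \<in> K" "w \<in> K" "L2_dist \<Omega> v (ubar k) < r" "L2_dist \<Omega> w (ubar k) < r"
      note Uv = nv[OF vw(1,3)] and Uw = nv[OF vw(2,4)]
      have wr: "L2_dist \<Omega> w (ubar k) < r0" and vr: "L2_dist \<Omega> v (ubar k) < r0"
        using vw r(2) by simp_all
      have vL: "v \<in> L2 \<Omega>" and wL: "w \<in> L2 \<Omega>" using vw KL by blast+
      have "L2_inner \<Omega> (g v) (\<lambda>x. w x - v x) = L2_inner \<Omega> (G k (ubar(k := v))) (\<lambda>x. w x - v x)
          - (L2_inner \<Omega> (ubarstar k) w - L2_inner \<Omega> (ubarstar k) v)"
        unfolding g_def[abs_def]
        by (simp only: L2.ip_sub_left[OF GL[OF Uv] pk L2_diff[OF wL vL]] L2.ip_sub_right[OF wL vL pk])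
      moreover have "\<bar>J_pert \<Omega> \<zeta> B L y k ebar (ubar(k := w)) - J_pert \<Omega> \<zeta> B L y k ebar (ubar(k := v))
          - L2_inner \<Omega> (G k (ubar(k := v))) (\<lambda>x. w x - v x)\<bar> \<le> C k * (L2_dist \<Omega> w v)\<^sup>2"
        using expand[OF Uv wL wr] by simp
      ultimately show "\<phi> w \<le> \<phi> v + L2_inner \<Omega> (g v) (\<lambda>x. w x - v x) + C k * (L2_dist \<Omega> w v)\<^sup>2"
        unfolding \<phi>_def by linarith
      \<comment> \<open>\<open>ubar(k := v)\<close> is regarded as an update of
        \<open>ubar(k := w)\<close>, so that the Lipschitz estimate for one changed component
        applies.\<close>
      have "(\<lambda>x. g v x - g w x) = (\<lambda>x. G k ((ubar(k := w))(k := v)) x - G k (ubar(k := w)) x)"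
        by (simp add: g_def)
      then show "L2_dist \<Omega> (g v) (g w) \<le> C k * L2_dist \<Omega> v w"
        using lip[OF Uw vL vr, of k] by simp
    next
      fix x assume x: "x \<in> L2 \<Omega>"
      have ub: "AE t in lebesgue_on \<Omega>. \<alpha> k t + e\<alpha> ebar k t \<le> ubar k t \<and> ubar k t \<le> \<beta> k t + e\<beta> ebar k t"
        using ubar_ad[of k] unfolding Uad_k_def by blast
      then have le: "AE t in lebesgue_on \<Omega>. \<alpha> k t + e\<alpha> ebar k t \<le> \<beta> k t + e\<beta> ebar k t" by eventually_elim linarith
      show "\<exists>v\<in>K. \<forall>w\<in>K. L2_inner \<Omega> (\<lambda>t. x t - v t) (\<lambda>t. w t - v t) \<le> 0"
        using box_projection[OF Linf_add[OF assms(19) e\<alpha>] Linf_add[OF assms(20) e\<beta>] le x uk ub]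
        unfolding K_def Uad_k_def by blast
    next
      fix w assume w: "w \<in> K"
      have wu: "(\<lambda>x. w x - ubar k x) \<in> L2 \<Omega>" by (rule L2_diff[OF KL[OF w] uk])
      have "AE x in lebesgue_on \<Omega>. ubarstar k x = F_map \<Omega> \<zeta> B L y ubar ebar k x + N k x"
        using pbar_eq by (simp add: ae_eq_def)
      then have "AE x in lebesgue_on \<Omega>. g (ubar k) x = -1 * N k x"
        using F_eq[OF near_ubar, of k] by eventually_elim (simp add: g_def)
      \<comment> \<open>At the reference point the gradient is minus the normal component
        \<open>N k\<close>, which turns normality into criticality.\<close>
      then have "L2_inner \<Omega> (g (ubar k)) (\<lambda>x. w x - ubar k x) = L2_inner \<Omega> (\<lambda>x. -1 * N k x) (\<lambda>x. w x - ubar k x)"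
        unfolding g_def[abs_def] fun_upd_triv
        by (intro L2_inner_cong_AE L2_diff GL near_ubar pk L2_scale L2m_D[OF NL] wu) auto
      also have "\<dots> = - L2_inner \<Omega> (N k) (\<lambda>x. w x - ubar k x)"
        by (simp only: L2.ip_sc_left[OF L2m_D[OF NL] wu])
      finally show "0 \<le> L2_inner \<Omega> (g (ubar k)) (\<lambda>x. w x - ubar k x)"
        using N_le'[of w k] w unfolding K_def by simp
    next
      fix v n
      assume v: "v \<in> K" "L2_dist \<Omega> v (ubar k) < r" and n: "n \<in> L2 \<Omega>"
        and normal: "\<And>w. w \<in> K \<Longrightarrow> L2_inner \<Omega> n (\<lambda>x. w x - v x) \<le> 0"
        and small: "L2_norm \<Omega> (\<lambda>x. g v x + n x) < s / 2"
      define U where "U = ubar(k := v)"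
      have U: "near U" unfolding U_def by (rule nv[OF v])
      have UL: "U \<in> L2m \<Omega>" using U by (simp add: near_def)
      have U_ad: "U \<in> Uad \<Omega> \<alpha> \<beta> ebar" unfolding U_def using v(1) unfolding K_def by (rule upd_ad)
      \<comment> \<open>The admissible set is a product, so normality may be tested player by
        player: the old normals remain valid for \<open>j \<noteq> k\<close> because those controls
        do not move.\<close>
      define N' where "N' = N(k := n)"
      have N'L: "N' \<in> L2m \<Omega>" unfolding N'_def by (rule L2m_update[OF NL n])
      have "L2m_inner \<Omega> N' (\<lambda>j x. w j x - U j x) \<le> 0" if w: "w \<in> Uad \<Omega> \<alpha> \<beta> ebar" for w
        unfolding L2m_inner_def
      proof (rule sum_nonpos)
        fix j
        have wj: "w j \<in> Uad_k \<Omega> \<alpha> \<beta> ebar j" using w unfolding Uad_def by blast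
        show "L2_inner \<Omega> (N' j) (\<lambda>x. w j x - U j x) \<le> 0"
          using N_le'[OF wj] normal[of "w k"] wj by (cases "j = k") (simp_all add: N'_def U_def K_def)
      qed
      then have N': "N' \<in> normal_cone \<Omega> U (Uad \<Omega> \<alpha> \<beta> ebar)" unfolding normal_cone_def using N'L U_ad by simp
      \<comment> \<open>The right-hand side for which \<open>U\<close> solves the variational
        inequality by construction.\<close>
      define p where "p = (\<lambda>j x. F_map \<Omega> \<zeta> B L y U ebar j x + N' j x)"
      have pL: "p \<in> L2m \<Omega>" using L2_add[OF FL[OF U] L2m_D[OF N'L]] unfolding p_def L2m_def by blast
      have "ae_eq \<Omega> p (\<lambda>j x. F_map \<Omega> \<zeta> B L y U ebar j x + N' j x)" unfolding p_def ae_eq_def by simp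
      then have US: "U \<in> S p ebar" unfolding S solution_map_def using U_ad N' by blast
      have U_diff: "(\<lambda>j x. U j x - ubar j x) = (\<lambda>j x. (ubar(k := v)) j x - ubar j x)" by (simp add: U_def)
      have U_norm: "L2m_norm \<Omega> (\<lambda>j x. U j x - ubar j x) = L2_dist \<Omega> v (ubar k)"
        unfolding L2m_norm_def L2_norm_def U_diff inner_upd by simp
      have gv: "AE x in lebesgue_on \<Omega>. p k x - ubarstar k x = g v x + n x"
        using F_eq[OF U, of k] by eventually_elim (simp add: p_def g_def N'_def U_def)
      have gvL: "(\<lambda>x. g v x + n x) \<in> L2 \<Omega>"
        unfolding g_def[abs_def] by (rule L2_add[OF L2_diff[OF GL[OF nv[OF v]] pk] n])
      have pdL: "(\<lambda>x. p j x - ubarstar j x) \<in> L2 \<Omega>" for j by (rule L2_diff[OF L2m_D[OF pL] L2m_D[OF pbar]])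
      \<comment> \<open>For \<open>j \<noteq> k\<close> the normals cancel and only the change of
        the gradient remains. For \<open>j = k\<close> the distance is the residual; the second
        summand is slack that makes the bound uniform in \<open>j\<close>.\<close>
      have pj: "L2_dist \<Omega> (p j) (ubarstar j) \<le> (if j = k then L2_norm \<Omega> (\<lambda>x. g v x + n x) else 0) + C j * L2_dist \<Omega> v (ubar k)" for j
      proof (cases "j = k")
        case True
        have "0 \<le> C j * L2_dist \<Omega> v (ubar k)"
          using C[of j] L2.nrm_nonneg[OF L2_diff[OF KL[OF v(1)] uk]] by simp
        then show ?thesis using L2_norm_cong_AE[OF pdL gvL] gv True by simp
      next
        case False
        have "AE x in lebesgue_on \<Omega>. ubarstar j x = F_map \<Omega> \<zeta> B L y ubar ebar j x + N j x"
          using pbar_eq by (simp add: ae_eq_def)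
        then have "AE x in lebesgue_on \<Omega>. p j x - ubarstar j x = G j U x - G j ubar x"
          using F_eq[OF U, of j] F_eq[OF near_ubar, of j]
          by eventually_elim (use False in \<open>simp add: p_def N'_def\<close>)
        then have "L2_dist \<Omega> (p j) (ubarstar j) = L2_norm \<Omega> (\<lambda>x. G j U x - G j ubar x)"
          by (intro L2_norm_cong_AE pdL L2_diff GL U near_ubar)
        also have "\<dots> \<le> C j * L2_dist \<Omega> v (ubar k)"
          unfolding U_def using v(2) r(2) by (intro lip[OF near_ubar KL[OF v(1)]]) simp
        finally show ?thesis using False by simp
      qed
      have "L2m_norm \<Omega> (\<lambda>j x. p j x - ubarstar j x) \<le> (\<Sum>j\<in>UNIV. L2_dist \<Omega> (p j) (ubarstar j))"
        by (rule L2m_norm_le_sum[OF L2m.sub_closed[OF pL pbar]])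
      also have "\<dots> \<le> (\<Sum>j\<in>UNIV. (if j = k then L2_norm \<Omega> (\<lambda>x. g v x + n x) else 0) + C j * L2_dist \<Omega> v (ubar k))"
        by (intro sum_mono pj)
      also have "\<dots> = L2_norm \<Omega> (\<lambda>x. g v x + n x) + Cs * L2_dist \<Omega> v (ubar k)"
        by (simp add: sum.distrib Cs_def sum_distrib_right)
      also have "\<dots> < s / 2 + Cs * r"
        using small v(2) Cs by (intro add_less_le_mono mult_left_mono) auto
      also have "\<dots> \<le> s" using r(4) by simp
      finally have p_norm: "L2m_norm \<Omega> (\<lambda>j x. p j x - ubarstar j x) < s" .
      have "L2m_norm \<Omega> (\<lambda>j x. U j x - ubar j x) < s" unfolding U_norm using v(2) r(3) by simp
      from strong[OF pL US p_norm this]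
      have "\<kappa> * (L2_dist \<Omega> v (ubar k))\<^sup>2 \<le> L2_inner \<Omega> (\<lambda>x. p k x - ubarstar k x) (\<lambda>x. v x - ubar k x)"
        unfolding U_norm unfolding U_diff inner_upd .
      also have "\<dots> = L2_inner \<Omega> (\<lambda>x. g v x + n x) (\<lambda>x. v x - ubar k x)"
        by (rule L2_inner_cong_AE[OF pdL L2_diff[OF KL[OF v(1)] uk] gvL L2_diff[OF KL[OF v(1)] uk] gv]) simp
      finally show "\<kappa> * (L2_dist \<Omega> v (ubar k))\<^sup>2 \<le> L2_inner \<Omega> (\<lambda>x. g v x + n x) (\<lambda>x. v x - ubar k x)" .
    qed
    then obtain \<epsilon> where \<epsilon>: "\<epsilon> > 0" "\<And>v. v \<in> K \<Longrightarrow> L2_dist \<Omega> v (ubar k) \<le> \<epsilon> \<Longrightarrow> \<phi> (ubar k) \<le> \<phi> v" by blast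
    show "\<exists>\<epsilon>>0. is_arg_min (\<lambda>v. J_pert \<Omega> \<zeta> B L y k ebar (ubar(k := v)) - L2_inner \<Omega> (ubarstar k) v)
       (\<lambda>v. v \<in> Uad_k \<Omega> \<alpha> \<beta> ebar k \<and> L2_dist \<Omega> v (ubar k) \<le> \<epsilon>) (ubar k)"
    proof (intro exI[of _ \<epsilon>] conjI \<epsilon>(1))
      show "is_arg_min (\<lambda>v. J_pert \<Omega> \<zeta> B L y k ebar (ubar(k := v)) - L2_inner \<Omega> (ubarstar k) v)
       (\<lambda>v. v \<in> Uad_k \<Omega> \<alpha> \<beta> ebar k \<and> L2_dist \<Omega> v (ubar k) \<le> \<epsilon>) (ubar k)"
        unfolding is_arg_min_def
      proof (intro conjI notI)
        show "ubar k \<in> Uad_k \<Omega> \<alpha> \<beta> ebar k" by (rule ubar_ad)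
        show "L2_dist \<Omega> (ubar k) (ubar k) \<le> \<epsilon>" unfolding zero using \<epsilon>(1) by simp
        assume "\<exists>v. (v \<in> Uad_k \<Omega> \<alpha> \<beta> ebar k \<and> L2_dist \<Omega> v (ubar k) \<le> \<epsilon>) \<and>
          J_pert \<Omega> \<zeta> B L y k ebar (ubar(k := v)) - L2_inner \<Omega> (ubarstar k) v <
          J_pert \<Omega> \<zeta> B L y k ebar (ubar(k := ubar k)) - L2_inner \<Omega> (ubarstar k) (ubar k)"
        then obtain v where "v \<in> K" "L2_dist \<Omega> v (ubar k) \<le> \<epsilon>" "\<phi> v < \<phi> (ubar k)"
          unfolding \<phi>_def K_def by blast
        then show False using \<epsilon>(2)[of v] by simp
      qed
    qed
  qed
qed

end
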